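(* Let $F_1$ and $F_2$ be function fields over $\mathbb R$ of transcendence degree $\ge1$, both contained in a common extension field of $\mathbb R$ and linearly disjoint over $\mathbb R$, and let $F=F_1F_2$ be their compositum. Then the image of every compatible embedding $\iota:M(F_1)\times M(F_2)\to M(F)$ is dense in $M(F)$, and every non-empty basic open subset of $M(F)$ contains infinitely many places that are not in the image of $\iota$.
   Context: A function field over $\mathbb R$ is a finitely generated field extension of $\mathbb R$. For a field $K$, $M(K)$ is the set of $\mathbb R$-places $K\to\mathbb R\cup\{\infty\}$, with topology generated by the subbasis $H'(b)=\{\zeta\in M(K)\mid \infty\ne\zeta(b)>0\}$, $b\in K$; basic open sets are finite intersections of such sets. Let $\rho:M(F)\to M(F_1)\times M(F_2)$, $\xi\mapsto(\xi|_{F_1},\xi|_{F_2})$; a compatible embedding is an injective map $\iota:M(F_1)\times M(F_2)\to M(F)$ with $\rho\circ\iota=\mathrm{id}$. *)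

theory Defs
  imports "HOL-Analysis.Analysis" "HOL-Computational_Algebra.Polynomial"
begin

text \<open>The common extension field of the reals is modelled by a type of class real_field
(a field containing the reals via of_real).  Subfields containing the reals are sets.\<close>

definition is_R_subfield :: "'a::real_field set \<Rightarrow> bool" where
  "is_R_subfield K \<longleftrightarrow> range of_real \<subseteq> K \<and>
     (\<forall>x\<in>K. \<forall>y\<in>K. x + y \<in> K \<and> x * y \<in> K) \<and>
     (\<forall>x\<in>K. - x \<in> K \<and> inverse x \<in> K)"

definition field_gen :: "'a::real_field set \<Rightarrow> 'a set" where
  "field_gen S = \<Inter> {K. is_R_subfield K \<and> S \<subseteq> K}"

definition function_field :: "'a::real_field set \<Rightarrow> bool" where
  "function_field F \<longleftrightarrow> is_R_subfield F \<and> (\<exists>S. finite S \<and> S \<subseteq> F \<and> F = field_gen S)"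

definition R_transcendental :: "'a::real_field \<Rightarrow> bool" where
  "R_transcendental x \<longleftrightarrow> (\<forall>p :: real poly. p \<noteq> 0 \<longrightarrow> poly (map_poly of_real p) x \<noteq> 0)"

text \<open>Transcendence degree at least 1 over the reals: a transcendence basis is non-empty,
i.e. some element is algebraically independent (transcendental) over the reals.\<close>
definition trdeg_ge_1 :: "'a::real_field set \<Rightarrow> bool" where
  "trdeg_ge_1 F \<longleftrightarrow> (\<exists>x\<in>F. R_transcendental x)"

definition linearly_disjoint :: "'a::real_field set \<Rightarrow> 'a set \<Rightarrow> bool" where
  "linearly_disjoint F1 F2 \<longleftrightarrow>
     (\<forall>S. finite S \<and> S \<subseteq> F1 \<and> \<not> dependent S \<longrightarrow>
        (\<forall>c. (\<forall>s\<in>S. c s \<in> F2) \<and> (\<Sum>s\<in>S. c s * s) = 0 \<longrightarrow> (\<forall>s\<in>S. c s = 0)))"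

text \<open>R-places K \<rightarrow> R \<union> {\<infinity>}; None represents \<infinity>.  A place is made extensional
by sending elements outside K to None.\<close>
type_synonym 'a place = "'a \<Rightarrow> real option"

definition is_place :: "'a::real_field set \<Rightarrow> 'a place \<Rightarrow> bool" where
  "is_place K \<zeta> \<longleftrightarrow>
     (\<forall>x. x \<notin> K \<longrightarrow> \<zeta> x = None) \<and>
     \<zeta> 1 = Some 1 \<and>
     (\<forall>x\<in>K. \<forall>y\<in>K. \<zeta> x \<noteq> None \<and> \<zeta> y \<noteq> None \<longrightarrow>
        \<zeta> (x + y) = Some (the (\<zeta> x) + the (\<zeta> y)) \<and>
        \<zeta> (x * y) = Some (the (\<zeta> x) * the (\<zeta> y))) \<and>
     (\<forall>x\<in>K. \<zeta> x = None \<longrightarrow> \<zeta> (inverse x) = Some 0)"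

definition M :: "'a::real_field set \<Rightarrow> 'a place set" where
  "M K = {\<zeta>. is_place K \<zeta>}"

definition H' :: "'a::real_field set \<Rightarrow> 'a \<Rightarrow> 'a place set" where
  "H' K b = {\<zeta> \<in> M K. \<exists>r. \<zeta> b = Some r \<and> r > 0}"

definition M_top :: "'a::real_field set \<Rightarrow> 'a place topology" where
  "M_top K = topology_generated_by {H' K b | b. b \<in> K}"

definition basic_open :: "'a::real_field set \<Rightarrow> 'a place set \<Rightarrow> bool" where
  "basic_open K U \<longleftrightarrow> (\<exists>B. finite B \<and> B \<subseteq> K \<and> U = M K \<inter> \<Inter> (H' K ` B))"

definition restr :: "'a set \<Rightarrow> 'a place \<Rightarrow> 'a place" where
  "restr F \<zeta> = (\<lambda>x. if x \<in> F then \<zeta> x else None)"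

definition rho :: "'a set \<Rightarrow> 'a set \<Rightarrow> 'a place \<Rightarrow> 'a place \<times> 'a place" where
  "rho F1 F2 \<xi> = (restr F1 \<xi>, restr F2 \<xi>)"

definition compatible_embedding ::
  "'a::real_field set \<Rightarrow> 'a set \<Rightarrow> 'a set \<Rightarrow> ('a place \<times> 'a place \<Rightarrow> 'a place) \<Rightarrow> bool" where
  "compatible_embedding F1 F2 F \<iota> \<longleftrightarrow>
     inj_on \<iota> (M F1 \<times> M F2) \<and>
     (\<forall>p \<in> M F1 \<times> M F2. \<iota> p \<in> M F \<and> rho F1 F2 (\<iota> p) = p)"

end

theory Submission
  imports "HOL-Algebra.Algebraic_Closure_Type" Defs
begin

text \<open>
  Let \<open>\<xi>\<close> be a place in a basic open set given by finitely many \<open>b \<in> F\<close>.  It induces an ordering of \<open>F\<close>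
  in which every \<open>b\<close> is positive, so by the Artin--Lang theorem there is a real point of a product
  \<open>V1 \<times> V2\<close> of affine models of \<open>F1\<close> and \<open>F2\<close> at which every \<open>b\<close> is defined and positive.  The two
  components can be chosen to be limits of generic points, hence they are centres of places \<open>\<zeta>1\<close>, \<open>\<zeta>2\<close>
  of \<open>F1\<close>, \<open>F2\<close>, and every place of \<open>F\<close> above \<open>(\<zeta>1, \<zeta>2)\<close>, in particular \<open>\<iota> (\<zeta>1, \<zeta>2)\<close>, lies in the
  basic open set.

  There are infinitely many such places and at most one of them is in the image of \<open>\<iota>\<close>: if \<open>t1\<close>, \<open>t2\<close>
  are positive infinitesimals for orderings of \<open>F1\<close>, \<open>F2\<close> inducing \<open>\<zeta>1\<close>, \<open>\<zeta>2\<close>, then for every real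
  \<open>c > 0\<close> some ordering of \<open>F\<close> extends both and makes \<open>t1 / t2\<close> infinitely close to \<open>c\<close>.  By
  compactness it suffices to find points of \<open>V1\<close> and \<open>V2\<close> respecting finitely many sign conditions
  whose values of \<open>t1\<close> and \<open>t2\<close> have a quotient close to \<open>c\<close>; such points exist because the
  Artin--Lang theorem allows the value of an infinitesimal to be prescribed.
\<close>

section \<open>Subalgebras and homomorphisms to the reals\<close>

text \<open>All steps speak of real-valued homomorphisms on subalgebras of the ambient field, that
  is, of real points at which the elements of the subalgebra are defined. Orderings and points are
  exchanged in both directions. Artin--Lang leads from an ordering to a point; it is proved inside a
  real closure by adjoining generators one at a time. Compactness leads from points to an ordering:
  strict sign conditions are realised by an ordering as soon as any finitely many of them hold at a
  point where any given finite set of elements is defined. The obstacle to this second direction is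
  denominators: an element of the field is a fraction whose denominator may vanish at the point. It
  is overcome by moving the point slightly until a prescribed nonzero element no longer vanishes,
  which is possible where the generators take values that are simple roots of their mapped minimal
  polynomials. Linear disjointness enters in that points chosen independently for the two fields
  always combine to a point of the compositum. Transcendence degree at least one supplies the
  infinitesimal on each side.\<close>

definition subalg :: "'a::real_field set \<Rightarrow> bool" where
  "subalg A \<longleftrightarrow> range of_real \<subseteq> A \<and> (\<forall>x\<in>A. \<forall>y\<in>A. x + y \<in> A \<and> x * y \<in> A)"

text \<open>Homomorphisms are total functions constrained only on \<open>A\<close>, so restricting
  one to a smaller algebra leaves the function itself unchanged.\<close>

definition alg_hom :: "'a::real_field set \<Rightarrow> ('a \<Rightarrow> real) \<Rightarrow> bool" where
  "alg_hom A \<phi> \<longleftrightarrow> (\<forall>r. \<phi> (of_real r) = r) \<and>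
     (\<forall>x\<in>A. \<forall>y\<in>A. \<phi> (x + y) = \<phi> x + \<phi> y \<and> \<phi> (x * y) = \<phi> x * \<phi> y)"

definition alg :: "'a::real_field set \<Rightarrow> 'a set" where
  "alg G = {x. \<forall>A. subalg A \<and> G \<subseteq> A \<longrightarrow> x \<in> A}"

definition coeffs_in :: "'a::real_field set \<Rightarrow> 'a poly \<Rightarrow> bool" where
  "coeffs_in A p \<longleftrightarrow> (\<forall>i. coeff p i \<in> A)"

definition adjoin :: "'a::real_field set \<Rightarrow> 'a \<Rightarrow> 'a set" where
  "adjoin A x = {poly p x |p. coeffs_in A p}"

lemma subalg_of_real: "subalg A \<Longrightarrow> of_real r \<in> A"
  by (auto simp: subalg_def)

lemma subalg_add: "subalg A \<Longrightarrow> x \<in> A \<Longrightarrow> y \<in> A \<Longrightarrow> x + y \<in> A"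
  and subalg_mult: "subalg A \<Longrightarrow> x \<in> A \<Longrightarrow> y \<in> A \<Longrightarrow> x * y \<in> A"
  by (auto simp: subalg_def)

lemma subalg_0: "subalg A \<Longrightarrow> 0 \<in> A" and subalg_1: "subalg A \<Longrightarrow> 1 \<in> A"
  using subalg_of_real[of A 0] subalg_of_real[of A 1] by auto

lemma subalg_uminus: "subalg A \<Longrightarrow> x \<in> A \<Longrightarrow> - x \<in> A"
  using subalg_mult[OF _ subalg_of_real[of A "-1"], of x] by simp

lemma subalg_diff: "subalg A \<Longrightarrow> x \<in> A \<Longrightarrow> y \<in> A \<Longrightarrow> x - y \<in> A"
  using subalg_add[of A x "- y"] subalg_uminus[of A y] by simp

lemma subalg_power: "subalg A \<Longrightarrow> x \<in> A \<Longrightarrow> x ^ n \<in> A"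
  by (induction n) (auto intro: subalg_mult subalg_1)

lemma subalg_sum: "subalg A \<Longrightarrow> (\<And>i. i \<in> I \<Longrightarrow> f i \<in> A) \<Longrightarrow> sum f I \<in> A"
  by (induction I rule: infinite_finite_induct) (auto intro: subalg_0 subalg_add)

lemma subalg_prod: "subalg A \<Longrightarrow> (\<And>i. i \<in> I \<Longrightarrow> f i \<in> A) \<Longrightarrow> prod f I \<in> A"
  by (induction I rule: infinite_finite_induct) (auto intro: subalg_1 subalg_mult)

lemma subalg_of_nat: "subalg A \<Longrightarrow> of_nat n \<in> A"
  using subalg_of_real[of A "of_nat n"] by simp

lemmas subalg_closed = subalg_of_real subalg_add subalg_mult subalg_0 subalg_1 subalg_uminus
  subalg_diff subalg_power subalg_sum subalg_prod subalg_of_nat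

lemma subalg_R_subfield: "is_R_subfield K \<Longrightarrow> subalg K"
  by (auto simp: is_R_subfield_def subalg_def)

lemma R_subfield_inverse: "is_R_subfield K \<Longrightarrow> x \<in> K \<Longrightarrow> inverse x \<in> K"
  by (auto simp: is_R_subfield_def)

lemma R_subfield_divide: "is_R_subfield K \<Longrightarrow> x \<in> K \<Longrightarrow> y \<in> K \<Longrightarrow> x / y \<in> K"
  unfolding divide_inverse by (intro subalg_mult subalg_R_subfield R_subfield_inverse)

lemma subalg_alg: "subalg (alg G)"
  unfolding subalg_def[of "alg G"] by (auto simp: alg_def subalg_closed)

lemma alg_superset: "G \<subseteq> alg G"
  unfolding alg_def by blast

lemma alg_least: "subalg A \<Longrightarrow> G \<subseteq> A \<Longrightarrow> alg G \<subseteq> A"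
  unfolding alg_def by blast

lemma alg_mono: "G \<subseteq> H \<Longrightarrow> alg G \<subseteq> alg H"
  by (meson alg_least alg_superset subalg_alg subset_trans)

section \<open>Polynomials with coefficients in a subalgebra\<close>

lemma coeffs_in_simps:
  assumes "subalg A"
  shows "coeffs_in A 0" "coeffs_in A 1"
    "coeffs_in A (pCons a p) \<longleftrightarrow> a \<in> A \<and> coeffs_in A p"
  using assms by (auto simp: coeffs_in_def coeff_pCons subalg_closed split: nat.splits)

lemma coeffs_in_add: "subalg A \<Longrightarrow> coeffs_in A p \<Longrightarrow> coeffs_in A q \<Longrightarrow> coeffs_in A (p + q)"
  by (auto simp: coeffs_in_def subalg_closed)

lemma coeffs_in_diff: "subalg A \<Longrightarrow> coeffs_in A p \<Longrightarrow> coeffs_in A q \<Longrightarrow> coeffs_in A (p - q)"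
  by (auto simp: coeffs_in_def subalg_closed)

lemma coeffs_in_mult: "subalg A \<Longrightarrow> coeffs_in A p \<Longrightarrow> coeffs_in A q \<Longrightarrow> coeffs_in A (p * q)"
  by (auto simp: coeffs_in_def coeff_mult intro!: subalg_sum subalg_mult)

lemma coeffs_in_smult: "subalg A \<Longrightarrow> a \<in> A \<Longrightarrow> coeffs_in A p \<Longrightarrow> coeffs_in A (smult a p)"
  by (auto simp: coeffs_in_def subalg_closed)

lemma coeffs_in_monom: "subalg A \<Longrightarrow> a \<in> A \<Longrightarrow> coeffs_in A (monom a n)"
  by (auto simp: coeffs_in_def subalg_closed)

lemma coeffs_in_pderiv: "subalg A \<Longrightarrow> coeffs_in A p \<Longrightarrow> coeffs_in A (pderiv p)"
  unfolding coeffs_in_def coeff_pderiv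
  by (auto intro!: subalg_mult subalg_add subalg_1 subalg_of_nat)

lemma coeffs_in_power: "subalg A \<Longrightarrow> coeffs_in A p \<Longrightarrow> coeffs_in A (p ^ n)"
  by (induction n) (auto simp: coeffs_in_simps intro: coeffs_in_mult)

lemma coeffs_in_mono: "A \<subseteq> B \<Longrightarrow> coeffs_in A p \<Longrightarrow> coeffs_in B p"
  by (auto simp: coeffs_in_def)

lemma coeffs_in_lead_coeff: "coeffs_in A p \<Longrightarrow> lead_coeff p \<in> A"
  by (simp add: coeffs_in_def)

lemmas coeffs_in_closed = coeffs_in_simps(1,2) coeffs_in_add coeffs_in_diff coeffs_in_mult
  coeffs_in_smult coeffs_in_monom coeffs_in_pderiv coeffs_in_power

lemma poly_in_subalg: "subalg A \<Longrightarrow> coeffs_in A p \<Longrightarrow> x \<in> A \<Longrightarrow> poly p x \<in> A"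
  unfolding poly_altdef by (intro subalg_closed) (auto simp: coeffs_in_def)

lemma adjoin_subalg:
  assumes "subalg A" shows "subalg (adjoin A x)"
  unfolding subalg_def
proof (intro conjI ballI subsetI)
  fix y :: 'a assume "y \<in> range of_real"
  then obtain r where "y = of_real r" by auto
  then have "y = poly [:of_real r:] x" "coeffs_in A [:of_real r:]"
    using assms by (auto simp: coeffs_in_simps subalg_closed)
  then show "y \<in> adjoin A x" unfolding adjoin_def by blast
next
  fix y z assume "y \<in> adjoin A x" "z \<in> adjoin A x"
  then obtain p q where pq: "coeffs_in A p" "coeffs_in A q" "y = poly p x" "z = poly q x"
    unfolding adjoin_def by blast
  have "y + z = poly (p + q) x" "y * z = poly (p * q) x" using pq by auto
  then show "y + z \<in> adjoin A x" "y * z \<in> adjoin A x"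
    unfolding adjoin_def using pq coeffs_in_add[OF assms] coeffs_in_mult[OF assms] by blast+
qed

lemma adjoin_superset: "subalg A \<Longrightarrow> A \<subseteq> adjoin A x"
proof
  fix a assume "subalg A" "a \<in> A"
  then have "a = poly [:a:] x" "coeffs_in A [:a:]" by (auto simp: coeffs_in_simps)
  then show "a \<in> adjoin A x" unfolding adjoin_def by blast
qed

lemma adjoin_generator: "subalg A \<Longrightarrow> x \<in> adjoin A x"
proof -
  assume "subalg A"
  then have "x = poly [:0,1:] x" "coeffs_in A [:0,1:]" by (auto simp: coeffs_in_simps subalg_closed)
  then show "x \<in> adjoin A x" unfolding adjoin_def by blast
qed

lemma adjoin_least: "subalg B \<Longrightarrow> A \<subseteq> B \<Longrightarrow> x \<in> B \<Longrightarrow> adjoin A x \<subseteq> B"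
  unfolding adjoin_def using poly_in_subalg coeffs_in_mono by blast

lemma alg_insert: "alg (insert x G) = adjoin (alg G) x"
proof
  show "alg (insert x G) \<subseteq> adjoin (alg G) x"
    by (rule alg_least)
      (use adjoin_subalg[OF subalg_alg] adjoin_superset[OF subalg_alg, of G x]
        adjoin_generator[OF subalg_alg] alg_superset in blast)+
  show "adjoin (alg G) x \<subseteq> alg (insert x G)"
    by (rule adjoin_least) (use subalg_alg alg_superset[of "insert x G"] alg_mono[of G "insert x G"] in auto)
qed

lemma alg_empty: "alg {} = range of_real"
proof
  have "subalg (range of_real :: 'a set)"
    unfolding subalg_def by (auto simp flip: of_real_add of_real_mult)
  then show "alg {} \<subseteq> (range of_real :: 'a set)" by (rule alg_least) auto
  show "range of_real \<subseteq> (alg {} :: 'a set)" using subalg_alg[of "{}"] unfolding subalg_def by blast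
qed

text \<open>Over a ring the leading coefficient of \<open>g\<close> cannot be inverted, so each
  cancellation of a leading term costs one factor of it. The exponent \<open>k\<close> merely counts
  them; what matters later is that this coefficient is nonzero and stays nonzero under the
  homomorphisms considered.\<close>

lemma pseudo_division:
  assumes A: "subalg A" and g: "coeffs_in A g" "g \<noteq> 0"
  shows "coeffs_in A f \<Longrightarrow> \<exists>k q r. coeffs_in A q \<and> coeffs_in A r \<and>
    smult (lead_coeff g ^ k) f = g * q + r \<and> (r = 0 \<or> degree r < degree g)"
proof (induction "degree f" arbitrary: f rule: less_induct)
  case less
  show ?case
  proof (cases "f = 0 \<or> degree f < degree g")
    case True
    then show ?thesis
      by (intro exI[of _ 0] exI[of _ 0] exI[of _ f]) (auto simp: coeffs_in_closed A less.prems)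
  next
    case False
    then have f: "f \<noteq> 0" and deg: "degree g \<le> degree f" by auto
    define m where "m = monom (lead_coeff f) (degree f - degree g)"
    define f' where "f' = smult (lead_coeff g) f - m * g"
    have m: "coeffs_in A m"
      unfolding m_def using A less.prems coeffs_in_lead_coeff by (intro coeffs_in_monom) auto
    have f': "coeffs_in A f'"
      unfolding f'_def using A g m less.prems by (intro coeffs_in_closed) (auto intro: coeffs_in_lead_coeff)
    have "m \<noteq> 0" using f by (auto simp: m_def)
    have dm: "degree m = degree f - degree g" using f by (simp add: m_def degree_monom_eq)
    have "degree (m * g) = degree f"
      using \<open>m \<noteq> 0\<close> g deg dm by (simp add: degree_mult_eq)
    moreover have "coeff (m * g) (degree f) = lead_coeff f * lead_coeff g"
      using coeff_mult_degree_sum[of m g] dm deg f by (simp add: m_def degree_monom_eq)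
    ultimately have "f' = 0 \<or> degree f' < degree f"
      using eq_zero_or_degree_less[of f' "degree f"] degree_diff_le[of "smult (lead_coeff g) f" "degree f" "m * g"]
      unfolding f'_def by simp
    moreover have "\<exists>k q r. coeffs_in A q \<and> coeffs_in A r \<and>
      smult (lead_coeff g ^ k) f' = g * q + r \<and> (r = 0 \<or> degree r < degree g)" if "f' = 0"
      by (intro exI[of _ 0] exI[of _ 0] exI[of _ 0]) (auto simp: coeffs_in_closed A that)
    ultimately obtain k q r where IH: "coeffs_in A q" "coeffs_in A r"
      "smult (lead_coeff g ^ k) f' = g * q + r" "r = 0 \<or> degree r < degree g"
      using less.hyps[of f'] f' by blast
    have "smult (lead_coeff g ^ Suc k) f = smult (lead_coeff g ^ k) (f' + m * g)"
      by (simp add: f'_def mult.commute)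
    also have "\<dots> = g * (q + smult (lead_coeff g ^ k) m) + r"
      by (simp add: smult_add_right IH algebra_simps)
    finally show ?thesis
      using IH A g m
      by (intro exI[of _ "Suc k"] exI[of _ "q + smult (lead_coeff g ^ k) m"] exI[of _ r])
        (auto intro!: coeffs_in_closed subalg_power coeffs_in_lead_coeff)
  qed
qed

lemma division_R_subfield:
  assumes K: "is_R_subfield K" and g: "coeffs_in K g" "g \<noteq> 0" and f: "coeffs_in K f"
  obtains q r where "coeffs_in K q" "coeffs_in K r" "f = g * q + r" "r = 0 \<or> degree r < degree g"
proof -
  note A = subalg_R_subfield[OF K]
  obtain k q r where *: "coeffs_in K q" "coeffs_in K r"
    "smult (lead_coeff g ^ k) f = g * q + r" "r = 0 \<or> degree r < degree g"
    using pseudo_division[OF A g f] by blast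
  define c where "c = inverse (lead_coeff g ^ k)"
  have c: "c \<in> K" unfolding c_def
    using K A g by (intro R_subfield_inverse subalg_power coeffs_in_lead_coeff)
  have "c * lead_coeff g ^ k = 1" using g by (simp add: c_def)
  then have "f = smult c (smult (lead_coeff g ^ k) f)" by simp
  also have "\<dots> = g * smult c q + smult c r" unfolding * by (simp add: smult_add_right)
  finally show ?thesis
    using *(4) degree_smult_le[of c r]
    by (intro that[of "smult c q" "smult c r"] coeffs_in_smult A c *(1,2)) auto
qed

section \<open>Homomorphisms, polynomials and simple ring extensions\<close>

lemma alg_hom_of_real: "alg_hom A \<phi> \<Longrightarrow> \<phi> (of_real r) = r"
  by (auto simp: alg_hom_def)

lemma alg_hom_0: "alg_hom A \<phi> \<Longrightarrow> \<phi> 0 = 0" and alg_hom_1: "alg_hom A \<phi> \<Longrightarrow> \<phi> 1 = 1"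
  using alg_hom_of_real[of A \<phi> 0] alg_hom_of_real[of A \<phi> 1] by auto

lemma alg_hom_add: "alg_hom A \<phi> \<Longrightarrow> x \<in> A \<Longrightarrow> y \<in> A \<Longrightarrow> \<phi> (x + y) = \<phi> x + \<phi> y"
  and alg_hom_mult: "alg_hom A \<phi> \<Longrightarrow> x \<in> A \<Longrightarrow> y \<in> A \<Longrightarrow> \<phi> (x * y) = \<phi> x * \<phi> y"
  by (auto simp: alg_hom_def)

lemma alg_hom_uminus:
  assumes "subalg A" "alg_hom A \<phi>" "x \<in> A" shows "\<phi> (- x) = - \<phi> x"
  using alg_hom_add[of A \<phi> x "- x"] assms by (simp add: subalg_uminus alg_hom_0)

lemma alg_hom_diff:
  assumes "subalg A" "alg_hom A \<phi>" "x \<in> A" "y \<in> A" shows "\<phi> (x - y) = \<phi> x - \<phi> y"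
  using alg_hom_add[of A \<phi> x "- y"] assms by (simp add: subalg_uminus alg_hom_uminus)

lemma alg_hom_power:
  assumes "subalg A" "alg_hom A \<phi>" "x \<in> A" shows "\<phi> (x ^ n) = \<phi> x ^ n"
  by (induction n) (auto simp: assms alg_hom_1[OF assms(2)] alg_hom_mult[OF assms(2)] subalg_power)

lemma alg_hom_sum:
  assumes "subalg A" "alg_hom A \<phi>" "\<And>i. i \<in> I \<Longrightarrow> f i \<in> A"
  shows "\<phi> (sum f I) = (\<Sum>i\<in>I. \<phi> (f i))"
  using assms(3)
  by (induction I rule: infinite_finite_induct)
    (auto simp: assms alg_hom_0[OF assms(2)] alg_hom_add[OF assms(2)] subalg_sum)

lemma alg_hom_prod:
  assumes "subalg A" "alg_hom A \<phi>" "\<And>i. i \<in> I \<Longrightarrow> f i \<in> A"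
  shows "\<phi> (prod f I) = (\<Prod>i\<in>I. \<phi> (f i))"
  using assms(3)
  by (induction I rule: infinite_finite_induct)
    (auto simp: assms alg_hom_1[OF assms(2)] alg_hom_mult[OF assms(2)] subalg_prod)

lemma alg_hom_mono: "alg_hom B \<phi> \<Longrightarrow> A \<subseteq> B \<Longrightarrow> alg_hom A \<phi>"
  unfolding alg_hom_def by blast

lemma alg_hom_map_poly_add:
  assumes "subalg A" "alg_hom A \<phi>" "coeffs_in A p" "coeffs_in A q"
  shows "map_poly \<phi> (p + q) = map_poly \<phi> p + map_poly \<phi> q"
  using assms by (intro poly_eqI) (auto simp: coeff_map_poly alg_hom_0 alg_hom_add coeffs_in_def)

lemma alg_hom_map_poly_diff:
  assumes "subalg A" "alg_hom A \<phi>" "coeffs_in A p" "coeffs_in A q"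
  shows "map_poly \<phi> (p - q) = map_poly \<phi> p - map_poly \<phi> q"
  using assms by (intro poly_eqI) (auto simp: coeff_map_poly alg_hom_0 alg_hom_diff coeffs_in_def)

lemma alg_hom_map_poly_mult:
  assumes "subalg A" "alg_hom A \<phi>" "coeffs_in A p" "coeffs_in A q"
  shows "map_poly \<phi> (p * q) = map_poly \<phi> p * map_poly \<phi> q"
  using assms
  by (intro poly_eqI)
    (auto simp: coeff_map_poly alg_hom_0 coeff_mult alg_hom_sum alg_hom_mult coeffs_in_def subalg_mult)

lemma alg_hom_map_poly_smult:
  assumes "subalg A" "alg_hom A \<phi>" "coeffs_in A p" "a \<in> A"
  shows "map_poly \<phi> (smult a p) = smult (\<phi> a) (map_poly \<phi> p)"
  using assms by (intro poly_eqI) (auto simp: coeff_map_poly alg_hom_0 alg_hom_mult coeffs_in_def)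

lemma alg_hom_map_poly_pderiv:
  assumes A: "subalg A" "alg_hom A \<phi>" and p: "coeffs_in A p"
  shows "map_poly \<phi> (pderiv p) = pderiv (map_poly \<phi> p)"
proof (rule poly_eqI)
  fix n
  have "\<phi> (of_nat (Suc n) * coeff p (Suc n)) = of_nat (Suc n) * \<phi> (coeff p (Suc n))"
    using alg_hom_mult[OF A(2), of "of_nat (Suc n)" "coeff p (Suc n)"] alg_hom_of_real[OF A(2), of "of_nat (Suc n)"]
      subalg_of_nat[OF A(1), of "Suc n"] p
    by (simp add: coeffs_in_def del: of_nat_Suc)
  then show "coeff (map_poly \<phi> (pderiv p)) n = coeff (pderiv (map_poly \<phi> p)) n"
    by (simp add: coeff_map_poly alg_hom_0[OF A(2)] coeff_pderiv del: of_nat_Suc)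
qed

lemma poly_map_poly_eq_sum:
  fixes f :: "'a::zero \<Rightarrow> real"
  assumes "f 0 = 0" shows "poly (map_poly f p) r = (\<Sum>i\<le>degree p. f (coeff p i) * r ^ i)"
proof -
  have "degree (map_poly f p) \<le> degree p"
    by (intro degree_le) (simp add: coeff_map_poly assms coeff_eq_0)
  then have "poly (map_poly f p) r = (\<Sum>i\<le>degree p. coeff (map_poly f p) i * r ^ i)"
    unfolding poly_altdef by (intro sum.mono_neutral_left) (auto simp: coeff_eq_0)
  then show ?thesis by (simp add: coeff_map_poly assms)
qed

lemma alg_hom_poly:
  assumes A: "subalg A" "alg_hom A \<phi>" and p: "coeffs_in A p" and x: "x \<in> A"
  shows "\<phi> (poly p x) = poly (map_poly \<phi> p) (\<phi> x)"
proof -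
  have "\<phi> (poly p x) = (\<Sum>i\<le>degree p. \<phi> (coeff p i) * \<phi> x ^ i)"
    unfolding poly_altdef using A p x
    by (subst alg_hom_sum)
      (auto intro!: sum.cong subalg_mult subalg_power simp: coeffs_in_def alg_hom_mult alg_hom_power subalg_power)
  also have "\<dots> = poly (map_poly \<phi> p) (\<phi> x)"
    by (simp add: poly_map_poly_eq_sum alg_hom_0[OF A(2)])
  finally show ?thesis .
qed

lemma map_poly_pCons_hom:
  assumes "alg_hom A \<phi>"
  shows "map_poly \<phi> (pCons a p) = pCons (\<phi> a) (map_poly \<phi> p)"
  by (intro poly_eqI) (auto simp: coeff_map_poly alg_hom_0[OF assms] coeff_pCons split: nat.splits)

text \<open>The value of a polynomial expression in \<open>x\<close> is forced to be the value at
  \<open>r\<close> of the polynomial with mapped coefficients. Applying \<open>rel\<close> to the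
  difference of two representations of the same element shows that the choice between them does not
  matter.\<close>

lemma alg_hom_adjoin:
  assumes A: "subalg A" "alg_hom A \<phi>"
    and rel: "\<And>p. coeffs_in A p \<Longrightarrow> poly p x = 0 \<Longrightarrow> poly (map_poly \<phi> p) r = 0"
  obtains \<psi> where "alg_hom (adjoin A x) \<psi>"
    "\<And>p. coeffs_in A p \<Longrightarrow> \<psi> (poly p x) = poly (map_poly \<phi> p) r"
    "\<And>a. a \<in> A \<Longrightarrow> \<psi> a = \<phi> a" "\<psi> x = r"
proof -
  define \<psi> where "\<psi> y = poly (map_poly \<phi> (SOME p. coeffs_in A p \<and> poly p x = y)) r" for y
  have \<psi>: "\<psi> (poly p x) = poly (map_poly \<phi> p) r" if p: "coeffs_in A p" for p
  proof -
    define q where "q = (SOME q. coeffs_in A q \<and> poly q x = poly p x)"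
    have q: "coeffs_in A q \<and> poly q x = poly p x"
      unfolding q_def by (rule someI[of _ p]) (use p in auto)
    have "poly (map_poly \<phi> (q - p)) r = 0"
      by (rule rel) (use q p A in \<open>auto intro: coeffs_in_diff\<close>)
    then show ?thesis
      unfolding \<psi>_def using alg_hom_map_poly_diff[OF A, of q p] q p by (simp flip: q_def)
  qed
  have const: "\<psi> a = \<phi> a" if "a \<in> A" for a
    using \<psi>[of "[:a:]"] that A by (simp add: coeffs_in_simps map_poly_pCons_hom[OF A(2)])
  have "alg_hom (adjoin A x) \<psi>"
    unfolding alg_hom_def
  proof (intro conjI allI ballI)
    fix s show "\<psi> (of_real s) = s"
      using const[of "of_real s"] A by (simp add: subalg_closed alg_hom_of_real)
  next
    fix y z assume "y \<in> adjoin A x" "z \<in> adjoin A x"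
    then obtain p q where pq: "coeffs_in A p" "coeffs_in A q" "y = poly p x" "z = poly q x"
      unfolding adjoin_def by blast
    show "\<psi> (y + z) = \<psi> y + \<psi> z"
      using \<psi>[of "p + q"] \<psi>[of p] \<psi>[of q] pq A by (simp add: coeffs_in_add alg_hom_map_poly_add)
    show "\<psi> (y * z) = \<psi> y * \<psi> z"
      using \<psi>[of "p * q"] \<psi>[of p] \<psi>[of q] pq A by (simp add: coeffs_in_mult alg_hom_map_poly_mult)
  qed
  moreover have "\<psi> x = r"
    using \<psi>[of "[:0, 1:]"] A
    by (simp add: coeffs_in_simps subalg_closed map_poly_pCons_hom[OF A(2)] alg_hom_0 alg_hom_1)
  ultimately show ?thesis using that \<psi> const by blast
qed

section \<open>Real closures\<close>

text \<open>A proper preordering in the sense of real algebra: it need not decide the sign of every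
  element.\<close>

definition precone :: "'a::real_field set \<Rightarrow> 'a set \<Rightarrow> bool" where
  "precone K T \<longleftrightarrow> is_R_subfield K \<and> T \<subseteq> K \<and> (\<forall>x\<in>T. \<forall>y\<in>T. x + y \<in> T \<and> x * y \<in> T) \<and>
     (\<forall>x\<in>K. x * x \<in> T) \<and> - 1 \<notin> T"

definition field_ordering :: "'a::real_field set \<Rightarrow> 'a set \<Rightarrow> bool" where
  "field_ordering K T \<longleftrightarrow> is_R_subfield K \<and> T \<subseteq> K \<and> (\<forall>x\<in>T. \<forall>y\<in>T. x + y \<in> T \<and> x * y \<in> T) \<and>
     (\<forall>x\<in>K. x \<in> T \<or> - x \<in> T) \<and> (\<forall>x. x \<in> T \<and> - x \<in> T \<longrightarrow> x = 0)"

definition lt :: "'a::real_field set \<Rightarrow> 'a \<Rightarrow> 'a \<Rightarrow> bool" where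
  "lt T x y \<longleftrightarrow> y - x \<in> T \<and> x \<noteq> y"

text \<open>The intermediate value property is taken as the definition because this is the form in
  which real closedness is used below.\<close>

definition real_closed :: "'a::real_field set \<Rightarrow> 'a set \<Rightarrow> bool" where
  "real_closed K T \<longleftrightarrow> field_ordering K T \<and>
     (\<forall>p a b. coeffs_in K p \<and> a \<in> K \<and> b \<in> K \<and> lt T a b \<and> lt T (poly p a * poly p b) 0 \<longrightarrow>
       (\<exists>c\<in>K. lt T a c \<and> lt T c b \<and> poly p c = 0))"

text \<open>Real-valued, so that a sign in an abstract ordering can be compared directly with
  \<open>sgn\<close> of the value of a homomorphism.\<close>

definition sg :: "'a::real_field set \<Rightarrow> 'a \<Rightarrow> real" where
  "sg T x = (if x = 0 then 0 else if x \<in> T then 1 else - 1)"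

locale ordered_R_field =
  fixes K T :: "'a::real_field set"
  assumes ordering: "field_ordering K T"
begin

lemma K: "is_R_subfield K" and sub: "subalg K" and T_sub: "x \<in> T \<Longrightarrow> x \<in> K"
  and T_add: "x \<in> T \<Longrightarrow> y \<in> T \<Longrightarrow> x + y \<in> T" and T_mult: "x \<in> T \<Longrightarrow> y \<in> T \<Longrightarrow> x * y \<in> T"
  and T_total: "x \<in> K \<Longrightarrow> x \<in> T \<or> - x \<in> T" and T_antisym: "x \<in> T \<Longrightarrow> - x \<in> T \<Longrightarrow> x = 0"
  using ordering subalg_R_subfield[of K] unfolding field_ordering_def by blast+

lemma T_square: "x \<in> K \<Longrightarrow> x * x \<in> T"
  using T_total[of x] T_mult[of x x] T_mult[of "- x" "- x"] by auto

lemma T_0: "0 \<in> T" and T_1: "1 \<in> T"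
  using T_square[of 0] T_square[of 1] subalg_closed[OF sub] by auto

lemma T_neg_one: "- 1 \<notin> T"
  using T_antisym[of 1] T_1 by auto

lemma T_of_real: "r \<ge> 0 \<Longrightarrow> of_real r \<in> T"
  using T_square[of "of_real (sqrt r)"] subalg_of_real[OF sub] by (simp flip: of_real_mult)

lemma T_inverse: "x \<in> T \<Longrightarrow> inverse x \<in> T"
  using T_mult[of x "inverse x * inverse x"] T_square[of "inverse x"] R_subfield_inverse[OF K] T_sub
  by (cases "x = 0") (auto simp: field_simps)

lemma T_of_real_iff: "of_real r \<in> T \<longleftrightarrow> r \<ge> 0"
proof
  assume "of_real r \<in> T"
  then show "r \<ge> 0"
    using T_of_real[of "- r"] T_antisym[of "of_real r"] by (cases "r \<ge> 0") auto
qed (rule T_of_real)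

abbreviation less (infix "\<lless>" 50) where "x \<lless> y \<equiv> lt T x y"

lemma less_iff_pos: "x \<lless> y \<longleftrightarrow> 0 \<lless> y - x"
  by (auto simp: lt_def)

lemma less_irrefl: "\<not> x \<lless> x"
  by (simp add: lt_def)

lemma pos_add: "0 \<lless> x \<Longrightarrow> 0 \<lless> y \<Longrightarrow> 0 \<lless> x + y"
  using T_antisym[of x] T_add[of x y] by (auto simp: lt_def add_eq_0_iff)

lemma pos_mult: "0 \<lless> x \<Longrightarrow> 0 \<lless> y \<Longrightarrow> 0 \<lless> x * y"
  using T_mult[of x y] by (auto simp: lt_def)

lemma less_trans: "x \<lless> y \<Longrightarrow> y \<lless> z \<Longrightarrow> x \<lless> z"
  using pos_add[of "y - x" "z - y"] less_iff_pos by (metis add.commute diff_add_cancel add_diff_eq)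

lemma less_asym: "x \<lless> y \<Longrightarrow> \<not> y \<lless> x"
  using less_trans less_irrefl by blast

lemma less_total: "x \<in> K \<Longrightarrow> y \<in> K \<Longrightarrow> x \<noteq> y \<Longrightarrow> x \<lless> y \<or> y \<lless> x"
  using T_total[of "y - x"] subalg_diff[OF sub] by (auto simp: lt_def)

lemma neg_iff: "x \<lless> 0 \<longleftrightarrow> 0 \<lless> - x"
  by (auto simp: lt_def)

lemma pos_of_real: "0 \<lless> of_real r \<longleftrightarrow> r > 0"
  by (auto simp: lt_def T_of_real_iff)

lemma sg_0 [simp]: "sg T 0 = 0" by (simp add: sg_def)

lemma sg_eq_0_iff [simp]: "sg T x = 0 \<longleftrightarrow> x = 0" by (simp add: sg_def)

lemma sg_eq_1_iff: "sg T x = 1 \<longleftrightarrow> 0 \<lless> x" by (simp add: sg_def lt_def)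

lemma sg_cases: "sg T x = 0 \<or> sg T x = 1 \<or> sg T x = - 1" by (simp add: sg_def)

lemma sg_uminus: "x \<in> K \<Longrightarrow> sg T (- x) = - sg T x"
  using T_total[of x] T_antisym[of x] by (auto simp: sg_def)

lemma sg_eq_neg1_iff: "x \<in> K \<Longrightarrow> sg T x = - 1 \<longleftrightarrow> x \<lless> 0"
  using sg_uminus[of x] sg_eq_1_iff[of "- x"] neg_iff[of x] by auto

lemma sg_mult: "x \<in> K \<Longrightarrow> y \<in> K \<Longrightarrow> sg T (x * y) = sg T x * sg T y"
proof -
  assume K: "x \<in> K" "y \<in> K"
  have *: "sg T (u * v) = 1" if "sg T u = 1" "sg T v = 1" for u v
    using that pos_mult by (simp add: sg_eq_1_iff)
  have "sg T (x * y) = 1" if "sg T x = 1" "sg T y = 1" using * that by blast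
  moreover have "sg T (x * y) = - 1" if "sg T x = - 1" "sg T y = 1"
    using *[of "- x" y] that sg_uminus[of x] sg_uminus[of "x * y"] K subalg_mult[OF sub] by simp
  moreover have "sg T (x * y) = - 1" if "sg T x = 1" "sg T y = - 1"
    using *[of x "- y"] that sg_uminus[of y] sg_uminus[of "x * y"] K subalg_mult[OF sub] by simp
  moreover have "sg T (x * y) = 1" if "sg T x = - 1" "sg T y = - 1"
    using *[of "- x" "- y"] that sg_uminus[of x] sg_uminus[of y] K by simp
  ultimately show ?thesis using sg_cases[of x] sg_cases[of y] by auto
qed

lemma sg_of_real: "sg T (of_real r) = sgn r"
  by (auto simp: sg_def T_of_real_iff sgn_if)

lemma sg_power: "x \<in> K \<Longrightarrow> sg T (x ^ n) = sg T x ^ n"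
  using sg_of_real[of 1] by (induction n) (auto simp: sg_mult subalg_power[OF sub])

lemma finite_has_greatest:
  "finite Z \<Longrightarrow> Z \<noteq> {} \<Longrightarrow> Z \<subseteq> K \<Longrightarrow> \<exists>m\<in>Z. \<forall>z\<in>Z. z = m \<or> z \<lless> m"
proof (induction Z rule: finite_ne_induct)
  case (insert x Z)
  then obtain m where m: "m \<in> Z" "\<forall>z\<in>Z. z = m \<or> z \<lless> m" by auto
  show ?case
  proof (cases "m \<lless> x")
    case True
    then have "\<forall>z\<in>Z. z \<lless> x" using m less_trans by metis
    then show ?thesis by auto
  next
    case False
    then have "x = m \<or> x \<lless> m" using less_total[of x m] insert.prems m(1) by blast
    then show ?thesis using m by auto
  qed
qed auto

lemma finite_has_least:
  "finite Z \<Longrightarrow> Z \<noteq> {} \<Longrightarrow> Z \<subseteq> K \<Longrightarrow> \<exists>m\<in>Z. \<forall>z\<in>Z. z = m \<or> m \<lless> z"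
proof (induction Z rule: finite_ne_induct)
  case (insert x Z)
  then obtain m where m: "m \<in> Z" "\<forall>z\<in>Z. z = m \<or> m \<lless> z" by auto
  show ?case
  proof (cases "x \<lless> m")
    case True
    then have "\<forall>z\<in>Z. x \<lless> z" using m less_trans by metis
    then show ?thesis by auto
  next
    case False
    then have "x = m \<or> m \<lless> x" using less_total[of x m] insert.prems m(1) by blast
    then show ?thesis using m by auto
  qed
qed auto

end

text \<open>Every \<open>x\<close> is the difference of the squares of \<open>(x + 1) / 2\<close>
  and \<open>(x - 1) / 2\<close>. A precone thus determines its field, and Zorn's lemma can be
  applied to the cones alone while the fields vary.\<close>

lemma precone_diffs: "precone K T \<Longrightarrow> {x - y |x y. x \<in> T \<and> y \<in> T} = K"
proof
  assume T: "precone K T"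
  then have K: "subalg K" using subalg_R_subfield by (auto simp: precone_def)
  show "{x - y |x y. x \<in> T \<and> y \<in> T} \<subseteq> K"
    using T subalg_diff[OF K] by (auto simp: precone_def)
  show "K \<subseteq> {x - y |x y. x \<in> T \<and> y \<in> T}"
  proof
    fix x assume x: "x \<in> K"
    have h: "1/2 \<in> K" using subalg_of_real[OF K, of "1/2"] by simp
    have "(x + 1) * (1/2) \<in> K" "(x - 1) * (1/2) \<in> K"
      by (intro subalg_mult[OF K] subalg_add[OF K] subalg_diff[OF K] subalg_1[OF K] x h)+
    then have "((x + 1) * (1/2)) * ((x + 1) * (1/2)) \<in> T" "((x - 1) * (1/2)) * ((x - 1) * (1/2)) \<in> T"
      using T unfolding precone_def by blast+
    moreover have "x = ((x + 1) * (1/2)) * ((x + 1) * (1/2)) - ((x - 1) * (1/2)) * ((x - 1) * (1/2))"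
      by (simp add: field_simps)
    ultimately show "x \<in> {x - y |x y. x \<in> T \<and> y \<in> T}" by blast
  qed
qed

lemma field_ordering_precone: "field_ordering K T \<Longrightarrow> precone K T"
proof -
  assume "field_ordering K T"
  then interpret ordered_R_field K T by unfold_locales
  show ?thesis unfolding precone_def using K T_sub T_add T_mult T_square T_neg_one by blast
qed

text \<open>A Euclidean descent: pseudo-dividing \<open>m\<close> by a representative
  \<open>g\<close> shows that a multiple of the value of \<open>g\<close> at \<open>x\<close> is, up
  to sign, the value of the remainder, which has smaller degree; the descent ends at a nonzero
  constant of \<open>A\<close>. Over a field this yields inverses, over a ring it pushes a
  nonvanishing condition down to \<open>A\<close>.\<close>

lemma algebraic_multiple_in_base:
  assumes A: "subalg A" and m: "coeffs_in A m" "m \<noteq> 0" "poly m x = 0"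
    and min: "\<And>p. coeffs_in A p \<Longrightarrow> p \<noteq> 0 \<Longrightarrow> poly p x = 0 \<Longrightarrow> degree m \<le> degree p"
    and b: "b \<in> adjoin A x" "b \<noteq> 0"
  obtains w where "w \<in> adjoin A x" "b * w \<in> A" "b * w \<noteq> 0"
proof -
  note B = adjoin_subalg[OF A, of x]
  have reduced: "\<exists>w\<in>adjoin A x. poly g x * w \<in> A \<and> poly g x * w \<noteq> 0"
    if "coeffs_in A g" "g \<noteq> 0" "degree g < degree m" for g
    using that
  proof (induction "degree g" arbitrary: g rule: less_induct)
    case less
    show ?case
    proof (cases "degree g = 0")
      case True
      then obtain c where c: "g = [:c:]" by (rule degree_eq_zeroE)
      then have "c \<in> A" "c \<noteq> 0" using less.prems by (auto simp: coeffs_in_simps[OF A])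
      then show ?thesis using subalg_1[OF B] c by (intro bexI[of _ 1]) auto
    next
      case False
      define c where "c = lead_coeff g"
      obtain k q r where qr: "coeffs_in A q" "coeffs_in A r" "smult (c ^ k) m = g * q + r"
        "r = 0 \<or> degree r < degree g"
        using pseudo_division[OF A less.prems(1,2) m(1)] unfolding c_def by blast
      have c0: "c ^ k \<noteq> 0" using less.prems(2) by (simp add: c_def)
      have g0: "poly g x \<noteq> 0" using min[of g] less.prems by auto
      have "poly (smult (c ^ k) m) x = poly (g * q + r) x" using qr(3) by simp
      then have eq: "poly r x = - (poly g x * poly q x)" using m(3) by (simp add: eq_neg_iff_add_eq_0 add.commute)
      \<comment> \<open>If the remainder vanished, \<open>q\<close> would be a nonzero polynomial of
        degree \<open>degree m - degree g\<close> annihilating \<open>x\<close>, against the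
        minimality of \<open>m\<close>.\<close>
      have "r \<noteq> 0"
      proof
        assume "r = 0"
        then have "poly q x = 0" "smult (c ^ k) m = g * q" using eq g0 qr(3) by auto
        moreover from this have "q \<noteq> 0" using c0 m(2) by auto
        moreover from calculation have "degree (smult (c ^ k) m) = degree g + degree q"
          using degree_mult_eq[OF less.prems(2)] by simp
        moreover have "degree (smult (c ^ k) m) = degree m" using c0 by (simp only: degree_smult_eq if_False)
        ultimately show False using min[OF qr(1)] False by simp
      qed
      then obtain z where z: "z \<in> adjoin A x" "poly r x * z \<in> A" "poly r x * z \<noteq> 0"
        using less.hyps[of r] qr less.prems(3) by force
      have "poly q x \<in> adjoin A x" using qr(1) unfolding adjoin_def by blast
      then have "- (poly q x * z) \<in> adjoin A x" by (intro subalg_uminus[OF B] subalg_mult[OF B] z(1))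
      moreover have "poly g x * - (poly q x * z) = poly r x * z" by (simp add: eq)
      ultimately show ?thesis using z by (intro bexI[of _ "- (poly q x * z)"]) auto
    qed
  qed
  obtain g where g: "coeffs_in A g" "b = poly g x" using b(1) unfolding adjoin_def by blast
  define c where "c = lead_coeff m"
  have c: "c \<in> A" "c \<noteq> 0" using m coeffs_in_lead_coeff by (auto simp: c_def)
  obtain k q r where qr: "coeffs_in A q" "coeffs_in A r" "smult (c ^ k) g = m * q + r" "r = 0 \<or> degree r < degree m"
    using pseudo_division[OF A m(1,2) g(1)] unfolding c_def by blast
  have "poly (smult (c ^ k) g) x = poly (m * q + r) x" using qr(3) by simp
  then have eq: "poly r x = c ^ k * b" using m(3) g(2) by simp
  then have "r \<noteq> 0" using b(2) c(2) by auto
  then obtain z where z: "z \<in> adjoin A x" "poly r x * z \<in> A" "poly r x * z \<noteq> 0"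
    using reduced[of r] qr by blast
  show ?thesis
  proof (rule that[of "c ^ k * z"])
    have "c ^ k \<in> adjoin A x" using subalg_power[OF A c(1)] adjoin_superset[OF A] by blast
    then show "c ^ k * z \<in> adjoin A x" by (intro subalg_mult[OF B] z(1))
    have eq': "b * (c ^ k * z) = poly r x * z" by (simp add: eq)
    show "b * (c ^ k * z) \<in> A" "b * (c ^ k * z) \<noteq> 0" unfolding eq' by (rule z)+
  qed
qed

lemma min_poly_exists:
  assumes "coeffs_in K p" "p \<noteq> 0" "poly p \<alpha> = 0"
  obtains m where "coeffs_in K m" "m \<noteq> 0" "poly m \<alpha> = 0" "degree m \<le> degree p"
    "\<And>q. coeffs_in K q \<Longrightarrow> q \<noteq> 0 \<Longrightarrow> poly q \<alpha> = 0 \<Longrightarrow> degree m \<le> degree q"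
  using ex_has_least_nat[of "\<lambda>p. coeffs_in K p \<and> p \<noteq> 0 \<and> poly p \<alpha> = 0" p degree] assms by blast

lemma poly_reduced:
  assumes K: "is_R_subfield K" and m: "coeffs_in K m" "m \<noteq> 0" "poly m \<alpha> = 0"
    and y: "y \<in> adjoin K \<alpha>"
  obtains g where "coeffs_in K g" "y = poly g \<alpha>" "g = 0 \<or> degree g < degree m"
proof -
  from y obtain f where f: "coeffs_in K f" "y = poly f \<alpha>" unfolding adjoin_def by blast
  obtain q r where "coeffs_in K q" "coeffs_in K r" "f = m * q + r" "r = 0 \<or> degree r < degree m"
    using division_R_subfield[OF K m(1,2) f(1)] by blast
  then show ?thesis using that[of r] f m by auto
qed

lemma adjoin_R_subfield:
  assumes K: "is_R_subfield K" and p: "coeffs_in K p" "p \<noteq> 0" "poly p \<alpha> = 0"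
  shows "is_R_subfield (adjoin K \<alpha>)"
proof -
  note A = subalg_R_subfield[OF K]
  obtain m where m: "coeffs_in K m" "m \<noteq> 0" "poly m \<alpha> = 0"
    and min: "\<And>q. coeffs_in K q \<Longrightarrow> q \<noteq> 0 \<Longrightarrow> poly q \<alpha> = 0 \<Longrightarrow> degree m \<le> degree q"
    using min_poly_exists[OF p] by metis
  have "inverse y \<in> adjoin K \<alpha>" if y: "y \<in> adjoin K \<alpha>" for y
  proof (cases "y = 0")
    case True
    then show ?thesis using y by simp
  next
    case False
    obtain w where w: "w \<in> adjoin K \<alpha>" "y * w \<in> K" "y * w \<noteq> 0"
      by (rule algebraic_multiple_in_base[OF A m min y False])
    have "inverse (y * w) \<in> adjoin K \<alpha>"
      using R_subfield_inverse[OF K w(2)] adjoin_superset[OF A] by blast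
    then have "w * inverse (y * w) \<in> adjoin K \<alpha>" by (rule subalg_mult[OF adjoin_subalg[OF A] w(1)])
    moreover have "w * inverse (y * w) = inverse y" using w(3) by (simp add: field_simps)
    ultimately show ?thesis by (simp only:)
  qed
  then show ?thesis
    using subalg_uminus[OF adjoin_subalg[OF A, of \<alpha>]] adjoin_subalg[OF A, of \<alpha>, unfolded subalg_def]
    unfolding is_R_subfield_def by simp
qed

text \<open>Sums of elements of \<open>T\<close> times squares of \<open>K\<close>: the least
  candidate for a precone on a larger field \<open>K\<close>. It can fail to be one only by
  containing -1.\<close>

inductive_set cone_ext :: "'a::real_field set \<Rightarrow> 'a set \<Rightarrow> 'a set" for T K where
  zero: "0 \<in> cone_ext T K"
| add: "z \<in> cone_ext T K \<Longrightarrow> t \<in> T \<Longrightarrow> y \<in> K \<Longrightarrow> z + t * (y * y) \<in> cone_ext T K"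

lemma cone_ext_precone:
  assumes T: "precone K T" and L: "is_R_subfield L" "K \<subseteq> L" and neg: "- 1 \<notin> cone_ext T L"
  shows "precone L (cone_ext T L)" "T \<subseteq> cone_ext T L"
proof -
  note A = subalg_R_subfield[OF L(1)]
  have T': "x \<in> T \<Longrightarrow> x \<in> L" "x \<in> T \<Longrightarrow> y \<in> T \<Longrightarrow> x * y \<in> T" "1 \<in> T" for x y
    using T L subalg_1[OF subalg_R_subfield, of K] unfolding precone_def by (blast, blast, force)
  have sub: "x \<in> L" if "x \<in> cone_ext T L" for x
    using that by induction (use A T' in \<open>auto intro!: subalg_closed\<close>)
  have plus: "x + y \<in> cone_ext T L" if "y \<in> cone_ext T L" "x \<in> cone_ext T L" for x y
    using that
  proof (induction)
    case (add z t y)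
    then show ?case using cone_ext.add[of "x + z" T L t y] by (simp add: add.assoc)
  qed auto
  have scale: "x * (t * (y * y)) \<in> cone_ext T L" if "x \<in> cone_ext T L" "t \<in> T" "y \<in> L" for x t y
    using that
  proof (induction)
    case zero
    then show ?case by (simp add: cone_ext.zero)
  next
    case (add z s w)
    have "z * (t * (y * y)) + (s * t) * ((w * y) * (w * y)) \<in> cone_ext T L"
      by (intro cone_ext.add T'(2) subalg_mult[OF A] add.IH add.hyps add.prems)
    then show ?case by (simp add: algebra_simps)
  qed
  have mult: "x * y \<in> cone_ext T L" if "y \<in> cone_ext T L" "x \<in> cone_ext T L" for x y
    using that
  proof (induction)
    case zero
    then show ?case by (simp add: cone_ext.zero)
  next
    case (add z t y)
    then show ?case using plus[OF scale add.IH] by (simp add: distrib_left)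
  qed
  have sq: "x * x \<in> cone_ext T L" if "x \<in> L" for x
    using cone_ext.add[OF cone_ext.zero T'(3) that] by simp
  show "precone L (cone_ext T L)"
    unfolding precone_def using L sub plus mult sq neg by (simp add: subsetI)
  show "T \<subseteq> cone_ext T L"
    using cone_ext.add[OF cone_ext.zero _ subalg_1[OF A], of _ T] by auto
qed


text \<open>Zorn's lemma is applied to the precones on all subfields of the algebraically closed
  ambient field at once. At a maximal one, adjoining any algebraic element from outside turns -1
  into a sum of weighted squares. Applied to a square root this makes the cone total; applied to a
  root of a minimal polynomial it gives the intermediate value property.\<close>

theorem real_closure:
  fixes T0 :: "'a::{real_field,alg_closed_field} set"
  assumes T0: "precone F T0"
  obtains K T where "real_closed K T" "T0 \<subseteq> T"
proof -
  define D where "D T = {x - y |x y. x \<in> T \<and> y \<in> T}" for T :: "'a set"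
  define \<A> where "\<A> = {T. precone (D T) T \<and> T0 \<subseteq> T}"
  have D: "D T = K" if "precone K T" for K T
    unfolding D_def using precone_diffs[OF that] .
  have "\<Union>C \<in> \<A>" if C: "C \<noteq> {}" "subset.chain \<A> C" for C
  proof -
    have A: "precone (D c) c" "T0 \<subseteq> c" if "c \<in> C" for c
      using C that unfolding \<A>_def subset.chain_def by blast+
    have tot: "c \<subseteq> d \<or> d \<subseteq> c" if "c \<in> C" "d \<in> C" for c d
      using C that unfolding subset.chain_def by blast
    have D_mono: "c \<subseteq> d \<Longrightarrow> D c \<subseteq> D d" for c d unfolding D_def by blast
    have two: "\<exists>c\<in>C. x \<in> c \<and> y \<in> c" if "x \<in> \<Union>C" "y \<in> \<Union>C" for x y
    proof -
      from that obtain c d where "c \<in> C" "d \<in> C" "x \<in> c" "y \<in> d" by blast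
      with tot[of c d] show ?thesis by blast
    qed
    have one_D: "\<exists>c\<in>C. x \<in> D c" if x: "x \<in> D (\<Union>C)" for x
    proof -
      from x obtain y z where yz: "y \<in> \<Union>C" "z \<in> \<Union>C" "x = y - z" unfolding D_def by blast
      then obtain c where "c \<in> C" "y \<in> c" "z \<in> c" using two by meson
      then show ?thesis unfolding D_def using yz(3) by blast
    qed
    have two_D: "\<exists>c\<in>C. x \<in> D c \<and> y \<in> D c" if xy: "x \<in> D (\<Union>C)" "y \<in> D (\<Union>C)" for x y
    proof -
      from one_D[OF xy(1)] one_D[OF xy(2)] obtain c d where cd: "c \<in> C" "d \<in> C" "x \<in> D c" "y \<in> D d" by blast
      then show ?thesis using tot[OF cd(1,2)] D_mono[of c d] D_mono[of d c] by blast
    qed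
    have up: "D c \<subseteq> D (\<Union>C)" "c \<subseteq> \<Union>C" if "c \<in> C" for c
      using that D_mono[of c "\<Union>C"] by blast+
    have field: "is_R_subfield (D (\<Union>C))"
      unfolding is_R_subfield_def
    proof (intro conjI ballI)
      obtain c where "c \<in> C" using C by blast
      then show "range of_real \<subseteq> D (\<Union>C)"
        using A(1) up(1) unfolding precone_def is_R_subfield_def by (meson subset_trans)
    next
      fix x y assume "x \<in> D (\<Union>C)" "y \<in> D (\<Union>C)"
      then obtain c where c: "c \<in> C" "x \<in> D c" "y \<in> D c" using two_D by meson
      then have "x + y \<in> D c" "x * y \<in> D c"
        using A(1)[OF c(1)] unfolding precone_def is_R_subfield_def by simp_all
      then show "x + y \<in> D (\<Union>C)" "x * y \<in> D (\<Union>C)" using up(1)[OF c(1)] by blast+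
    next
      fix x assume "x \<in> D (\<Union>C)"
      then obtain c where c: "c \<in> C" "x \<in> D c" using one_D by meson
      then have "- x \<in> D c" "inverse x \<in> D c"
        using A(1)[OF c(1)] unfolding precone_def is_R_subfield_def by simp_all
      then show "- x \<in> D (\<Union>C)" "inverse x \<in> D (\<Union>C)" using up(1)[OF c(1)] by blast+
    qed
    have "precone (D (\<Union>C)) (\<Union>C)"
      unfolding precone_def
    proof (intro conjI ballI field)
      show "\<Union>C \<subseteq> D (\<Union>C)"
        using A(1) up(1) unfolding precone_def by (meson Union_least subset_trans)
      show "- 1 \<notin> \<Union>C" using A(1) unfolding precone_def by blast
    next
      fix x y assume "x \<in> \<Union>C" "y \<in> \<Union>C"
      then obtain c where c: "c \<in> C" "x \<in> c" "y \<in> c" using two by meson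
      then have "x + y \<in> c" "x * y \<in> c"
        using A(1)[OF c(1)] unfolding precone_def by simp_all
      then show "x + y \<in> \<Union>C" "x * y \<in> \<Union>C" using c(1) by blast+
    next
      fix x assume "x \<in> D (\<Union>C)"
      then obtain c where c: "c \<in> C" "x \<in> D c" using one_D by meson
      then have "x * x \<in> c" using A(1)[OF c(1)] unfolding precone_def by simp
      then show "x * x \<in> \<Union>C" using c(1) by blast
    qed
    moreover have "T0 \<subseteq> \<Union>C" using A(2) C(1) by blast
    ultimately show ?thesis unfolding \<A>_def by blast
  qed
  moreover have "T0 \<in> \<A>" using T0 D[OF T0] unfolding \<A>_def by simp
  ultimately obtain T where T: "T \<in> \<A>" and max: "\<And>T'. T' \<in> \<A> \<Longrightarrow> T \<subseteq> T' \<Longrightarrow> T' = T"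
    using subset_Zorn_nonempty[of \<A>] by blast
  define K where "K = D T"
  have P: "precone K T" and T0T: "T0 \<subseteq> T" using T unfolding \<A>_def K_def by auto
  then have K: "is_R_subfield K" unfolding precone_def by blast
  note A = subalg_R_subfield[OF K]
  have Tadd: "x \<in> T \<Longrightarrow> y \<in> T \<Longrightarrow> x + y \<in> T" and Tmult: "x \<in> T \<Longrightarrow> y \<in> T \<Longrightarrow> x * y \<in> T"
    and Tsq: "u \<in> K \<Longrightarrow> u * u \<in> T" and TK: "x \<in> T \<Longrightarrow> x \<in> K" and Tneg: "- 1 \<notin> T" for x y u
    using P unfolding precone_def by blast+
  have T1: "1 \<in> T" and T00: "0 \<in> T" using Tsq[of 1] Tsq[of 0] subalg_closed[OF A] by simp_all
  have Tinv: "inverse x \<in> T" if "x \<in> T" for x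
  proof -
    have eq: "x * (inverse x * inverse x) = inverse x" by (cases "x = 0") (simp_all add: mult.assoc[symmetric])
    from Tmult[OF that Tsq[OF R_subfield_inverse[OF K TK[OF that]]]] show ?thesis unfolding eq .
  qed
  \<comment> \<open>Otherwise the extended cone would belong to the family; by maximality it would
    equal \<open>T\<close>, and so its field of differences would be \<open>K\<close>, although
    \<open>\<alpha>\<close> lies in it.\<close>
  have ext: "- 1 \<in> cone_ext T (adjoin K \<alpha>)"
    if p: "coeffs_in K p" "p \<noteq> 0" "poly p \<alpha> = 0" and \<alpha>: "\<alpha> \<notin> K" for p \<alpha>
  proof (rule ccontr)
    assume neg: "\<not> ?thesis"
    note E = cone_ext_precone[OF P adjoin_R_subfield[OF K p] adjoin_superset[OF A] neg]
    have "cone_ext T (adjoin K \<alpha>) = T"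
      by (rule max) (use E T0T D[OF E(1)] in \<open>auto simp: \<A>_def\<close>)
    then have "adjoin K \<alpha> = K" using D[OF E(1)] K_def by simp
    then show False using \<alpha> adjoin_generator[OF A, of \<alpha>] by simp
  qed
  have total: "x \<in> T \<or> - x \<in> T" if x: "x \<in> K" for x
  proof -
    have "\<exists>\<alpha>. poly [:- x, 0, 1:] \<alpha> = 0" by (rule alg_closed_imp_poly_has_root) simp
    then obtain \<alpha> where "poly [:- x, 0, 1:] \<alpha> = 0" by blast
    then have \<alpha>: "\<alpha> * \<alpha> = x" by (simp add: algebra_simps)
    show ?thesis
    proof (cases "\<alpha> \<in> K")
      case True
      then show ?thesis using Tsq \<alpha> by auto
    next
      case False
      have p: "coeffs_in K [:- x, 0, 1:]"
        by (simp add: coeffs_in_simps[OF A] x subalg_closed[OF A])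
      \<comment> \<open>Comes from expanding \<open>t * (a + b * \<alpha>)^2\<close> with
        \<open>\<alpha>^2 = x\<close>: apart from an uncontrolled multiple of
        \<open>\<alpha>\<close> everything stays in \<open>T + T * x\<close>.\<close>
      have form: "\<exists>s\<in>T. \<exists>s'\<in>T. \<exists>l\<in>K. z = s + s' * x + l * \<alpha>" if "z \<in> cone_ext T (adjoin K \<alpha>)" for z
        using that
      proof induction
        case zero
        show ?case using T00 TK[OF T00] by force
      next
        case (add z t y)
        then obtain s s' l where z: "s \<in> T" "s' \<in> T" "l \<in> K" "z = s + s' * x + l * \<alpha>" by blast
        obtain g where g: "coeffs_in K g" "y = poly g \<alpha>" "g = 0 \<or> degree g < degree [:- x, 0, 1:]"
          using poly_reduced[OF K p _ _ add(3)] \<alpha> by (auto simp: algebra_simps)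
        then have dg: "degree g \<le> 1" by auto
        define a b where "a = coeff g 0" and "b = coeff g 1"
        have y: "y = a + b * \<alpha>"
        proof -
          have "g = [:a, b:]"
            using dg by (intro poly_eqI) (auto simp: a_def b_def coeff_pCons coeff_eq_0 split: nat.splits)
          then show ?thesis using g(2) by (simp add: mult.commute)
        qed
        have ab: "a \<in> K" "b \<in> K" using g(1) by (auto simp: coeffs_in_def a_def b_def)
        have "z + t * (y * y) = (s + t * (a * a)) + (s' + t * (b * b)) * x + (l + t * (2 * a * b)) * \<alpha>"
          unfolding z y \<alpha>[symmetric] by (simp add: algebra_simps)
        moreover have "s + t * (a * a) \<in> T" "s' + t * (b * b) \<in> T"
          by (intro Tadd Tmult Tsq z ab add)+
        moreover have "l + t * (2 * a * b) \<in> K"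
        proof -
          have "(2::'a) \<in> K" using subalg_of_nat[OF A, of 2] by simp
          then show ?thesis by (intro subalg_add[OF A] subalg_mult[OF A] ab z(3) TK[OF add(2)])
        qed
        ultimately show ?case by blast
      qed
      have "- 1 \<in> cone_ext T (adjoin K \<alpha>)"
        by (rule ext[OF p _ _ False]) (use \<alpha> in \<open>auto simp: algebra_simps\<close>)
      from form[OF this] obtain s s' l where sl: "s \<in> T" "s' \<in> T" "l \<in> K" "- 1 = s + s' * x + l * \<alpha>" by blast
      \<comment> \<open>A nonzero \<open>l\<close> would let the equation be solved for
        \<open>\<alpha>\<close> within \<open>K\<close>. What then remains expresses
        \<open>- x\<close> as a quotient of elements of \<open>T\<close>.\<close>
      have "l = 0"
      proof (rule ccontr)
        assume l: "l \<noteq> 0"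
        have eq: "l * \<alpha> = - 1 - s - s' * x" unfolding sl(4) by (simp add: algebra_simps)
        have "\<alpha> = (- 1 - s - s' * x) * inverse l" unfolding eq[symmetric] using l by simp
        also have "\<dots> \<in> K"
          by (intro subalg_mult[OF A] subalg_diff[OF A] subalg_uminus[OF A] subalg_1[OF A] TK[OF sl(1)] TK[OF sl(2)] sl(3) x R_subfield_inverse[OF K])
        finally show False using False by simp
      qed
      then have eq: "- 1 = s + s' * x" using sl(4) by simp
      have "s' \<noteq> 0" using eq Tneg sl(1) by auto
      have eq': "(- x) * s' = 1 + s" using eq by (metis add.commute add.inverse_inverse add_diff_cancel_left' diff_minus_eq_add minus_diff_eq minus_mult_left mult.commute)
      have "- x = (1 + s) * inverse s'" unfolding eq'[symmetric] using \<open>s' \<noteq> 0\<close> by simp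
      also have "\<dots> \<in> T" by (intro Tmult Tadd Tinv T1 sl)
      finally show ?thesis by simp
    qed
  qed
  have antisym: "x = 0" if "x \<in> T" "- x \<in> T" for x
  proof (rule ccontr)
    assume "x \<noteq> 0"
    then have "- 1 = (- x) * inverse x" by simp
    then show False using Tmult[OF that(2) Tinv[OF that(1)]] Tneg by simp
  qed
  have ord: "field_ordering K T"
    unfolding field_ordering_def using K TK Tadd Tmult total antisym by (simp add: subsetI)
  interpret ordered_R_field K T by unfold_locales (rule ord)
  \<comment> \<open>Strong induction on the degree. The sign change of \<open>f\<close> is passed on
    to the minimal polynomial \<open>m\<close> of some root \<open>\<alpha>\<close> or to the
    cofactor \<open>k\<close>. If \<open>m\<close> changes sign, either \<open>\<alpha>\<close> lies
    in \<open>K\<close> and \<open>m\<close> is linear, or a contradiction arises.\<close>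
  have IVT: "\<exists>c\<in>K. lt T a c \<and> lt T c b \<and> poly f c = 0"
    if "coeffs_in K f" "a \<in> K" "b \<in> K" "lt T a b" "lt T (poly f a * poly f b) 0" for f a b
    using that
  proof (induction "degree f" arbitrary: f rule: less_induct)
    case less
    have val: "poly p c \<in> K" if "coeffs_in K p" "c \<in> K" for p c
      using poly_in_subalg[OF A that] .
    have change: "lt T (poly p a * poly p b) 0 \<longleftrightarrow> sg T (poly p a) * sg T (poly p b) = - 1" if "coeffs_in K p" for p
      using val[OF that] less.prems(2,3) sg_eq_neg1_iff[of "poly p a * poly p b"] sg_mult[of "poly p a" "poly p b"]
        subalg_mult[OF A] by metis
    have "degree f > 0"
    proof (rule ccontr)
      assume "\<not> ?thesis"
      then obtain c where c: "f = [:c:]" by (auto elim: degree_eq_zeroE)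
      have "c \<in> K" using less.prems(1) A by (simp add: c coeffs_in_simps)
      then have "lt T (c * c) 0 \<longrightarrow> False" using Tsq[of c] antisym[of "c * c"] by (auto simp: lt_def)
      then show False using less.prems(5) by (simp add: c)
    qed
    then have "f \<noteq> 0" by auto
    obtain \<alpha> where "poly f \<alpha> = 0" using alg_closed_imp_poly_has_root[OF \<open>degree f > 0\<close>] by blast
    then obtain m where m: "coeffs_in K m" "m \<noteq> 0" "poly m \<alpha> = 0" "degree m \<le> degree f"
      and min: "\<And>q. coeffs_in K q \<Longrightarrow> q \<noteq> 0 \<Longrightarrow> poly q \<alpha> = 0 \<Longrightarrow> degree m \<le> degree q"
      using min_poly_exists[OF less.prems(1) \<open>f \<noteq> 0\<close>] by blast
    have dvd: "\<exists>q. coeffs_in K q \<and> g = m * q" if g: "coeffs_in K g" "poly g \<alpha> = 0" for g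
    proof -
      obtain q r where qr: "coeffs_in K q" "coeffs_in K r" "g = m * q + r" "r = 0 \<or> degree r < degree m"
        using division_R_subfield[OF K m(1,2) g(1)] by blast
      have "poly r \<alpha> = 0" using qr(3) g(2) m(3) by simp
      then have "r = 0" using min[of r] qr(2,4) by force
      then show ?thesis using qr by auto
    qed
    obtain k where k: "coeffs_in K k" "f = m * k" using dvd[OF less.prems(1) \<open>poly f \<alpha> = 0\<close>] by blast
    have dm: "degree m > 0"
    proof (rule ccontr)
      assume "\<not> ?thesis"
      then obtain c where "m = [:c:]" by (auto elim: degree_eq_zeroE)
      then show False using m by auto
    qed
    have "k \<noteq> 0" using \<open>f \<noteq> 0\<close> k by auto
    have "sg T (poly f a) * sg T (poly f b) =
        (sg T (poly m a) * sg T (poly m b)) * (sg T (poly k a) * sg T (poly k b))"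
      using val m(1) k less.prems(2,3) by (simp add: sg_mult mult_ac)
    then have "sg T (poly m a) * sg T (poly m b) = - 1 \<or> sg T (poly k a) * sg T (poly k b) = - 1"
      using less.prems(5) change[OF less.prems(1)]
        sg_cases[of "poly m a"] sg_cases[of "poly m b"] sg_cases[of "poly k a"] sg_cases[of "poly k b"] by auto
    then consider "lt T (poly k a * poly k b) 0" | "lt T (poly m a * poly m b) 0"
      using change m k by auto
    then show ?case
    proof cases
      case 1
      have "degree k < degree f" using dm k m(2) \<open>k \<noteq> 0\<close> by (simp add: degree_mult_eq)
      from less.hyps[OF this k(1) less.prems(2-4) 1] show ?thesis unfolding k(2) by auto
    next
      case 2
      show ?thesis
      proof (cases "\<alpha> \<in> K")
        case True
        then have "coeffs_in K [:- \<alpha>, 1:]" by (simp add: coeffs_in_simps[OF A] subalg_closed[OF A])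
        then have "degree m \<le> 1" using min[of "[:- \<alpha>, 1:]"] by simp
        with dm have d1: "degree m = 1" by simp
        define c0 c1 where "c0 = coeff m 0" and "c1 = coeff m 1"
        have "m = [:c0, c1:]"
          using d1 by (intro poly_eqI) (auto simp: c0_def c1_def coeff_pCons coeff_eq_0 split: nat.splits)
        moreover have "c1 \<noteq> 0" using d1 m(2) by (metis c1_def leading_coeff_0_iff)
        ultimately have m_eq': "m = [:c0, c1:]" "c1 \<noteq> 0" by auto
        have "c0 + c1 * \<alpha> = 0" using m(3) by (simp add: m_eq' mult.commute)
        then have "c0 = - (c1 * \<alpha>)" by (simp add: eq_neg_iff_add_eq_0)
        then have m_eq: "m = [:- (c1 * \<alpha>), c1:]" by (simp add: m_eq'(1))
        have c1: "c1 \<in> K" using m(1) by (simp add: m_eq coeffs_in_simps[OF A])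
        have "poly m a * poly m b = (c1 * c1) * ((a - \<alpha>) * (b - \<alpha>))" by (simp add: m_eq algebra_simps)
        moreover have "sg T (c1 * c1) = 1"
          using m_eq'(2) c1 Tsq by (simp add: sg_def)
        moreover have mem: "a - \<alpha> \<in> K" "b - \<alpha> \<in> K" using subalg_diff[OF A] less.prems(2,3) True by auto
        ultimately have "sg T ((a - \<alpha>) * (b - \<alpha>)) = - 1"
          using 2 sg_eq_neg1_iff[of "poly m a * poly m b"] sg_mult[of "c1 * c1" "(a - \<alpha>) * (b - \<alpha>)"] c1
            subalg_mult[OF A] by (metis mult_1)
        then have "sg T (a - \<alpha>) * sg T (b - \<alpha>) = - 1" using mem sg_mult by simp
        then consider "sg T (a - \<alpha>) = - 1" "sg T (b - \<alpha>) = 1" | "sg T (a - \<alpha>) = 1" "sg T (b - \<alpha>) = - 1"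
          using sg_cases[of "a - \<alpha>"] sg_cases[of "b - \<alpha>"] by auto
        then show ?thesis
        proof cases
          case 1
          then have "lt T a \<alpha>" "lt T \<alpha> b" using mem
            by (auto simp: sg_eq_1_iff sg_eq_neg1_iff lt_def)
          then show ?thesis using True \<open>poly f \<alpha> = 0\<close> by blast
        next
          case 2
          then have "lt T \<alpha> a" "lt T b \<alpha>" using mem
            by (auto simp: sg_eq_1_iff sg_eq_neg1_iff lt_def)
          then have "lt T b a" using less_trans by blast
          then show ?thesis using less_asym less.prems(4) by blast
        qed
      next
        case False
        \<comment> \<open>The polynomials \<open>G\<close> are sums of \<open>t * (g * g)\<close>
          with \<open>g\<close> reduced modulo \<open>m\<close>. The squares keep their values on
          \<open>K\<close> in \<open>T\<close>, and the degree bound makes the cofactor below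
          smaller than \<open>m\<close>.\<close>
        have form: "\<exists>G. coeffs_in K G \<and> z = poly G \<alpha> \<and> degree G \<le> 2 * (degree m - 1) \<and> (\<forall>c\<in>K. poly G c \<in> T)"
          if "z \<in> cone_ext T (adjoin K \<alpha>)" for z
          using that
        proof induction
          case zero
          show ?case using T00 by (intro exI[of _ 0]) (auto simp: coeffs_in_simps[OF A])
        next
          case (add z t y)
          then obtain G where G: "coeffs_in K G" "z = poly G \<alpha>" "degree G \<le> 2 * (degree m - 1)"
            "\<forall>c\<in>K. poly G c \<in> T" by blast
          obtain g where g: "coeffs_in K g" "y = poly g \<alpha>" "g = 0 \<or> degree g < degree m"
            using poly_reduced[OF K m(1-3) add(3)] by blast
          then have dg: "degree g \<le> degree m - 1" using dm by auto
          show ?case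
          proof (intro exI[of _ "G + smult t (g * g)"] conjI ballI)
            show "coeffs_in K (G + smult t (g * g))"
              by (intro coeffs_in_add[OF A] coeffs_in_smult[OF A] coeffs_in_mult[OF A] G g TK add)
            show "z + t * (y * y) = poly (G + smult t (g * g)) \<alpha>" using G g by simp
            have "degree (smult t (g * g)) \<le> 2 * (degree m - 1)"
              using degree_smult_le[of t "g * g"] degree_mult_le[of g g] dg by linarith
            then show "degree (G + smult t (g * g)) \<le> 2 * (degree m - 1)" using G(3) by (intro degree_add_le)
          next
            fix c assume c: "c \<in> K"
            then show "poly (G + smult t (g * g)) c \<in> T"
              using G(4) add(2) Tsq[OF val[OF g(1) c]] by (auto intro!: Tadd Tmult)
          qed
        qed
        \<comment> \<open>As \<open>1 + G\<close> is positive on \<open>K\<close>, its cofactor \<open>h\<close> changes sign together with \<open>m\<close>, but has smaller degree.\<close>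
        from form[OF ext[OF m(1-3) False]] obtain G where G: "coeffs_in K G" "- 1 = poly G \<alpha>"
          "degree G \<le> 2 * (degree m - 1)" "\<forall>c\<in>K. poly G c \<in> T" by blast
        have G1: "coeffs_in K (1 + G)" by (intro coeffs_in_add[OF A] coeffs_in_simps(2)[OF A] G)
        moreover have "poly (1 + G) \<alpha> = 0" using G(2)[symmetric] by simp
        ultimately obtain h where h: "coeffs_in K h" "1 + G = m * h" using dvd by blast
        have pos: "lt T 0 (poly (1 + G) c)" if "c \<in> K" for c
        proof -
          have "poly (1 + G) c \<in> T" using G(4) that T1 Tadd by simp
          moreover have "poly (1 + G) c \<noteq> 0"
          proof
            assume "poly (1 + G) c = 0"
            then have "poly G c = - 1" by (simp add: add_eq_0_iff)
            then show False using G(4) that Tneg by metis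
          qed
          ultimately show ?thesis by (simp add: lt_def)
        qed
        have "1 + G \<noteq> 0" using pos[OF less.prems(2)] less_irrefl by fastforce
        then have "h \<noteq> 0" using h by auto
        have "degree (1 + G) \<le> 2 * (degree m - 1)" using G(3) by (intro degree_add_le) auto
        then have "degree m + degree h \<le> 2 * (degree m - 1)"
          using h \<open>h \<noteq> 0\<close> m(2) by (simp add: degree_mult_eq)
        then have dh: "degree h < degree f" using m(4) dm by linarith
        have mh: "sg T (poly m c) * sg T (poly h c) = 1" if "c \<in> K" for c
        proof -
          have "poly (1 + G) c = poly m c * poly h c" unfolding h(2) by simp
          then have "sg T (poly m c * poly h c) = 1" using pos[OF that] sg_eq_1_iff by metis
          then show ?thesis using sg_mult[OF val[OF m(1) that] val[OF h(1) that]] by simp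
        qed
        have "sg T (poly h a) * sg T (poly h b) = - 1"
          using mh[OF less.prems(2)] mh[OF less.prems(3)] 2 change[OF m(1)]
            sg_cases[of "poly m a"] sg_cases[of "poly m b"] by auto
        \<comment> \<open>The induction hypothesis would give \<open>h\<close> a root in
          \<open>K\<close>, where \<open>m * h = 1 + G\<close> is nevertheless positive. Hence
          \<open>m\<close> cannot change sign when \<open>\<alpha>\<close> is outside
          \<open>K\<close>.\<close>
        then obtain c where c: "c \<in> K" "poly h c = 0"
          using less.hyps[OF dh h(1) less.prems(2-4)] change[OF h(1)] by blast
        then show ?thesis using mh[OF c(1)] by simp
      qed
    qed
  qed
  have "real_closed K T"
    unfolding real_closed_def using ord IVT by blast
  then show ?thesis using that T0T by blast
qed

section \<open>Specialisation of signs\<close>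

locale real_closed_field = ordered_R_field +
  assumes real_closed: "real_closed K T"
begin

lemma val: "coeffs_in K p \<Longrightarrow> c \<in> K \<Longrightarrow> poly p c \<in> K"
  by (rule poly_in_subalg[OF sub])

lemma IVT_sg:
  assumes "coeffs_in K p" "a \<in> K" "b \<in> K" "a \<lless> b" "sg T (poly p a) * sg T (poly p b) = - 1"
  shows "\<exists>c\<in>K. a \<lless> c \<and> c \<lless> b \<and> poly p c = 0"
proof -
  have "sg T (poly p a * poly p b) = - 1" using assms val by (simp add: sg_mult)
  then have "poly p a * poly p b \<lless> 0"
    using sg_eq_neg1_iff subalg_mult[OF sub] val assms by blast
  then show ?thesis using real_closed assms unfolding real_closed_def by blast
qed

lemma factor_root:
  assumes a: "a \<in> K"
  shows "coeffs_in K p \<Longrightarrow> p \<noteq> 0 \<Longrightarrow> \<exists>n q. coeffs_in K q \<and> p = [:- a, 1:] ^ n * q \<and> poly q a \<noteq> 0"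
proof (induction "degree p" arbitrary: p rule: less_induct)
  case less
  show ?case
  proof (cases "poly p a = 0")
    case False
    then show ?thesis using less.prems by (intro exI[of _ 0] exI[of _ p]) auto
  next
    case True
    have lin: "coeffs_in K [:- a, 1:]" using a by (simp add: coeffs_in_simps[OF sub] subalg_closed[OF sub])
    obtain q r where qr: "coeffs_in K q" "coeffs_in K r" "p = [:- a, 1:] * q + r" "r = 0 \<or> degree r < degree [:- a, 1:]"
      using division_R_subfield[OF K lin _ less.prems(1)] by auto
    then have "degree r = 0" by auto
    then obtain c where "r = [:c:]" by (rule degree_eq_zeroE)
    with True qr(3) have p: "p = [:- a, 1:] * q" by simp
    then have "q \<noteq> 0" using less.prems by auto
    then have "degree q < degree p" unfolding p by (subst degree_mult_eq) auto
    from less.hyps[OF this qr(1) \<open>q \<noteq> 0\<close>] obtain n g where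
      "coeffs_in K g" "q = [:- a, 1:] ^ n * g" "poly g a \<noteq> 0" by blast
    then show ?thesis
      by (intro exI[of _ "Suc n"] exI[of _ g]) (simp only: p power_Suc mult.assoc simp_thms)
  qed
qed

lemma sg_of_nat_Suc: "sg T (of_nat (Suc n)) = 1"
  using sg_of_real[of "of_nat (Suc n)"] by simp

text \<open>Only the intermediate value property is available, so the argument is algebraic. Let
  \<open>d\<close> be the next root after \<open>a\<close> and split off the powers of
  \<open>X - a\<close> and \<open>X - d\<close> from \<open>p\<close>, with exponents
  \<open>m\<close> and \<open>n\<close>, leaving \<open>g\<close>. The derivative has a cofactor
  \<open>h\<close> whose values at \<open>a\<close> and \<open>d\<close> are
  \<open>m * (a - d) * g(a)\<close> and \<open>n * (d - a) * g(d)\<close>. As \<open>g\<close> does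
  not change sign between \<open>a\<close> and \<open>d\<close>, \<open>h\<close> does.\<close>

lemma rolle:
  assumes p: "coeffs_in K p" "p \<noteq> 0" and ab: "a \<in> K" "b \<in> K" "a \<lless> b" "poly p a = 0" "poly p b = 0"
  shows "\<exists>c\<in>K. a \<lless> c \<and> c \<lless> b \<and> poly (pderiv p) c = 0"
proof -
  define Z where "Z = {z \<in> K. a \<lless> z \<and> poly p z = 0}"
  have "finite Z" using poly_roots_finite[OF p(2)] by (auto simp: Z_def)
  moreover have "b \<in> Z" using ab by (auto simp: Z_def)
  ultimately obtain d where d: "d \<in> Z" "\<forall>z\<in>Z. z = d \<or> d \<lless> z"
    using finite_has_least[of Z] by (auto simp: Z_def)
  have dK: "d \<in> K" "a \<lless> d" "poly p d = 0" using d by (auto simp: Z_def)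
  have db: "d = b \<or> d \<lless> b" using d(2) \<open>b \<in> Z\<close> by auto
  have ad: "a \<noteq> d" using dK(2) less_irrefl by auto
  obtain m q where q: "coeffs_in K q" "p = [:- a, 1:] ^ m * q" "poly q a \<noteq> 0"
    using factor_root[OF ab(1) p] by blast
  have "q \<noteq> 0" using q by auto
  then obtain n g where g: "coeffs_in K g" "q = [:- d, 1:] ^ n * g" "poly g d \<noteq> 0"
    using factor_root[OF dK(1) q(1)] by blast
  have "m \<noteq> 0" using q ab(4) by (cases m) auto
  then obtain m' where m': "m = Suc m'" using not0_implies_Suc by blast
  have "poly q d = 0" using q(2) dK(3) ad by simp
  then have "n \<noteq> 0" using g by (cases n) auto
  then obtain n' where n': "n = Suc n'" using not0_implies_Suc by blast
  define P Q where "P = [:- a, 1:]" and "Q = [:- d, 1:]"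
  define h where "h = smult (of_nat m) (Q * g) + smult (of_nat n) (P * g) + P * Q * pderiv g"
  have PQ: "coeffs_in K P" "coeffs_in K Q"
    using ab dK by (simp_all add: P_def Q_def coeffs_in_simps[OF sub] subalg_closed[OF sub])
  have h: "coeffs_in K h" unfolding h_def
    by (intro coeffs_in_add[OF sub] coeffs_in_smult[OF sub] coeffs_in_mult[OF sub] PQ g
        coeffs_in_pderiv[OF sub] subalg_of_nat[OF sub])
  have p_eq: "p = P ^ Suc m' * (Q ^ Suc n' * g)" using q g m' n' by (simp add: P_def Q_def)
  have "pderiv P = 1" "pderiv Q = 1" by (simp_all add: P_def Q_def pderiv_pCons)
  then have dp: "pderiv p = P ^ m' * Q ^ n' * h"
    unfolding p_eq h_def m' n' pderiv_mult pderiv_power_Suc by (simp add: algebra_simps)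
  have ga: "poly g a \<noteq> 0" using q(3) g(2) by auto
  have nz: "sg T (poly g a) * sg T (poly g d) \<noteq> - 1"
  proof
    assume "sg T (poly g a) * sg T (poly g d) = - 1"
    from IVT_sg[OF g(1) ab(1) dK(1,2) this] obtain c where c: "c \<in> K" "a \<lless> c" "c \<lless> d" "poly g c = 0" by blast
    then have "c \<in> Z" by (auto simp: Z_def p_eq)
    then have "c = d \<or> d \<lless> c" using d(2) by blast
    then show False using c(3) less_irrefl[of d] less_asym[of c d] by auto
  qed
  have PQ_val: "poly P z = z - a" "poly Q z = z - d" for z by (simp_all add: P_def Q_def)
  have "poly h a = of_nat m * ((a - d) * poly g a)" by (simp add: h_def PQ_val)
  then have sa: "sg T (poly h a) = - sg T (poly g a)"
    using ab dK(1) val[OF g(1)] subalg_diff[OF sub] subalg_mult[OF sub] subalg_of_nat[OF sub]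
      sg_of_nat_Suc[of m'] sg_eq_neg1_iff[of "a - d"] dK(2)
    by (simp add: sg_mult m' lt_def del: of_nat_Suc)
  have "poly h d = of_nat n * ((d - a) * poly g d)" by (simp add: h_def PQ_val)
  then have sd: "sg T (poly h d) = sg T (poly g d)"
    using ab dK(1) val[OF g(1)] subalg_diff[OF sub] subalg_mult[OF sub] subalg_of_nat[OF sub]
      sg_of_nat_Suc[of n'] sg_eq_1_iff[of "d - a"] dK(2) ad
    by (simp add: sg_mult n' lt_def del: of_nat_Suc)
  have "sg T (poly h a) * sg T (poly h d) = - 1"
    unfolding sa sd using nz ga g(3) sg_cases[of "poly g a"] sg_cases[of "poly g d"] by auto
  from IVT_sg[OF h ab(1) dK(1,2) this] obtain c where "c \<in> K" "a \<lless> c" "c \<lless> d" "poly h c = 0" by blast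
  then show ?thesis using db less_trans[of c d b] by (auto simp: dp intro!: bexI[of _ c])
qed

text \<open>Rolle's theorem excludes a second root on the closed interval and the nonvanishing
  derivative makes \<open>x\<close> a simple one; the factor left after removing
  \<open>X - x\<close> has no sign change. In this way the root \<open>x\<close>, itself not in the
  algebra at hand, is turned into a sign condition at \<open>u\<close> and \<open>v\<close>.\<close>

lemma simple_root_sign_change:
  assumes p: "coeffs_in K p" "p \<noteq> 0" and uxv: "u \<in> K" "x \<in> K" "v \<in> K" "u \<lless> x" "x \<lless> v"
    and root: "poly p x = 0"
    and no_crit: "\<And>c. c \<in> K \<Longrightarrow> u \<lless> c \<Longrightarrow> c \<lless> v \<Longrightarrow> poly (pderiv p) c \<noteq> 0"
  shows "sg T (poly p u) * sg T (poly p v) = - 1"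
proof -
  have other: "poly p y \<noteq> 0" if y: "y \<in> K" "y \<noteq> x" "u = y \<or> u \<lless> y" "y = v \<or> y \<lless> v" for y
  proof
    assume y0: "poly p y = 0"
    show False
    proof (cases "y \<lless> x")
      case True
      from rolle[OF p y(1) uxv(2) True y0 root] no_crit y(3) uxv(5) less_trans show False by blast
    next
      case False
      then have "x \<lless> y" using less_total[of x y] uxv y by blast
      from rolle[OF p uxv(2) y(1) this root y0] no_crit y(4) uxv(4) less_trans show False by blast
    qed
  qed
  obtain n g where g: "coeffs_in K g" "p = [:- x, 1:] ^ n * g" "poly g x \<noteq> 0"
    using factor_root[OF uxv(2) p] by blast
  have "n \<noteq> 0" using g root by (cases n) auto
  then obtain m where m: "n = Suc m" using not0_implies_Suc by blast
  have "pderiv [:- x, 1:] = 1" by (simp add: pderiv_pCons)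
  then have "poly (pderiv p) x = of_nat (Suc m) * 0 ^ m * poly g x"
    unfolding g(2) m pderiv_mult pderiv_power_Suc by simp
  then have "m = 0" using no_crit[OF uxv(2,4,5)] by (cases m) auto
  then have p_eq: "p = [:- x, 1:] * g" using g m by simp
  have nz: "sg T (poly g u) * sg T (poly g v) \<noteq> - 1"
  proof
    assume "sg T (poly g u) * sg T (poly g v) = - 1"
    from IVT_sg[OF g(1) uxv(1,3) less_trans[OF uxv(4,5)] this] obtain c where
      c: "c \<in> K" "u \<lless> c" "c \<lless> v" "poly g c = 0" by blast
    then have "c \<noteq> x" using g(3) by auto
    then show False using other[of c] c by (simp add: p_eq)
  qed
  have uv: "poly g u \<noteq> 0" "poly g v \<noteq> 0"
    using other[OF uxv(1)] other[OF uxv(3)] uxv less_irrefl less_trans[OF uxv(4,5)] by (auto simp: p_eq)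
  have "poly p u = (u - x) * poly g u" "poly p v = (v - x) * poly g v"
    by (simp_all add: p_eq algebra_simps)
  moreover have "sg T (u - x) = - 1" "sg T (v - x) = 1"
    using sg_eq_neg1_iff[of "u - x"] sg_eq_1_iff[of "v - x"] uxv subalg_diff[OF sub] by (auto simp: lt_def)
  ultimately have "sg T (poly p u) = - sg T (poly g u)" "sg T (poly p v) = sg T (poly g v)"
    using sg_mult[OF subalg_diff[OF sub uxv(1,2)] val[OF g(1) uxv(1)]]
      sg_mult[OF subalg_diff[OF sub uxv(3,2)] val[OF g(1) uxv(3)]] by simp_all
  then show ?thesis
    using nz uv sg_cases[of "poly g u"] sg_cases[of "poly g v"] by auto
qed

end

text \<open>Thom's lemma, by induction on the degree: the derivative has constant sign on the interval,
  so the polynomial is monotone and its sign is determined by those at the end points.\<close>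

lemma constant_signs:
  fixes Q :: "'i \<Rightarrow> real poly" and \<mu> :: "'i \<Rightarrow> nat" and \<sigma> :: "'i \<Rightarrow> real"
  assumes \<sigma>: "\<And>i. i \<in> I \<Longrightarrow> \<sigma> i = 1 \<or> \<sigma> i = - 1"
    and ends: "\<And>i. i \<in> I \<Longrightarrow> sgn (poly (Q i) a) \<in> {0, \<sigma> i} \<and> sgn (poly (Q i) b) \<in> {0, \<sigma> i}"
    and step: "\<And>i. i \<in> I \<Longrightarrow> (\<forall>r. sgn (poly (Q i) r) = \<sigma> i) \<or>
      (d i \<in> I \<and> \<mu> (d i) < \<mu> i \<and> pderiv (Q i) = Q (d i))"
  shows "i \<in> I \<Longrightarrow> a < r \<Longrightarrow> r < b \<Longrightarrow> sgn (poly (Q i) r) = \<sigma> i"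
proof (induction "\<mu> i" arbitrary: i r rule: less_induct)
  case less
  show ?case
  proof (cases "\<forall>r. sgn (poly (Q i) r) = \<sigma> i")
    case False
    then have d: "d i \<in> I" "\<mu> (d i) < \<mu> i" "pderiv (Q i) = Q (d i)" using step[OF less.prems(1)] by auto
    have IH: "sgn (poly (Q (d i)) s) = \<sigma> (d i)" if "a < s" "s < b" for s
      using less.hyps[OF d(2,1) that] .
    have cont: "continuous_on S (poly (Q i))" for S by (intro continuous_intros)
    have D: "(poly (Q i) has_real_derivative poly (Q (d i)) s) (at s)" for s
      using poly_DERIV[of "Q i" s] by (simp add: d(3))
    from \<sigma>[OF d(1)] show ?thesis
    proof
      assume s: "\<sigma> (d i) = 1"
      have pos: "poly (Q (d i)) z > 0" if "a < z" "z < b" for z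
        using IH[OF that] s by (simp add: sgn_1_pos)
      have inc: "poly (Q i) x < poly (Q i) y" if "a \<le> x" "x < y" "y \<le> b" for x y
        by (rule DERIV_pos_imp_increasing_open[OF that(2) _ cont]) (use D pos that in \<open>force\<close>)
      show ?thesis
        using inc[of a r] inc[of r b] less.prems ends[OF less.prems(1)] \<sigma>[OF less.prems(1)]
        by (auto simp: sgn_if split: if_splits)
    next
      assume s: "\<sigma> (d i) = - 1"
      have neg: "poly (Q (d i)) z < 0" if "a < z" "z < b" for z
        using IH[OF that] s by (simp add: sgn_1_neg)
      have dec: "poly (Q i) y < poly (Q i) x" if "a \<le> x" "x < y" "y \<le> b" for x y
        by (rule DERIV_neg_imp_decreasing_open[OF that(2) _ cont]) (use D neg that in \<open>force\<close>)
      show ?thesis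
        using dec[of a r] dec[of r b] less.prems ends[OF less.prems(1)] \<sigma>[OF less.prems(1)]
        by (auto simp: sgn_if split: if_splits)
    qed
  qed auto
qed

text \<open>Allowing every small value \<open>\<tau>\<close> of \<open>t\<close> is what later makes it possible to steer the quotient of two
  infinitesimals towards a given real number.\<close>

definition good :: "'a::real_field set \<Rightarrow> 'a \<Rightarrow> 'a set \<Rightarrow> bool" where
  "good T t A \<longleftrightarrow> (\<forall>S. finite S \<and> S \<subseteq> A \<longrightarrow>
     (\<forall>\<^sub>F \<tau> in at_right 0. \<exists>\<phi>. alg_hom A \<phi> \<and> \<phi> t = \<tau> \<and> (\<forall>s\<in>S. sgn (\<phi> s) = sg T s)))"

section \<open>Extending sign-preserving homomorphisms by one generator\<close>

lemma goodD:
  assumes "good T t A" "finite S" "S \<subseteq> A"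
  shows "\<forall>\<^sub>F \<tau> in at_right 0. \<exists>\<phi>. alg_hom A \<phi> \<and> \<phi> t = \<tau> \<and> (\<forall>s\<in>S. sgn (\<phi> s) = sg T s)"
  using assms unfolding good_def by simp

lemma good_mono: "good T t B \<Longrightarrow> A \<subseteq> B \<Longrightarrow> good T t A"
  unfolding good_def[of T t A]
proof (intro allI impI)
  fix S assume B: "good T t B" and AB: "A \<subseteq> B" and S: "finite S \<and> S \<subseteq> A"
  then have "finite S" "S \<subseteq> B" by auto
  from goodD[OF B this]
  show "\<forall>\<^sub>F \<tau> in at_right 0. \<exists>\<phi>. alg_hom A \<phi> \<and> \<phi> t = \<tau> \<and> (\<forall>s\<in>S. sgn (\<phi> s) = sg T s)"
    by eventually_elim (use alg_hom_mono[OF _ AB] in blast)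
qed

text \<open>The polynomial 0 stands for a transcendental element, where every polynomial counts as
  reduced and \<open>c\<close> is 1. This convention lets algebraic and transcendental generators
  share one argument.\<close>

lemma pseudo_reduction:
  assumes A: "subalg A" and p: "coeffs_in A p" and g: "coeffs_in A g"
    and c: "c = (if p = 0 then 1 else lead_coeff p)"
  obtains k h r where "coeffs_in A h" "coeffs_in A r" "smult (c ^ k) g = p * h + r"
    "r = 0 \<or> p = 0 \<or> degree r < degree p"
proof (cases "p = 0")
  case True
  then show ?thesis using that[of 0 g 0] g coeffs_in_simps[OF A] by simp
next
  case False
  then show ?thesis using pseudo_division[OF A p False g] that c by auto
qed

text \<open>Up to powers of \<open>c\<close>, the leading coefficient of \<open>p\<close>, the
  elements of \<open>adjoin A x\<close> reduce to values of remainders of degree below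
  \<open>degree p\<close>. So it is enough to preserve the signs of \<open>c\<close> and of finitely
  many remainders while sending \<open>x\<close> to a root of the mapped \<open>p\<close>.\<close>

lemma good_adjoinI:
  assumes ord: "field_ordering K T" and A: "subalg A" "A \<subseteq> K" and x: "x \<in> K"
    and p: "coeffs_in A p" "poly p x = 0"
    and indep: "\<And>q. coeffs_in A q \<Longrightarrow> q \<noteq> 0 \<Longrightarrow> p = 0 \<or> degree q < degree p \<Longrightarrow> poly q x \<noteq> 0"
    and specialise: "\<And>S \<Sigma>. finite S \<Longrightarrow> S \<subseteq> A \<Longrightarrow> finite \<Sigma> \<Longrightarrow>
      (\<And>q. q \<in> \<Sigma> \<Longrightarrow> coeffs_in A q \<and> q \<noteq> 0 \<and> (p = 0 \<or> degree q < degree p)) \<Longrightarrow>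
      (\<forall>\<^sub>F \<tau> in at_right 0. \<exists>\<phi> r. alg_hom A \<phi> \<and> \<phi> t = \<tau> \<and> (\<forall>s\<in>S. sgn (\<phi> s) = sg T s) \<and>
         (\<forall>q\<in>\<Sigma>. sgn (poly (map_poly \<phi> q) r) = sg T (poly q x)) \<and> poly (map_poly \<phi> p) r = 0)"
    and t: "t \<in> A"
  shows "good T t (adjoin A x)"
  unfolding good_def
proof (intro allI impI)
  interpret ordered_R_field K T by unfold_locales (rule ord)
  fix S assume S: "finite S \<and> S \<subseteq> adjoin A x"
  define c where "c = (if p = 0 then 1 else lead_coeff p)"
  have c: "c \<in> A" "c \<noteq> 0"
    using p(1) subalg_1[OF A(1)] coeffs_in_lead_coeff by (auto simp: c_def)
  have "\<exists>g k h r. s = poly g x \<and> coeffs_in A g \<and> coeffs_in A h \<and> coeffs_in A r \<and>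
      smult (c ^ k) g = p * h + r \<and> (r = 0 \<or> p = 0 \<or> degree r < degree p)" if "s \<in> S" for s
  proof -
    from that S obtain g where g: "coeffs_in A g" "s = poly g x" unfolding adjoin_def by blast
    show ?thesis using pseudo_reduction[OF A(1) p(1) g(1) c_def] g by metis
  qed
  then obtain g k h r where red: "\<And>s. s \<in> S \<Longrightarrow> s = poly (g s) x \<and> coeffs_in A (g s) \<and>
      coeffs_in A (h s) \<and> coeffs_in A (r s) \<and>
      smult (c ^ k s) (g s) = p * h s + r s \<and> (r s = 0 \<or> p = 0 \<or> degree (r s) < degree p)"
    by metis
  \<comment> \<open>Vanishing remainders are left out because \<open>specialise\<close> speaks of
    nonzero polynomials only; their sign is 0 on both sides.\<close>
  define \<Sigma> where "\<Sigma> = r ` S - {0}"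
  have "\<forall>\<^sub>F \<tau> in at_right 0. \<exists>\<phi> y. alg_hom A \<phi> \<and> \<phi> t = \<tau> \<and> (\<forall>s\<in>{c}. sgn (\<phi> s) = sg T s) \<and>
         (\<forall>q\<in>\<Sigma>. sgn (poly (map_poly \<phi> q) y) = sg T (poly q x)) \<and> poly (map_poly \<phi> p) y = 0"
    by (rule specialise) (use S c red in \<open>auto simp: \<Sigma>_def\<close>)
  then show "\<forall>\<^sub>F \<tau> in at_right 0. \<exists>\<phi>. alg_hom (adjoin A x) \<phi> \<and> \<phi> t = \<tau> \<and> (\<forall>s\<in>S. sgn (\<phi> s) = sg T s)"
  proof eventually_elim
    case (elim \<tau>)
    then obtain \<phi> y where \<phi>: "alg_hom A \<phi>" "\<phi> t = \<tau>" "sgn (\<phi> c) = sg T c"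
      "\<And>q. q \<in> \<Sigma> \<Longrightarrow> sgn (poly (map_poly \<phi> q) y) = sg T (poly q x)" "poly (map_poly \<phi> p) y = 0"
      by auto
    have \<phi>c: "\<phi> c \<noteq> 0" using \<phi>(3) c(2) by (auto simp: sgn_if sg_def split: if_splits)
    \<comment> \<open>At a root of the mapped \<open>p\<close> the multiple of \<open>p\<close> in
      the pseudo-division disappears, and the remaining factor can be cancelled because
      \<open>\<phi> c\<close> is nonzero.\<close>
    have main: "\<phi> c ^ k * poly (map_poly \<phi> g) y = poly (map_poly \<phi> r) y"
      if "coeffs_in A g" "coeffs_in A h" "coeffs_in A r" "smult (c ^ k) g = p * h + r" for k g h r
    proof -
      have "map_poly \<phi> (smult (c ^ k) g) = map_poly \<phi> (p * h + r)" using that by simp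
      then have "smult (\<phi> c ^ k) (map_poly \<phi> g) = map_poly \<phi> p * map_poly \<phi> h + map_poly \<phi> r"
        using alg_hom_map_poly_smult[OF A(1) \<phi>(1) that(1) subalg_power[OF A(1) c(1)], of k]
          alg_hom_map_poly_add[OF A(1) \<phi>(1) coeffs_in_mult[OF A(1) p(1) that(2)] that(3)]
          alg_hom_map_poly_mult[OF A(1) \<phi>(1) p(1) that(2)] alg_hom_power[OF A(1) \<phi>(1) c(1), of k]
        by simp
      then show ?thesis using \<phi>(5) by (metis add_0 mult_zero_left poly_add poly_mult poly_smult)
    qed
    obtain \<psi> where \<psi>: "alg_hom (adjoin A x) \<psi>"
      "\<And>q. coeffs_in A q \<Longrightarrow> \<psi> (poly q x) = poly (map_poly \<phi> q) y"
      "\<And>a. a \<in> A \<Longrightarrow> \<psi> a = \<phi> a" "\<psi> x = y"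
    proof (rule alg_hom_adjoin[OF A(1) \<phi>(1)])
      fix q assume q: "coeffs_in A q" "poly q x = 0"
      obtain k h r where r: "coeffs_in A h" "coeffs_in A r" "smult (c ^ k) q = p * h + r"
        "r = 0 \<or> p = 0 \<or> degree r < degree p"
        using pseudo_reduction[OF A(1) p(1) q(1) c_def] by blast
      have "poly (smult (c ^ k) q) x = poly (p * h + r) x" using r by simp
      then have "poly r x = 0" using q p by simp
      then have "r = 0" using indep[of r] r by auto
      then show "poly (map_poly \<phi> q) y = 0" using main[OF q(1) r(1-3)] \<phi>c by simp
    qed blast
    have "sgn (\<psi> s) = sg T s" if s: "s \<in> S" for s
    proof -
      have sx: "poly (g s) x = s" and R: "coeffs_in A (g s)" "coeffs_in A (h s)" "coeffs_in A (r s)"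
        "smult (c ^ k s) (g s) = p * h s + r s"
        using red[OF s] by auto
      have "poly (smult (c ^ k s) (g s)) x = poly (p * h s + r s) x" using R by metis
      then have eq: "c ^ k s * s = poly (r s) x" using p by (simp add: sx)
      have sK: "s \<in> K"
        using poly_in_subalg[OF sub coeffs_in_mono[OF A(2) R(1)] x] sx by simp
      have "sgn (\<phi> c) ^ k s * sgn (\<psi> s) = sgn (\<phi> c ^ k s * poly (map_poly \<phi> (g s)) y)"
        using \<psi>(2)[OF R(1)] sx by (simp add: sgn_mult power_sgn)
      also have "\<dots> = sgn (poly (map_poly \<phi> (r s)) y)" using main[OF R] by simp
      also have "\<dots> = sg T (poly (r s) x)"
        using \<phi>(4)[of "r s"] s by (cases "r s = 0") (auto simp: \<Sigma>_def)
      also have "\<dots> = sg T c ^ k s * sg T s"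
        unfolding eq[symmetric] using c A sK by (subst sg_mult) (auto simp: sg_power subalg_power[OF sub])
      finally show ?thesis using \<phi>(3) c(2) by simp
    qed
    then show ?case using \<psi>(1,3) \<phi>(2) t by auto
  qed
qed


text \<open>Derivatives of order beyond the degree vanish.\<close>

lemma finite_pderiv_closure:
  fixes \<Sigma> :: "'a::real_field poly set"
  assumes "finite \<Sigma>"
  shows "finite ({(pderiv ^^ k) q |q k. q \<in> \<Sigma>} - {0})"
proof -
  have deg: "degree ((pderiv ^^ k) q) = degree q - k" for k and q :: "'a poly"
    by (induction k) (auto simp: degree_pderiv)
  have "(pderiv ^^ k) q = 0" if lt: "degree q < k" for k and q :: "'a poly"
  proof -
    obtain j where j: "k = Suc j" "degree q \<le> j" using lt by (cases k) auto
    then have "degree ((pderiv ^^ j) q) = 0" using deg by simp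
    then show ?thesis using j by (simp add: pderiv_eq_0_iff)
  qed
  then have "(pderiv ^^ k) q \<in> (\<Union>q\<in>\<Sigma>. (\<lambda>k. (pderiv ^^ k) q) ` {..degree q}) \<or> (pderiv ^^ k) q = 0"
    if "q \<in> \<Sigma>" for q k
    using that by (cases "k \<le> degree q") auto
  then have "{(pderiv ^^ k) q |q k. q \<in> \<Sigma>} - {0} \<subseteq> (\<Union>q\<in>\<Sigma>. (\<lambda>k. (pderiv ^^ k) q) ` {..degree q})"
    by blast
  then show ?thesis by (rule finite_subset) (use assms in auto)
qed

context real_closed_field
begin

text \<open>Let \<open>u\<close> and \<open>v\<close> be the roots of the family nearest to
  \<open>x\<close> on either side. No member vanishes strictly between them, so at \<open>u\<close>
  and \<open>v\<close> each member is 0 or has its sign at \<open>x\<close>. A homomorphism on the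
  algebra generated by \<open>A\<close>, \<open>u\<close> and \<open>v\<close> that preserves
  finitely many signs carries this over to a real interval. There \<open>constant_signs\<close>
  yields the right signs at every inner point, and the image of a nonzero \<open>p\<close> changes
  sign, so it has a root inside.\<close>

lemma specialise_between_roots:
  assumes A: "subalg A" "A \<subseteq> K" "t \<in> A"
    and \<Sigma>: "finite \<Sigma>" "\<And>q. q \<in> \<Sigma> \<Longrightarrow> coeffs_in A q \<and> poly q x \<noteq> 0 \<and> (pderiv q = 0 \<or> pderiv q \<in> \<Sigma>)"
      "[:1, 1:] \<in> \<Sigma>" "[:- 1, 1:] \<in> \<Sigma>"
    and x: "x \<in> K" "- 1 \<lless> x" "x \<lless> 1"
    and good: "\<And>u v. u \<in> K \<Longrightarrow> v \<in> K \<Longrightarrow> \<exists>q\<in>\<Sigma>. poly q u = 0 \<Longrightarrow> \<exists>q\<in>\<Sigma>. poly q v = 0 \<Longrightarrow>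
      good T t (adjoin (adjoin A u) v)"
    and p: "coeffs_in A p" "p = 0 \<or> (poly p x = 0 \<and> pderiv p \<in> \<Sigma>)"
    and S: "finite S" "S \<subseteq> A"
  shows "\<forall>\<^sub>F \<tau> in at_right 0. \<exists>\<phi> r. alg_hom A \<phi> \<and> \<phi> t = \<tau> \<and> (\<forall>s\<in>S. sgn (\<phi> s) = sg T s) \<and>
         (\<forall>q\<in>\<Sigma>. sgn (poly (map_poly \<phi> q) r) = sg T (poly q x)) \<and> poly (map_poly \<phi> p) r = 0"
proof -
  define Z where "Z = {z \<in> K. \<exists>q\<in>\<Sigma>. poly q z = 0}"
  have Kq: "coeffs_in K q" if "q \<in> \<Sigma>" for q using \<Sigma>(2)[OF that] coeffs_in_mono A(2) by blast
  have "Z \<subseteq> (\<Union>q\<in>\<Sigma>. {z. poly q z = 0})" by (auto simp: Z_def)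
  moreover have "finite (\<Union>q\<in>\<Sigma>. {z. poly q z = 0})"
  proof (rule finite_UN_I[OF \<Sigma>(1)])
    fix q assume "q \<in> \<Sigma>"
    then have "q \<noteq> 0" using \<Sigma>(2)[of q] by force
    then show "finite {z. poly q z = 0}" by (rule poly_roots_finite)
  qed
  ultimately have finZ: "finite Z" by (rule finite_subset)
  have one: "1 \<in> K" "- 1 \<in> K" using subalg_closed[OF sub] by auto
  \<comment> \<open>The linear polynomials with roots -1 and 1 belong to \<open>\<Sigma>\<close> so
    that the family has a root on each side of \<open>x\<close>.\<close>
  have "- 1 \<in> Z" using one bexI[OF _ \<Sigma>(3), of "\<lambda>q. poly q (- 1) = 0"] by (simp add: Z_def)
  moreover have "1 \<in> Z" using one bexI[OF _ \<Sigma>(4), of "\<lambda>q. poly q 1 = 0"] by (simp add: Z_def)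
  ultimately have ne: "{z\<in>Z. z \<lless> x} \<noteq> {}" "{z\<in>Z. x \<lless> z} \<noteq> {}" using x by auto
  have ZK: "{z\<in>Z. z \<lless> x} \<subseteq> K" "{z\<in>Z. x \<lless> z} \<subseteq> K" by (auto simp: Z_def)
  have fin: "finite {z\<in>Z. z \<lless> x}" "finite {z\<in>Z. x \<lless> z}" using finZ by simp_all
  obtain u where uZ: "u \<in> {z\<in>Z. z \<lless> x}" "\<forall>z\<in>{z\<in>Z. z \<lless> x}. z = u \<or> z \<lless> u"
    using finite_has_greatest[OF fin(1) ne(1) ZK(1)] by (rule bexE)
  obtain v where vZ: "v \<in> {z\<in>Z. x \<lless> z}" "\<forall>z\<in>{z\<in>Z. x \<lless> z}. z = v \<or> v \<lless> z"
    using finite_has_least[OF fin(2) ne(2) ZK(2)] by (rule bexE)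
  have u: "u \<in> Z" "u \<lless> x" "\<And>z. z \<in> Z \<Longrightarrow> z \<lless> x \<Longrightarrow> z = u \<or> z \<lless> u"
    and v: "v \<in> Z" "x \<lless> v" "\<And>z. z \<in> Z \<Longrightarrow> x \<lless> z \<Longrightarrow> z = v \<or> v \<lless> z"
    using uZ vZ by blast+
  have uv: "u \<in> K" "v \<in> K" "u \<lless> v" using u(1) v(1) less_trans[OF u(2) v(2)] by (simp_all add: Z_def)
  have no_root: "poly q c \<noteq> 0" if "q \<in> \<Sigma>" "c \<in> K" "u \<lless> c" "c \<lless> v" for q c
  proof
    assume "poly q c = 0"
    then have cZ: "c \<in> Z" using that by (auto simp: Z_def)
    have "c \<noteq> x" using \<Sigma>(2)[OF that(1)] \<open>poly q c = 0\<close> by auto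
    then have "c \<lless> x \<or> x \<lless> c" using less_total x(1) that(2) by blast
    then show False using u(3)[OF cZ] v(3)[OF cZ] that(3,4) less_irrefl less_asym by metis
  qed
  have ends: "sg T (poly q u) \<in> {0, sg T (poly q x)}" "sg T (poly q v) \<in> {0, sg T (poly q x)}"
    if q: "q \<in> \<Sigma>" for q
  proof -
    have "sg T (poly q u) * sg T (poly q x) \<noteq> - 1"
      using IVT_sg[OF Kq[OF q] uv(1) x(1) u(2)] no_root[OF q] v(2) less_trans by blast
    moreover have "sg T (poly q x) * sg T (poly q v) \<noteq> - 1"
      using IVT_sg[OF Kq[OF q] x(1) uv(2) v(2)] no_root[OF q] u(2) less_trans by blast
    moreover have "sg T (poly q x) \<noteq> 0" using \<Sigma>(2)[OF q] by simp
    ultimately show "sg T (poly q u) \<in> {0, sg T (poly q x)}" "sg T (poly q v) \<in> {0, sg T (poly q x)}"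
      using sg_cases[of "poly q u"] sg_cases[of "poly q v"] sg_cases[of "poly q x"] by auto
  qed
  have change: "sg T (poly p u) * sg T (poly p v) = - 1" if "p \<noteq> 0"
    using p that
    by (intro simple_root_sign_change[OF coeffs_in_mono[OF A(2)] _ uv(1) x(1) uv(2) u(2) v(2)] no_root) auto
  define B where "B = adjoin (adjoin A u) v"
  have B: "subalg B" "A \<subseteq> B" "u \<in> B" "v \<in> B"
    using adjoin_subalg[OF adjoin_subalg[OF A(1)]] adjoin_superset[OF A(1)]
      adjoin_superset[OF adjoin_subalg[OF A(1)]] adjoin_generator[OF A(1)]
      adjoin_generator[OF adjoin_subalg[OF A(1)]] unfolding B_def by blast+
  have AB: "coeffs_in A q \<Longrightarrow> coeffs_in B q" for q using coeffs_in_mono B(2) by blast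
  \<comment> \<open>Besides the values at \<open>u\<close> and \<open>v\<close>, the sign of
    \<open>v - u\<close> keeps the real interval nonempty, and the coefficients of degree 0 fix the
    signs of the constant members, at which the descent by derivatives ends.\<close>
  define S' where "S' = S \<union> (\<lambda>q. poly q u) ` insert p \<Sigma> \<union> (\<lambda>q. poly q v) ` insert p \<Sigma> \<union> {v - u} \<union> (\<lambda>q. coeff q 0) ` \<Sigma>"
  have S': "finite S'" "S' \<subseteq> B"
    using S B(2) \<Sigma>(1,2) p(1) AB poly_in_subalg[OF B(1)] B(3,4) subalg_diff[OF B(1)]
    unfolding S'_def coeffs_in_def by auto
  have "good T t B"
    unfolding B_def by (rule good) (use u(1) v(1) uv in \<open>auto simp: Z_def\<close>)
  then have "\<forall>\<^sub>F \<tau> in at_right 0. \<exists>\<phi>. alg_hom B \<phi> \<and> \<phi> t = \<tau> \<and> (\<forall>s\<in>S'. sgn (\<phi> s) = sg T s)"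
    unfolding good_def using S' by blast
  then show ?thesis
  proof eventually_elim
    case (elim \<tau>)
    then obtain \<phi> where \<phi>: "alg_hom B \<phi>" "\<phi> t = \<tau>" "\<And>s. s \<in> S' \<Longrightarrow> sgn (\<phi> s) = sg T s" by blast
    define Q where "Q q = map_poly \<phi> q" for q
    have at: "\<phi> (poly q e) = poly (Q q) (\<phi> e)" if "coeffs_in A q" "e \<in> B" for q e
      unfolding Q_def using alg_hom_poly[OF B(1) \<phi>(1) AB[OF that(1)] that(2)] .
    have "sgn (\<phi> (v - u)) = sg T (v - u)" using \<phi>(3) by (auto simp: S'_def)
    also have "\<dots> = 1" using uv(3) by (auto simp: sg_eq_1_iff lt_def)
    finally have lt: "\<phi> u < \<phi> v"
      using alg_hom_diff[OF B(1) \<phi>(1) B(4,3)] by (simp add: sgn_1_pos)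
    have pd: "Q (pderiv q) = pderiv (Q q)" if "coeffs_in A q" for q
      unfolding Q_def using alg_hom_map_poly_pderiv[OF A(1) alg_hom_mono[OF \<phi>(1) B(2)] that] .
    have sgns: "sgn (poly (Q q) r) = sg T (poly q x)" if "q \<in> \<Sigma>" "\<phi> u < r" "r < \<phi> v" for q r
    proof (rule constant_signs[where I = \<Sigma> and Q = Q and d = pderiv and \<mu> = degree and \<sigma> = "\<lambda>q. sg T (poly q x)"])
      fix i assume i: "i \<in> \<Sigma>"
      note c = conjunct1[OF \<Sigma>(2)[OF i]]
      show "sg T (poly i x) = 1 \<or> sg T (poly i x) = - 1"
        using \<Sigma>(2)[OF i] sg_cases[of "poly i x"] by auto
      have "sgn (\<phi> (poly i u)) = sg T (poly i u)" "sgn (\<phi> (poly i v)) = sg T (poly i v)"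
        using i by (auto intro!: \<phi>(3) simp: S'_def)
      then show "sgn (poly (Q i) (\<phi> u)) \<in> {0, sg T (poly i x)} \<and> sgn (poly (Q i) (\<phi> v)) \<in> {0, sg T (poly i x)}"
        using ends[OF i] at[OF c B(3)] at[OF c B(4)] by simp
      show "(\<forall>r. sgn (poly (Q i) r) = sg T (poly i x)) \<or>
        (pderiv i \<in> \<Sigma> \<and> degree (pderiv i) < degree i \<and> pderiv (Q i) = Q (pderiv i))"
      proof (cases "pderiv i = 0")
        case True
        then have "degree i = 0" by (simp add: pderiv_eq_0_iff)
        then obtain a where a: "i = [:a:]" by (rule degree_eq_zeroE)
        have "sgn (\<phi> (coeff i 0)) = sg T (coeff i 0)" using i by (auto intro!: \<phi>(3) simp: S'_def)
        then show ?thesis by (simp add: Q_def a map_poly_pCons_hom[OF \<phi>(1)])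
      next
        case False
        then have "degree i \<noteq> 0" by (simp add: pderiv_eq_0_iff)
        then show ?thesis using False \<Sigma>(2)[OF i] pd[OF c] by (simp add: degree_pderiv)
      qed
    qed (use that in auto)
    have "\<exists>r. \<phi> u < r \<and> r < \<phi> v \<and> poly (Q p) r = 0"
    proof (cases "p = 0")
      case True
      then show ?thesis using dense[OF lt] by (auto simp: Q_def)
    next
      case False
      have "sgn (\<phi> (poly p u)) = sg T (poly p u)" "sgn (\<phi> (poly p v)) = sg T (poly p v)"
        by (auto intro!: \<phi>(3) simp: S'_def)
      then have "sgn (poly (Q p) (\<phi> u) * poly (Q p) (\<phi> v)) = - 1"
        using change[OF False] at[OF p(1) B(3)] at[OF p(1) B(4)] by (simp add: sgn_mult)
      then have "poly (Q p) (\<phi> u) * poly (Q p) (\<phi> v) < 0" by (simp add: sgn_1_neg)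
      from poly_IVT[OF lt this] show ?thesis by blast
    qed
    then obtain r where "\<phi> u < r" "r < \<phi> v" "poly (Q p) r = 0" by blast
    moreover have "\<forall>s\<in>S. sgn (\<phi> s) = sg T s" using \<phi>(3) by (auto simp: S'_def)
    ultimately show ?case
      using sgns \<phi>(2) alg_hom_mono[OF \<phi>(1) B(2)] unfolding Q_def by blast
  qed
qed

text \<open>The family is closed under derivatives for the sake of \<open>constant_signs\<close>,
  and enlarged by \<open>pderiv p\<close>, so that \<open>p\<close> has no critical point near
  \<open>x\<close>, and by the linear polynomials with roots -1 and 1. If \<open>p\<close> is
  nonzero, all members must have smaller degree than \<open>p\<close>: then \<open>x\<close> is not
  a root of them and their own roots are covered by \<open>good\<close>. For the linear ones this
  requires degree at least 2.\<close>

lemma good_adjoin_bounded: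
  assumes A: "subalg A" "A \<subseteq> K" "t \<in> A" and x: "x \<in> K" "- 1 \<lless> x" "x \<lless> 1"
    and p: "coeffs_in A p" "poly p x = 0" "p = 0 \<or> degree p \<ge> 2"
    and indep: "\<And>q. coeffs_in A q \<Longrightarrow> q \<noteq> 0 \<Longrightarrow> p = 0 \<or> degree q < degree p \<Longrightarrow> poly q x \<noteq> 0"
    and good: "\<And>u v q q'. u \<in> K \<Longrightarrow> v \<in> K \<Longrightarrow>
      coeffs_in A q \<Longrightarrow> q \<noteq> 0 \<Longrightarrow> p = 0 \<or> degree q < degree p \<Longrightarrow> poly q u = 0 \<Longrightarrow>
      coeffs_in A q' \<Longrightarrow> q' \<noteq> 0 \<Longrightarrow> p = 0 \<or> degree q' < degree p \<Longrightarrow> poly q' v = 0 \<Longrightarrow>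
      good T t (adjoin (adjoin A u) v)"
  shows "good T t (adjoin A x)"
proof (rule good_adjoinI[OF ordering A(1,2) x(1) p(1,2) indep _ A(3)])
  fix S and \<Sigma> :: "'a poly set"
  assume S: "finite S" "S \<subseteq> A" and \<Sigma>: "finite \<Sigma>"
    and \<Sigma>': "\<And>q. q \<in> \<Sigma> \<Longrightarrow> coeffs_in A q \<and> q \<noteq> 0 \<and> (p = 0 \<or> degree q < degree p)"
  define \<Sigma>0 where "\<Sigma>0 = \<Sigma> \<union> {[:1, 1:], [:- 1, 1:]} \<union> (if p = 0 then {} else {pderiv p})"
  define \<Sigma>1 where "\<Sigma>1 = {(pderiv ^^ k) q |q k. q \<in> \<Sigma>0} - {0}"
  have "p \<noteq> 0 \<Longrightarrow> pderiv p \<noteq> 0" using p(3) by (auto simp: pderiv_eq_0_iff)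
  then have \<Sigma>0: "coeffs_in A q \<and> (p = 0 \<or> degree q < degree p) \<and> q \<noteq> 0" if "q \<in> \<Sigma>0" for q
    using that \<Sigma>' p coeffs_in_pderiv[OF A(1)] subalg_closed[OF A(1)]
    by (auto simp: \<Sigma>0_def coeffs_in_simps[OF A(1)] degree_pderiv split: if_splits)
  have low: "coeffs_in A ((pderiv ^^ k) q) \<and> (p = 0 \<or> degree ((pderiv ^^ k) q) < degree p)"
    if "q \<in> \<Sigma>0" for q k
  proof (induction k)
    case 0
    then show ?case using \<Sigma>0[OF that] by simp
  next
    case (Suc k)
    then show ?case using coeffs_in_pderiv[OF A(1)] by (auto simp: degree_pderiv)
  qed
  have \<Sigma>1: "coeffs_in A q \<and> (p = 0 \<or> degree q < degree p) \<and> q \<noteq> 0" if "q \<in> \<Sigma>1" for q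
    using that low unfolding \<Sigma>1_def by blast
  have sub01: "\<Sigma>0 \<subseteq> \<Sigma>1"
  proof
    fix q assume q: "q \<in> \<Sigma>0"
    then have "q = (pderiv ^^ 0) q" "q \<noteq> 0" using \<Sigma>0 by auto
    then show "q \<in> \<Sigma>1" unfolding \<Sigma>1_def using q by blast
  qed
  have closed: "pderiv q \<in> \<Sigma>1" if "q \<in> \<Sigma>1" "pderiv q \<noteq> 0" for q
  proof -
    from that(1) obtain q0 k where "q0 \<in> \<Sigma>0" "q = (pderiv ^^ k) q0" unfolding \<Sigma>1_def by blast
    then have "q0 \<in> \<Sigma>0" "pderiv q = (pderiv ^^ Suc k) q0" by auto
    then show ?thesis using that(2) unfolding \<Sigma>1_def by blast
  qed
  have "\<forall>\<^sub>F \<tau> in at_right 0. \<exists>\<phi> r. alg_hom A \<phi> \<and> \<phi> t = \<tau> \<and> (\<forall>s\<in>S. sgn (\<phi> s) = sg T s) \<and>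
         (\<forall>q\<in>\<Sigma>1. sgn (poly (map_poly \<phi> q) r) = sg T (poly q x)) \<and> poly (map_poly \<phi> p) r = 0"
  proof (rule specialise_between_roots[OF A _ _ _ _ x _ p(1) _ S])
    show "finite \<Sigma>1" unfolding \<Sigma>1_def
      by (rule finite_pderiv_closure) (simp add: \<Sigma>0_def \<Sigma>)
    show "[:1, 1:] \<in> \<Sigma>1" "[:- 1, 1:] \<in> \<Sigma>1" using sub01 by (auto simp: \<Sigma>0_def)
    show "p = 0 \<or> poly p x = 0 \<and> pderiv p \<in> \<Sigma>1" 
      using p sub01 by (cases "p = 0") (auto simp: \<Sigma>0_def)
    show "coeffs_in A q \<and> poly q x \<noteq> 0 \<and> (pderiv q = 0 \<or> pderiv q \<in> \<Sigma>1)" if "q \<in> \<Sigma>1" for q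
      using \<Sigma>1[OF that] indep[of q] closed[OF that] by blast
    show "good T t (adjoin (adjoin A u) v)"
      if "u \<in> K" "v \<in> K" "\<exists>q\<in>\<Sigma>1. poly q u = 0" "\<exists>q\<in>\<Sigma>1. poly q v = 0" for u v
      using good[OF that(1,2)] that(3,4) \<Sigma>1 by blast
  qed
  then show "\<forall>\<^sub>F \<tau> in at_right 0. \<exists>\<phi> r. alg_hom A \<phi> \<and> \<phi> t = \<tau> \<and> (\<forall>s\<in>S. sgn (\<phi> s) = sg T s) \<and>
         (\<forall>q\<in>\<Sigma>. sgn (poly (map_poly \<phi> q) r) = sg T (poly q x)) \<and> poly (map_poly \<phi> p) r = 0"
  proof (rule eventually_mono)
    have sub: "\<Sigma> \<subseteq> \<Sigma>1" using sub01 unfolding \<Sigma>0_def by blast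
    fix \<tau> :: real
    assume "\<exists>\<phi> r. alg_hom A \<phi> \<and> \<phi> t = \<tau> \<and> (\<forall>s\<in>S. sgn (\<phi> s) = sg T s) \<and>
         (\<forall>q\<in>\<Sigma>1. sgn (poly (map_poly \<phi> q) r) = sg T (poly q x)) \<and> poly (map_poly \<phi> p) r = 0"
    then obtain \<phi> r where \<phi>: "alg_hom A \<phi>" "\<phi> t = \<tau>" "\<forall>s\<in>S. sgn (\<phi> s) = sg T s"
      "\<forall>q\<in>\<Sigma>1. sgn (poly (map_poly \<phi> q) r) = sg T (poly q x)" "poly (map_poly \<phi> p) r = 0" by blast
    have "\<forall>q\<in>\<Sigma>. sgn (poly (map_poly \<phi> q) r) = sg T (poly q x)"
      by (intro ballI bspec[OF \<phi>(4)] subsetD[OF sub])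
    with \<phi> show "\<exists>\<phi> r. alg_hom A \<phi> \<and> \<phi> t = \<tau> \<and> (\<forall>s\<in>S. sgn (\<phi> s) = sg T s) \<and>
         (\<forall>q\<in>\<Sigma>. sgn (poly (map_poly \<phi> q) r) = sg T (poly q x)) \<and> poly (map_poly \<phi> p) r = 0"
      by blast
  qed
qed

text \<open>Modulo the linear polynomial annihilating \<open>x\<close> only constants are reduced,
  so the signs to preserve are signs in \<open>A\<close>. The generator goes to the quotient of the
  values of \<open>a\<close> and \<open>b\<close>, where preserving the sign of \<open>b\<close>
  keeps the denominator from vanishing.\<close>

lemma good_adjoin_fraction:
  assumes A: "subalg A" "A \<subseteq> K" "t \<in> A" "good T t A" and x: "x \<in> K"
    and ab: "a \<in> A" "b \<in> A" "b \<noteq> 0" "b * x = a"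
  shows "good T t (adjoin A x)"
proof (rule good_adjoinI[OF ordering A(1,2) x, of "[:- a, b:]"])
  show "coeffs_in A [:- a, b:]" using ab subalg_uminus[OF A(1)] by (simp add: coeffs_in_simps[OF A(1)])
  show "poly [:- a, b:] x = 0" using ab by (simp add: mult.commute)
  have deg: "degree [:- a, b:] = 1" using ab by simp
  show "poly q x \<noteq> 0" if "coeffs_in A q" "q \<noteq> 0" "[:- a, b:] = 0 \<or> degree q < degree [:- a, b:]" for q
  proof -
    have "degree q = 0" using that ab by auto
    then obtain c where "q = [:c:]" by (rule degree_eq_zeroE)
    then show ?thesis using that by auto
  qed
  fix S and \<Sigma> :: "'a poly set"
  assume S: "finite S" "S \<subseteq> A" and \<Sigma>: "finite \<Sigma>"
    and \<Sigma>': "\<And>q. q \<in> \<Sigma> \<Longrightarrow> coeffs_in A q \<and> q \<noteq> 0 \<and> ([:- a, b:] = 0 \<or> degree q < degree [:- a, b:])"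
  define S' where "S' = S \<union> {b} \<union> (\<lambda>q. coeff q 0) ` \<Sigma>"
  have "finite S'" "S' \<subseteq> A" using S \<Sigma> \<Sigma>' ab by (auto simp: S'_def coeffs_in_def)
  then have "\<forall>\<^sub>F \<tau> in at_right 0. \<exists>\<phi>. alg_hom A \<phi> \<and> \<phi> t = \<tau> \<and> (\<forall>s\<in>S'. sgn (\<phi> s) = sg T s)"
    using A(4) unfolding good_def by blast
  then show "\<forall>\<^sub>F \<tau> in at_right 0. \<exists>\<phi> r. alg_hom A \<phi> \<and> \<phi> t = \<tau> \<and> (\<forall>s\<in>S. sgn (\<phi> s) = sg T s) \<and>
         (\<forall>q\<in>\<Sigma>. sgn (poly (map_poly \<phi> q) r) = sg T (poly q x)) \<and> poly (map_poly \<phi> [:- a, b:]) r = 0"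
  proof eventually_elim
    case (elim \<tau>)
    then obtain \<phi> where \<phi>: "alg_hom A \<phi>" "\<phi> t = \<tau>" "\<And>s. s \<in> S' \<Longrightarrow> sgn (\<phi> s) = sg T s" by blast
    have "sgn (\<phi> b) = sg T b" using \<phi>(3) by (auto simp: S'_def)
    then have "\<phi> b \<noteq> 0" using ab by (auto simp: sg_def split: if_splits)
    then have "poly (map_poly \<phi> [:- a, b:]) (\<phi> a / \<phi> b) = 0"
      using alg_hom_uminus[OF A(1) \<phi>(1) ab(1)] by (simp add: map_poly_pCons_hom[OF \<phi>(1)])
    moreover have "sgn (poly (map_poly \<phi> q) (\<phi> a / \<phi> b)) = sg T (poly q x)" if q: "q \<in> \<Sigma>" for q
    proof -
      have "degree q = 0" using \<Sigma>'[OF q] ab by auto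
      then obtain c where c: "q = [:c:]" by (rule degree_eq_zeroE)
      have "sgn (\<phi> (coeff q 0)) = sg T (coeff q 0)" using q \<phi>(3) by (auto simp: S'_def)
      then show ?thesis by (simp add: c map_poly_pCons_hom[OF \<phi>(1)])
    qed
    ultimately show ?case using \<phi> by (auto simp: S'_def)
  qed
qed (use A in auto)

lemma inverse_bound:
  assumes x: "x \<in> K" "x \<lless> - 1 \<or> 1 \<lless> x"
  shows "- 1 \<lless> inverse x" "inverse x \<lless> 1" "x \<noteq> 0"
proof -
  have pos: "- 1 \<lless> inverse y \<and> inverse y \<lless> 1 \<and> 0 \<lless> inverse y \<and> y \<noteq> 0" if y: "1 \<lless> y" for y
  proof -
    have "0 \<lless> 1" using pos_of_real[of 1] by simp
    then have y0: "0 \<lless> y" using y less_trans by blast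
    then have ne: "y \<noteq> 0" using less_irrefl by auto
    then have i: "0 \<lless> inverse y" using y0 T_inverse[of y] by (simp add: lt_def)
    have "0 \<lless> (y - 1) * inverse y" using pos_mult[OF _ i] y less_iff_pos by blast
    then have "0 \<lless> 1 - inverse y" using ne by (simp add: algebra_simps)
    then have "inverse y \<lless> 1" using less_iff_pos by blast
    moreover have "- 1 \<lless> 0" using \<open>0 \<lless> 1\<close> neg_iff by simp
    ultimately show ?thesis using i ne less_trans by blast
  qed
  have flip: "- a \<lless> - b \<longleftrightarrow> b \<lless> a" for a b by (auto simp: lt_def)
  from x(2) have "- 1 \<lless> inverse x \<and> inverse x \<lless> 1 \<and> x \<noteq> 0"
  proof
    assume "x \<lless> - 1"
    then have "1 \<lless> - x" using flip[of "- 1" x] flip[of 1 "- x"] by simp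
    from pos[OF this] show ?thesis
      using flip[of 1 "- inverse x"] flip[of "inverse x" "- 1"] flip[of "- inverse x" 1]
        less_trans[of "inverse x" 0 1] neg_iff[of "inverse x"] pos_of_real[of 1] by simp
  qed (use pos in blast)
  then show "- 1 \<lless> inverse x" "inverse x \<lless> 1" "x \<noteq> 0" by auto
qed

text \<open>An element outside the interval from -1 to 1 is replaced by its inverse and then
  recovered as a fraction over the algebra containing the inverse. Bounded elements have the
  auxiliary roots -1 and 1 as neighbours, so unbounded intervals never occur.\<close>

lemma good_adjoin_from_bounded:
  assumes A: "subalg A" "A \<subseteq> K" "t \<in> A" "good T t A" and x: "x \<in> K"
    and bounded: "\<And>y. y \<in> K \<Longrightarrow> - 1 \<lless> y \<Longrightarrow> y \<lless> 1 \<Longrightarrow> y = x \<or> y = inverse x \<Longrightarrow> good T t (adjoin A y)"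
  shows "good T t (adjoin A x)"
proof -
  have one: "1 \<in> K" "- 1 \<in> K" using subalg_closed[OF sub] by auto
  then consider "x = 1 \<or> x = - 1" | "- 1 \<lless> x" "x \<lless> 1" | "x \<lless> - 1 \<or> 1 \<lless> x"
    using less_total[of x 1] less_total[of x "- 1"] x by blast
  then show ?thesis
  proof cases
    case 1
    then have "x \<in> A" using subalg_closed[OF A(1)] by auto
    then have "adjoin A x \<subseteq> A" by (intro adjoin_least A) auto
    then show ?thesis using good_mono[OF A(4)] by blast
  next
    case 2
    then show ?thesis using bounded x by blast
  next
    case 3
    note inv = inverse_bound[OF x 3]
    define y where "y = inverse x"
    define B where "B = adjoin A y"
    have y: "y \<in> K" unfolding y_def using R_subfield_inverse[OF K x] .
    have B: "subalg B" "B \<subseteq> K" "A \<subseteq> B" "y \<in> B"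
      unfolding B_def using adjoin_subalg[OF A(1)] adjoin_least[OF sub A(2) y]
        adjoin_superset[OF A(1)] adjoin_generator[OF A(1)] by blast+
    have gB: "good T t B" unfolding B_def using bounded[OF y] inv by (simp add: y_def)
    have "good T t (adjoin B x)"
      by (rule good_adjoin_fraction[OF B(1,2) _ gB x subalg_1[OF B(1)] B(4)])
        (use A(3) B(3) inv(3) in \<open>auto simp: y_def\<close>)
    moreover have "adjoin A x \<subseteq> adjoin B x" unfolding adjoin_def using coeffs_in_mono[OF B(3)] by blast
    ultimately show ?thesis by (rule good_mono)
  qed
qed

text \<open>The signs at \<open>x\<close> can be read off at the neighbouring roots of polynomials of smaller degree than the
  minimal polynomial of \<open>x\<close>, and these roots are covered by the induction hypothesis.\<close>

lemma good_adjoin_algebraic: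
  "\<lbrakk>subalg A; A \<subseteq> K; t \<in> A; good T t A; x \<in> K; coeffs_in A p; p \<noteq> 0; poly p x = 0\<rbrakk>
    \<Longrightarrow> good T t (adjoin A x)"
proof (induction "degree p" arbitrary: A x p rule: less_induct)
  case less
  note A = less.prems(1-4)
  have bounded: "good T t (adjoin A y)"
    if y: "y \<in> K" "- 1 \<lless> y" "y \<lless> 1" and p': "coeffs_in A p'" "p' \<noteq> 0" "poly p' y = 0" "degree p' \<le> degree p"
    for y p'
  proof -
    obtain m where m: "coeffs_in A m" "m \<noteq> 0" "poly m y = 0" "degree m \<le> degree p'"
      and min: "\<And>q. coeffs_in A q \<Longrightarrow> q \<noteq> 0 \<Longrightarrow> poly q y = 0 \<Longrightarrow> degree m \<le> degree q"
      using min_poly_exists[OF p'(1-3)] by blast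
    \<comment> \<open>Degree 1 is separated because the auxiliary linear polynomials would not have
      smaller degree; there \<open>y\<close> is a fraction over \<open>A\<close>.\<close>
    consider "degree m < degree p" | "degree m = 0" | "degree m = 1" | "degree m = degree p" "degree m \<ge> 2"
      using m(4) p'(4) by linarith
    then show ?thesis
    proof cases
      case 1
      then show ?thesis using less.hyps[OF 1 A y(1) m(1-3)] by blast
    next
      case 2
      then obtain c where "m = [:c:]" by (rule degree_eq_zeroE)
      then show ?thesis using m by auto
    next
      case 3
      define c0 c1 where "c0 = coeff m 0" and "c1 = coeff m 1"
      have "m = [:c0, c1:]"
        using 3 by (intro poly_eqI) (auto simp: c0_def c1_def coeff_pCons coeff_eq_0 split: nat.splits)
      then have "c0 + y * c1 = 0" using m(3) by simp
      then have "c1 * y = - c0" by (simp add: eq_neg_iff_add_eq_0 algebra_simps)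
      moreover have "c1 \<noteq> 0" using 3 m(2) by (metis c1_def leading_coeff_0_iff)
      moreover have "c0 \<in> A" "c1 \<in> A" using m(1) by (auto simp: c0_def c1_def coeffs_in_def)
      ultimately show ?thesis
        using good_adjoin_fraction[OF A y(1), of "- c0" c1] subalg_uminus[OF A(1)] by blast
    next
      case 4
      show ?thesis
      proof (rule good_adjoin_bounded[OF A(1-3) y m(1,3)])
        show "m = 0 \<or> degree m \<ge> 2" using 4 by simp
        show "poly q y \<noteq> 0" if "coeffs_in A q" "q \<noteq> 0" "m = 0 \<or> degree q < degree m" for q
          using min[OF that(1,2)] that(3) m(2) by auto
        fix u v q q'
        assume u: "u \<in> K" "coeffs_in A q" "q \<noteq> 0" "m = 0 \<or> degree q < degree m" "poly q u = 0"
          and v: "v \<in> K" "coeffs_in A q'" "q' \<noteq> 0" "m = 0 \<or> degree q' < degree m" "poly q' v = 0"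
        have d: "degree q < degree p" "degree q' < degree p" using u v 4 m(2) by auto
        define B where "B = adjoin A u"
        have B: "subalg B" "B \<subseteq> K" "A \<subseteq> B"
          unfolding B_def using adjoin_subalg[OF A(1)] adjoin_least[OF sub A(2) u(1)]
            adjoin_superset[OF A(1)] by blast+
        \<comment> \<open>The induction runs over all algebras, so \<open>q'\<close> can be used
          again over \<open>adjoin A u\<close>, where it need not be minimal for
          \<open>v\<close>.\<close>
        have "good T t B" unfolding B_def using less.hyps[OF d(1) A u(1-3,5)] .
        then show "good T t (adjoin (adjoin A u) v)"
          using less.hyps[OF d(2) B(1,2) _ _ v(1) coeffs_in_mono[OF B(3) v(2)] v(3,5)] A(3) B(3)
          unfolding B_def by blast
      qed
    qed
  qed
  show ?case
  proof (rule good_adjoin_from_bounded[OF A less.prems(5)])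
    fix y assume y: "y \<in> K" "- 1 \<lless> y" "y \<lless> 1" "y = x \<or> y = inverse x"
    show "good T t (adjoin A y)"
    proof (cases "y = x")
      case True
      then show ?thesis using bounded[OF y(1-3) less.prems(6,7)] less.prems(8) by simp
    next
      case False
      then have yx: "y = inverse x" using y by blast
      have "x \<noteq> 0" using False yx by auto
      \<comment> \<open>Reversing the coefficients gives a polynomial for the inverse of no larger
        degree.\<close>
      then have "poly (reflect_poly p) y = 0" using poly_reflect_poly_nz[of y p] less.prems(8) yx by simp
      moreover have "coeffs_in A (reflect_poly p)"
        using less.prems(6) subalg_0[OF A(1)] by (auto simp: coeffs_in_def coeff_reflect_poly)
      ultimately show ?thesis
        using bounded[OF y(1-3)] less.prems(7) degree_reflect_poly_le[of p] by auto
    qed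
  qed
qed

text \<open>If no nonzero polynomial over \<open>A\<close> annihilates the element, the case
  \<open>p = 0\<close> of the bounded step applies. It asks only for the neighbouring roots
  \<open>u\<close> and \<open>v\<close>, which are algebraic over \<open>A\<close> and hence already
  settled.\<close>

lemma good_adjoin:
  assumes A: "subalg A" "A \<subseteq> K" "t \<in> A" "good T t A" and x: "x \<in> K"
  shows "good T t (adjoin A x)"
proof (rule good_adjoin_from_bounded[OF A x])
  fix y assume y: "y \<in> K" "- 1 \<lless> y" "y \<lless> 1"
  show "good T t (adjoin A y)"
  proof (cases "\<exists>p. coeffs_in A p \<and> p \<noteq> 0 \<and> poly p y = 0")
    case True
    then show ?thesis using good_adjoin_algebraic[OF A y(1)] by blast
  next
    case False
    show ?thesis
    proof (rule good_adjoin_bounded[OF A(1-3) y coeffs_in_simps(1)[OF A(1)]])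
      fix u v q q'
      assume u: "u \<in> K" "coeffs_in A q" "q \<noteq> 0" "poly q u = 0"
        and v: "v \<in> K" "coeffs_in A q'" "q' \<noteq> 0" "poly q' v = 0"
      define B where "B = adjoin A u"
      have B: "subalg B" "B \<subseteq> K" "A \<subseteq> B"
        unfolding B_def using adjoin_subalg[OF A(1)] adjoin_least[OF sub A(2) u(1)]
          adjoin_superset[OF A(1)] by blast+
      have "good T t B" unfolding B_def using good_adjoin_algebraic[OF A u] .
      then show "good T t (adjoin (adjoin A u) v)"
        using good_adjoin_algebraic[OF B(1,2) _ _ v(1) coeffs_in_mono[OF B(3) v(2)] v(3,4)] A(3) B(3)
        unfolding B_def by blast
    qed (use False in auto)
  qed
qed

end

section \<open>The Artin--Lang theorem\<close>

definition pos_infinitesimal :: "'a::real_field set \<Rightarrow> 'a set \<Rightarrow> 'a \<Rightarrow> bool" where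
  "pos_infinitesimal K T t \<longleftrightarrow> t \<in> K \<and> lt T 0 t \<and> (\<forall>\<epsilon>>0. lt T t (of_real \<epsilon>))"

context ordered_R_field
begin

lemma poly_infinitesimal_bounded:
  assumes t: "pos_infinitesimal K T t"
  shows "\<exists>C>0. 0 \<lless> of_real C - poly (map_poly of_real p) t \<and> 0 \<lless> of_real C + poly (map_poly of_real p) t"
proof (induction p)
  case 0
  show ?case by (intro exI[of _ 1]) (use pos_of_real[of 1] in simp)
next
  case (pCons a p)
  define w where "w = poly (map_poly of_real p) t"
  obtain C where C: "C > 0" "0 \<lless> of_real C - w" "0 \<lless> of_real C + w"
    using pCons.IH unfolding w_def by blast
  have t0: "0 \<lless> t" using t by (simp add: pos_infinitesimal_def)
  have "t \<lless> of_real 1" using t unfolding pos_infinitesimal_def by (metis zero_less_one)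
  then have t1: "0 \<lless> of_real C * (1 - t)"
    using pos_mult[of "of_real C" "1 - t"] C(1) less_iff_pos[of t 1] by (simp add: pos_of_real)
  have c: "0 \<lless> of_real (\<bar>a\<bar> - a + 1)" "0 \<lless> of_real (\<bar>a\<bar> + a + 1)" by (simp_all only: pos_of_real)
  note m = pos_mult[OF t0 C(2)] pos_mult[OF t0 C(3)]
  have "0 \<lless> of_real (\<bar>a\<bar> + 1 + C) - (of_real a + t * w)"
    using pos_add[OF c(1) pos_add[OF t1 m(1)]] by (simp add: algebra_simps)
  moreover have "0 \<lless> of_real (\<bar>a\<bar> + 1 + C) + (of_real a + t * w)"
    using pos_add[OF c(2) pos_add[OF t1 m(2)]] by (simp add: algebra_simps)
  moreover have "poly (map_poly of_real (pCons a p)) t = of_real a + t * w"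
    by (simp add: map_poly_pCons w_def)
  ultimately show ?case using C(1) by (intro exI[of _ "\<bar>a\<bar> + 1 + C"]) auto
qed

text \<open>Both signs are that of the lowest nonzero coefficient: a factor \<open>t\<close> or
  \<open>\<tau>\<close> is positive, and a bounded multiple of \<open>t\<close> cannot outweigh a
  nonzero real constant. As the sign is nonzero, an infinitesimal is transcendental over the
  reals.\<close>

lemma poly_infinitesimal_sign:
  assumes t: "pos_infinitesimal K T t"
  shows "p \<noteq> 0 \<Longrightarrow> \<exists>\<sigma>. \<sigma> \<noteq> 0 \<and> sg T (poly (map_poly of_real p) t) = \<sigma> \<and>
    (\<forall>\<^sub>F \<tau> in at_right 0. sgn (poly p \<tau>) = \<sigma>)"
proof (induction p)
  case (pCons a p)
  define w where "w = poly (map_poly of_real p) t"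
  have val: "poly (map_poly of_real (pCons a p)) t = of_real a + t * w"
    by (simp add: map_poly_pCons w_def)
  have t0: "0 \<lless> t" "t \<in> K" using t by (simp_all add: pos_infinitesimal_def)
  have w: "w \<in> K" unfolding w_def
    by (rule poly_in_subalg[OF sub _ t0(2)]) (simp add: coeffs_in_def coeff_map_poly subalg_of_real[OF sub])
  show ?case
  proof (cases "a = 0")
    case True
    then have "p \<noteq> 0" using pCons.prems by auto
    then obtain \<sigma> where \<sigma>: "\<sigma> \<noteq> 0" "sg T w = \<sigma>" "\<forall>\<^sub>F \<tau> in at_right 0. sgn (poly p \<tau>) = \<sigma>"
      using pCons.IH[OF \<open>p \<noteq> 0\<close>] unfolding w_def by blast
    have "sg T t = 1" using t0 by (simp add: sg_eq_1_iff)
    then have "sg T (t * w) = \<sigma>" using sg_mult[OF t0(2) w] \<sigma>(2) by simp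
    moreover have "\<forall>\<^sub>F \<tau> in at_right 0. sgn (poly (pCons a p) \<tau>) = \<sigma>"
      using \<sigma>(3) eventually_at_right_less[of "0::real"]
      by eventually_elim (simp add: True sgn_mult)
    ultimately show ?thesis using \<sigma>(1) val True by auto
  next
    case False
    obtain C where C: "C > 0" "0 \<lless> of_real C - w" "0 \<lless> of_real C + w"
      using poly_infinitesimal_bounded[OF t] unfolding w_def by blast
    have "\<bar>a\<bar> / C > 0" using C False by simp
    then have "t \<lless> of_real (\<bar>a\<bar> / C)" using t unfolding pos_infinitesimal_def by blast
    then have "0 \<lless> of_real C * (of_real (\<bar>a\<bar> / C) - t)"
      using pos_mult[of "of_real C"] C(1) less_iff_pos[of t] by (simp only: pos_of_real)
    moreover have "of_real C * (of_real (\<bar>a\<bar> / C) - t) = of_real \<bar>a\<bar> - of_real C * t"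
      unfolding right_diff_distrib of_real_mult[symmetric] using C(1) by simp
    ultimately have d: "0 \<lless> of_real \<bar>a\<bar> - of_real C * t" by simp
    have "sg T (of_real a + t * w) = sgn a"
    proof (cases "a > 0")
      case True
      then have "0 \<lless> of_real a + t * w"
        using pos_add[OF d pos_mult[OF t0(1) C(3)]] by (simp add: algebra_simps)
      then show ?thesis using True by (simp add: sg_eq_1_iff)
    next
      case neg: False
      then have "0 \<lless> - (of_real a + t * w)"
        using pos_add[OF d pos_mult[OF t0(1) C(2)]] by (simp add: algebra_simps)
      then have "sg T (- (of_real a + t * w)) = 1" by (simp only: sg_eq_1_iff)
      then show ?thesis
        using sg_uminus[of "of_real a + t * w"] subalg_add[OF sub subalg_of_real[OF sub] subalg_mult[OF sub t0(2) w]]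
          neg False by simp
    qed
    moreover have "\<forall>\<^sub>F \<tau> in at_right 0. sgn (poly (pCons a p) \<tau>) = sgn a"
    proof -
      have "(poly (pCons a p) \<longlongrightarrow> poly (pCons a p) 0) (at_right 0)"
        by (intro tendsto_intros)
      then have lim: "(poly (pCons a p) \<longlongrightarrow> a) (at_right 0)" by simp
      show ?thesis
      proof (cases "a > 0")
        case True
        from order_tendstoD(1)[OF lim True] show ?thesis
          by eventually_elim (use True in simp)
      next
        case neg: False
        then have "a < 0" using False by simp
        from order_tendstoD(2)[OF lim this] show ?thesis
          by eventually_elim (use \<open>a < 0\<close> in simp)
      qed
    qed
    ultimately show ?thesis using False val by (intro exI[of _ "sgn a"]) (auto simp: sgn_eq_0_iff)
  qed
qed simp

text \<open>The base case of Artin--Lang. As \<open>t\<close> is transcendental over the reals,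
  evaluation at any \<open>\<tau>\<close> is a homomorphism on the polynomials in \<open>t\<close>;
  this is the origin of the freedom to prescribe the value of \<open>t\<close>.\<close>

lemma good_infinitesimal:
  assumes t: "pos_infinitesimal K T t"
  shows "good T t (alg {t})"
  unfolding good_def
proof (intro allI impI)
  let ?R = "range of_real :: 'a set"
  have R: "subalg ?R" using subalg_alg[of "{}"] by (simp add: alg_empty)
  define \<phi>0 :: "'a \<Rightarrow> real" where "\<phi>0 = the_inv of_real"
  have \<phi>0: "\<phi>0 (of_real r) = r" for r unfolding \<phi>0_def by (rule the_inv_f_f[OF inj_of_real])
  have hom0: "alg_hom ?R \<phi>0"
    unfolding alg_hom_def using \<phi>0 by (auto simp flip: of_real_add of_real_mult)
  have real_poly: "\<exists>p. q = map_poly of_real p \<and> map_poly \<phi>0 q = p" if "coeffs_in ?R q" for q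
  proof (intro exI conjI)
    show "q = map_poly of_real (map_poly \<phi>0 q)"
    proof (rule poly_eqI)
      fix n
      have "coeff q n \<in> ?R" using that by (simp add: coeffs_in_def)
      then obtain r where "coeff q n = of_real r" by blast
      then show "coeff q n = coeff (map_poly of_real (map_poly \<phi>0 q)) n"
        using \<phi>0[of 0] by (simp add: coeff_map_poly \<phi>0)
    qed
  qed simp
  fix S assume "finite S \<and> S \<subseteq> alg {t}"
  then have S: "finite S" "S \<subseteq> adjoin ?R t" by (auto simp: alg_insert alg_empty)
  have "\<exists>q. s = poly q t \<and> coeffs_in ?R q" if "s \<in> S" for s
    using S that unfolding adjoin_def by blast
  then obtain q where q: "\<And>s. s \<in> S \<Longrightarrow> s = poly (q s) t \<and> coeffs_in ?R (q s)" by metis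
  have "\<forall>\<^sub>F \<tau> in at_right 0. \<forall>s\<in>S. sgn (poly (map_poly \<phi>0 (q s)) \<tau>) = sg T s"
  proof (rule eventually_ball_finite[OF S(1)], intro ballI)
    fix s assume s: "s \<in> S"
    obtain p where p: "q s = map_poly of_real p" "map_poly \<phi>0 (q s) = p" using real_poly q[OF s] by blast
    have ps: "poly (map_poly of_real p) t = s" using q[OF s] p by simp
    show "\<forall>\<^sub>F \<tau> in at_right 0. sgn (poly (map_poly \<phi>0 (q s)) \<tau>) = sg T s"
    proof (cases "p = 0")
      case True
      then show ?thesis using ps p(2) by auto
    next
      case False
      show ?thesis using poly_infinitesimal_sign[OF t False] unfolding ps p(2) by blast
    qed
  qed
  then show "\<forall>\<^sub>F \<tau> in at_right 0. \<exists>\<phi>. alg_hom (alg {t}) \<phi> \<and> \<phi> t = \<tau> \<and> (\<forall>s\<in>S. sgn (\<phi> s) = sg T s)"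
  proof eventually_elim
    case (elim \<tau>)
    obtain \<psi> where \<psi>: "alg_hom (adjoin ?R t) \<psi>"
      "\<And>p. coeffs_in ?R p \<Longrightarrow> \<psi> (poly p t) = poly (map_poly \<phi>0 p) \<tau>" "\<psi> t = \<tau>"
    proof (rule alg_hom_adjoin[OF R hom0])
      fix g assume g: "coeffs_in ?R g" "poly g t = 0"
      obtain p where p: "g = map_poly of_real p" "map_poly \<phi>0 g = p" using real_poly[OF g(1)] by blast
      have "p = 0"
        using poly_infinitesimal_sign[OF t, of p] g(2) p(1) by auto
      then show "poly (map_poly \<phi>0 g) \<tau> = 0" using p(2) by simp
    qed blast
    have "sgn (\<psi> s) = sg T s" if s: "s \<in> S" for s
      using \<psi>(2)[of "q s"] q[OF s] elim s by metis
    then show ?case using \<psi>(1,3) by (auto simp: alg_insert alg_empty)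
  qed
qed

end

lemma (in real_closed_field) good_alg:
  assumes t: "pos_infinitesimal K T t" and "finite G" "G \<subseteq> K"
  shows "good T t (alg (insert t G))"
  using assms(2,3)
proof (induction G rule: finite_induct)
  case empty
  show ?case by (rule good_infinitesimal[OF t])
next
  case (insert x G)
  have "t \<in> K" using t by (simp add: pos_infinitesimal_def)
  then have "alg (insert t G) \<subseteq> K" using insert.prems by (intro alg_least[OF sub]) auto
  moreover have "t \<in> alg (insert t G)" using alg_superset[of "insert t G"] by simp
  ultimately have "good T t (adjoin (alg (insert t G)) x)"
    using good_adjoin[OF subalg_alg] insert by auto
  then show ?case by (simp add: alg_insert[symmetric] insert_commute)
qed

section \<open>Passing to the algebraic closure of the ambient field\<close>

instantiation alg_closure :: (real_field) real_field
begin

definition scaleR_alg_closure :: "real \<Rightarrow> 'a alg_closure \<Rightarrow> 'a alg_closure" where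
  "scaleR_alg_closure r x = to_ac (of_real r) * x"

instance
proof
  fix a b :: real and x y :: "'a alg_closure"
  show "a *\<^sub>R (x + y) = a *\<^sub>R x + a *\<^sub>R y"
    unfolding scaleR_alg_closure_def by (rule distrib_left)
  show "(a + b) *\<^sub>R x = a *\<^sub>R x + b *\<^sub>R x"
    unfolding scaleR_alg_closure_def of_real_add to_ac_add by (rule distrib_right)
  show "a *\<^sub>R b *\<^sub>R x = (a * b) *\<^sub>R x"
    unfolding scaleR_alg_closure_def of_real_mult to_ac_mult by (rule mult.assoc[symmetric])
  show "1 *\<^sub>R x = x"
    unfolding scaleR_alg_closure_def by simp
  show "a *\<^sub>R x * y = a *\<^sub>R (x * y)" "x * a *\<^sub>R y = a *\<^sub>R (x * y)"
    unfolding scaleR_alg_closure_def by (simp_all only: mult_ac)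
qed

end

lemma to_ac_of_real: "to_ac (of_real r) = of_real r"
  by (simp add: of_real_def[where 'a = "'a alg_closure"] scaleR_alg_closure_def)

lemma precone_to_ac:
  fixes F T :: "'a::real_field set"
  assumes "precone F T"
  shows "precone (to_ac ` F) (to_ac ` T)"
proof -
  have K: "is_R_subfield F" and TF: "x \<in> T \<Longrightarrow> x \<in> F" and closed: "x \<in> T \<Longrightarrow> y \<in> T \<Longrightarrow> x + y \<in> T \<and> x * y \<in> T"
    and sq: "z \<in> F \<Longrightarrow> z * z \<in> T" and neg: "- 1 \<notin> T" for x y z
    using assms unfolding precone_def by blast+
  note sub = subalg_R_subfield[OF K]
  have F': "is_R_subfield (to_ac ` F)"
    unfolding is_R_subfield_def
  proof (intro conjI ballI subsetI)
    fix x :: "'a alg_closure" assume "x \<in> range of_real"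
    then obtain r where "x = to_ac (of_real r)" by (auto simp: to_ac_of_real)
    then show "x \<in> to_ac ` F" using subalg_of_real[OF sub] by blast
  next
    fix x y assume "x \<in> to_ac ` F" "y \<in> to_ac ` F"
    then obtain a b where "a \<in> F" "b \<in> F" "x = to_ac a" "y = to_ac b" by blast
    then have "x + y = to_ac (a + b)" "x * y = to_ac (a * b)" "a + b \<in> F" "a * b \<in> F"
      using subalg_add[OF sub] subalg_mult[OF sub] by auto
    then show "x + y \<in> to_ac ` F" "x * y \<in> to_ac ` F" by blast+
  next
    fix x assume "x \<in> to_ac ` F"
    then obtain a where "a \<in> F" "x = to_ac a" by blast
    then have "- x = to_ac (- a)" "inverse x = to_ac (inverse a)" "- a \<in> F" "inverse a \<in> F"
      using subalg_uminus[OF sub] R_subfield_inverse[OF K] by auto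
    then show "- x \<in> to_ac ` F" "inverse x \<in> to_ac ` F" by blast+
  qed
  show ?thesis
    unfolding precone_def
  proof (intro conjI ballI F')
    show "to_ac ` T \<subseteq> to_ac ` F" using TF by blast
    show "- 1 \<notin> to_ac ` T"
    proof
      assume "- 1 \<in> to_ac ` T"
      then obtain x where "x \<in> T" "to_ac x = to_ac (- 1)" by force
      then show False using neg by (simp only: to_ac_eq_iff)
    qed
  next
    fix x y assume "x \<in> to_ac ` T" "y \<in> to_ac ` T"
    then obtain a b where "a \<in> T" "b \<in> T" "x = to_ac a" "y = to_ac b" by blast
    then have "x + y = to_ac (a + b)" "x * y = to_ac (a * b)" "a + b \<in> T" "a * b \<in> T"
      using closed by auto
    then show "x + y \<in> to_ac ` T" "x * y \<in> to_ac ` T" by blast+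
  next
    fix x assume "x \<in> to_ac ` F"
    then obtain a where "a \<in> F" "x = to_ac a" by blast
    then have "x * x = to_ac (a * a)" "a * a \<in> T" using sq by auto
    then show "x * x \<in> to_ac ` T" by blast
  qed
qed

text \<open>The ordering is the restriction to \<open>F\<close> of that of a real closed field
  inside the algebraic closure whose cone contains the precone.\<close>

lemma precone_ordering:
  fixes F T :: "'a::real_field set"
  assumes T: "precone F T"
  obtains P where "field_ordering F P" "T \<subseteq> P"
proof -
  obtain K Q where rc: "real_closed K Q" and Q: "to_ac ` T \<subseteq> Q"
    using real_closure[OF precone_to_ac[OF T]] by blast
  interpret ordered_R_field K Q by unfold_locales (use rc in \<open>simp add: real_closed_def\<close>)
  define P where "P = {x \<in> F. to_ac x \<in> Q}"
  have F: "is_R_subfield F" and TF: "T \<subseteq> F" using T by (auto simp: precone_def)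
  note A = subalg_R_subfield[OF F]
  have FK: "to_ac x \<in> K" if x: "x \<in> F" for x
  proof -
    obtain y z where "y \<in> T" "z \<in> T" "x = y - z"
      using precone_diffs[OF T] x by blast
    moreover from this have "to_ac y \<in> K" "to_ac z \<in> K" using Q T_sub by blast+
    ultimately show ?thesis using subalg_diff[OF sub] by simp
  qed
  have "field_ordering F P"
    unfolding field_ordering_def
  proof (intro conjI ballI allI impI F)
    show "P \<subseteq> F" by (auto simp: P_def)
    show "x + y \<in> P" "x * y \<in> P" if "x \<in> P" "y \<in> P" for x y
      using that subalg_add[OF A] subalg_mult[OF A] T_add T_mult by (auto simp: P_def)
    show "x \<in> P \<or> - x \<in> P" if "x \<in> F" for x
      using that T_total[OF FK[OF that]] subalg_uminus[OF A] by (auto simp: P_def)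
    show "x = 0" if "x \<in> P \<and> - x \<in> P" for x
      using that T_antisym[of "to_ac x"] by (auto simp: P_def)
  qed
  then show ?thesis using that Q TF by (auto simp: P_def)
qed

text \<open>The generators are adjoined inside a real closed field in the algebraic closure, and the
  resulting homomorphism is pulled back along \<open>to_ac\<close>. As \<open>T\<close> already
  decides every sign in \<open>F\<close>, the larger ordering induces the same signs there.\<close>

theorem artin_lang:
  fixes F T :: "'a::real_field set"
  assumes ord: "field_ordering F T" and t: "pos_infinitesimal F T t" and G: "finite G" "G \<subseteq> F"
  shows "good T t (alg (insert t G))"
proof -
  interpret F: ordered_R_field F T by unfold_locales (rule ord)
  obtain K P where rc: "real_closed K P" and P: "to_ac ` T \<subseteq> P"
    using real_closure[OF precone_to_ac[OF field_ordering_precone[OF ord]]] by blast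
  interpret K: real_closed_field K P
    by unfold_locales (use rc in \<open>auto simp: real_closed_def\<close>)
  have FK: "to_ac x \<in> K" if "x \<in> F" for x
    using F.T_total[OF that] P K.T_sub[of "to_ac x"] K.T_sub[of "to_ac (- x)"]
      subalg_uminus[OF K.sub, of "to_ac (- x)"] by auto
  have P_iff: "to_ac x \<in> P \<longleftrightarrow> x \<in> T" if "x \<in> F" for x
  proof
    assume "to_ac x \<in> P"
    show "x \<in> T"
    proof (rule ccontr)
      assume "x \<notin> T"
      then have "to_ac (- x) \<in> P" using F.T_total[OF that] P by blast
      then have "to_ac x = 0" using K.T_antisym[OF \<open>to_ac x \<in> P\<close>] by simp
      then show False using \<open>x \<notin> T\<close> F.T_0 by simp
    qed
  qed (use P in blast)
  have sg: "sg P (to_ac x) = sg T x" if "x \<in> F" for x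
    using P_iff[OF that] by (simp add: sg_def)
  have lt: "lt P (to_ac x) (to_ac y) \<longleftrightarrow> lt T x y" if "x \<in> F" "y \<in> F" for x y
    using P_iff[OF subalg_diff[OF F.sub that(2,1)]] by (simp add: lt_def)
  have tF: "t \<in> F" using t by (simp add: pos_infinitesimal_def)
  have "pos_infinitesimal K P (to_ac t)"
    unfolding pos_infinitesimal_def
    using t FK[OF tF] lt[OF subalg_0[OF F.sub] tF] lt[OF tF subalg_of_real[OF F.sub]]
    by (simp add: pos_infinitesimal_def to_ac_of_real)
  from K.good_alg[OF this, of "to_ac ` G"] have good: "good P (to_ac t) (alg (to_ac ` insert t G))"
    using G FK by auto
  define B where "B = alg (to_ac ` insert t G)"
  have "subalg {x. to_ac x \<in> B}"
    using subalg_alg[of "to_ac ` insert t G"] unfolding subalg_def B_def[symmetric]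
    by (auto simp: to_ac_of_real)
  then have up: "alg (insert t G) \<subseteq> {x. to_ac x \<in> B}"
    by (rule alg_least) (use alg_superset[of "to_ac ` insert t G"] in \<open>auto simp: B_def\<close>)
  have AF: "alg (insert t G) \<subseteq> F" using tF G by (intro alg_least[OF F.sub]) auto
  show ?thesis
    unfolding good_def
  proof (intro allI impI)
    fix S assume S: "finite S \<and> S \<subseteq> alg (insert t G)"
    then have "finite (to_ac ` S) \<and> to_ac ` S \<subseteq> B" using up by auto
    then have "\<forall>\<^sub>F \<tau> in at_right 0. \<exists>\<phi>. alg_hom B \<phi> \<and> \<phi> (to_ac t) = \<tau> \<and> (\<forall>s\<in>to_ac ` S. sgn (\<phi> s) = sg P s)"
      using good unfolding good_def B_def by blast
    then show "\<forall>\<^sub>F \<tau> in at_right 0. \<exists>\<phi>. alg_hom (alg (insert t G)) \<phi> \<and> \<phi> t = \<tau> \<and> (\<forall>s\<in>S. sgn (\<phi> s) = sg T s)"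
    proof eventually_elim
      case (elim \<tau>)
      then obtain \<phi> where \<phi>: "alg_hom B \<phi>" "\<phi> (to_ac t) = \<tau>" "\<forall>s\<in>to_ac ` S. sgn (\<phi> s) = sg P s" by blast
      have "alg_hom (alg (insert t G)) (\<phi> \<circ> to_ac)"
        using \<phi>(1) up unfolding alg_hom_def by (auto simp: to_ac_of_real subset_iff)
      moreover have "sgn ((\<phi> \<circ> to_ac) s) = sg T s" if "s \<in> S" for s
        using \<phi>(3) that sg[of s] S AF by auto
      ultimately show ?case using \<phi>(2) by (intro exI[of _ "\<phi> \<circ> to_ac"]) auto
    qed
  qed
qed

section \<open>Central points\<close>

text \<open>This replaces smoothness of the point \<open>\<phi>\<close>.\<close>

definition central :: "'a::real_field set \<Rightarrow> ('a \<Rightarrow> real) \<Rightarrow> bool" where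
  "central A \<phi> \<longleftrightarrow> (\<forall>e\<in>A. e \<noteq> 0 \<longrightarrow> (\<exists>\<phi>s. (\<forall>\<^sub>F n in sequentially. alg_hom A (\<phi>s n) \<and> \<phi>s n e \<noteq> 0) \<and>
     (\<forall>a\<in>A. (\<lambda>n. \<phi>s n a) \<longlonglongrightarrow> \<phi> a)))"

text \<open>Approximating homomorphisms extend as soon as values \<open>r n\<close> for
  \<open>x\<close> are known that converge to \<open>\<phi> x\<close> and eventually satisfy all
  relations of \<open>x\<close> over \<open>A\<close>. Transcendental and algebraic generators
  differ in how \<open>r\<close> is found.\<close>

lemma approximations_adjoin:
  assumes A: "subalg A" and \<phi>: "alg_hom (adjoin A x) \<phi>"
    and \<phi>s: "\<forall>\<^sub>F n in sequentially. alg_hom A (\<phi>s n)" "\<And>a. a \<in> A \<Longrightarrow> (\<lambda>n. \<phi>s n a) \<longlonglongrightarrow> \<phi> a"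
    and r: "r \<longlonglongrightarrow> \<phi> x"
    and rel: "\<forall>\<^sub>F n in sequentially. \<forall>p. coeffs_in A p \<and> poly p x = 0 \<longrightarrow> poly (map_poly (\<phi>s n) p) (r n) = 0"
  obtains \<psi>s where "\<forall>\<^sub>F n in sequentially. alg_hom (adjoin A x) (\<psi>s n) \<and>
      (\<forall>p. coeffs_in A p \<longrightarrow> \<psi>s n (poly p x) = poly (map_poly (\<phi>s n) p) (r n))"
    "\<And>b. b \<in> adjoin A x \<Longrightarrow> (\<lambda>n. \<psi>s n b) \<longlonglongrightarrow> \<phi> b"
proof -
  define P where "P n \<psi> \<longleftrightarrow> alg_hom (adjoin A x) \<psi> \<and>
    (\<forall>p. coeffs_in A p \<longrightarrow> \<psi> (poly p x) = poly (map_poly (\<phi>s n) p) (r n))" for n \<psi>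
  define \<psi>s where "\<psi>s n = (SOME \<psi>. P n \<psi>)" for n
  have ev: "\<forall>\<^sub>F n in sequentially. P n (\<psi>s n)"
    using \<phi>s(1) rel
  proof eventually_elim
    case (elim n)
    have "\<exists>\<psi>. P n \<psi>"
      by (rule alg_hom_adjoin[OF A elim(1), of x "r n"]) (use elim(2) in \<open>auto simp: P_def\<close>)
    then show ?case unfolding \<psi>s_def by (rule someI_ex)
  qed
  have lim: "(\<lambda>n. \<psi>s n b) \<longlonglongrightarrow> \<phi> b" if b: "b \<in> adjoin A x" for b
  proof -
    obtain p where p: "coeffs_in A p" "b = poly p x" using b unfolding adjoin_def by blast
    have "\<forall>\<^sub>F n in sequentially. (\<Sum>i\<le>degree p. \<phi>s n (coeff p i) * r n ^ i) = \<psi>s n b"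
      using ev \<phi>s(1)
    proof eventually_elim
      case (elim n)
      then show ?case using p alg_hom_0[of A "\<phi>s n"] unfolding P_def by (simp add: poly_map_poly_eq_sum)
    qed
    moreover have "(\<lambda>n. \<Sum>i\<le>degree p. \<phi>s n (coeff p i) * r n ^ i) \<longlonglongrightarrow> (\<Sum>i\<le>degree p. \<phi> (coeff p i) * \<phi> x ^ i)"
      by (intro tendsto_intros \<phi>s(2) r) (use p(1) in \<open>auto simp: coeffs_in_def\<close>)
    moreover have "(\<Sum>i\<le>degree p. \<phi> (coeff p i) * \<phi> x ^ i) = \<phi> b"
      using alg_hom_poly[OF adjoin_subalg[OF A] \<phi> coeffs_in_mono[OF adjoin_superset[OF A] p(1)] adjoin_generator[OF A]]
      by (simp add: p(2) poly_map_poly_eq_sum alg_hom_0[OF \<phi>])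
    ultimately show ?thesis using Lim_transform_eventually by fastforce
  qed
  show ?thesis using that[of \<psi>s] ev lim unfolding P_def by blast
qed

text \<open>At a simple root the polynomial changes sign, and strict signs at two fixed points
  persist under pointwise convergence. Taking the root nearest to \<open>r\<close> gives one
  sequence for all neighbourhoods; \<open>nz\<close> makes the set of roots finite, so that a
  nearest one exists.\<close>

lemma simple_root_persists:
  fixes P :: "real poly" and Ps :: "nat \<Rightarrow> real poly"
  assumes root: "poly P r = 0" "poly (pderiv P) r \<noteq> 0"
    and lim: "\<And>s. (\<lambda>n. poly (Ps n) s) \<longlonglongrightarrow> poly P s" and nz: "\<forall>\<^sub>F n in sequentially. Ps n \<noteq> 0"
  obtains rs where "rs \<longlonglongrightarrow> r" "\<forall>\<^sub>F n in sequentially. poly (Ps n) (rs n) = 0"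
proof -
  have near_pos: "\<forall>\<^sub>F n in sequentially. \<exists>s. \<bar>s - r\<bar> < \<epsilon> \<and> poly (Qs n) s = 0"
    if Q: "poly Q r = 0" "poly (pderiv Q) r > 0" and limQ: "\<And>s. (\<lambda>n. poly (Qs n) s) \<longlonglongrightarrow> poly Q s"
      and \<epsilon>: "\<epsilon> > 0" for \<epsilon> and Q and Qs :: "nat \<Rightarrow> real poly"
  proof -
    have D: "(poly Q has_real_derivative poly (pderiv Q) r) (at r)" by (rule poly_DERIV)
    obtain d1 where d1: "d1 > 0" "\<And>h. h > 0 \<Longrightarrow> h < d1 \<Longrightarrow> poly Q r < poly Q (r + h)"
      using DERIV_pos_inc_right[OF D Q(2)] by blast
    obtain d2 where d2: "d2 > 0" "\<And>h. h > 0 \<Longrightarrow> h < d2 \<Longrightarrow> poly Q (r - h) < poly Q r"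
      using DERIV_pos_inc_left[OF D Q(2)] by blast
    define h where "h = Min {d1, d2, \<epsilon>} / 2"
    have h: "h > 0" "h < d1" "h < d2" "h < \<epsilon>" using d1(1) d2(1) \<epsilon> by (auto simp: h_def)
    have "poly Q (r + h) > 0" "poly Q (r - h) < 0" using d1(2) d2(2) h Q(1) by force+
    then have "\<forall>\<^sub>F n in sequentially. poly (Qs n) (r + h) > 0" "\<forall>\<^sub>F n in sequentially. poly (Qs n) (r - h) < 0"
      using order_tendstoD(1)[OF limQ, of 0 "r + h"] order_tendstoD(2)[OF limQ, of "r - h" 0] by simp_all
    then show ?thesis
    proof eventually_elim
      case (elim n)
      obtain s where "r - h < s" "s < r + h" "poly (Qs n) s = 0"
        using poly_IVT_pos[of "r - h" "r + h" "Qs n"] elim h(1) by auto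
      then show ?case using h(4) by (intro exI[of _ s]) auto
    qed
  qed
  have near: "\<forall>\<^sub>F n in sequentially. \<exists>s. \<bar>s - r\<bar> < \<epsilon> \<and> poly (Ps n) s = 0" if "\<epsilon> > 0" for \<epsilon>
  proof (cases "poly (pderiv P) r > 0")
    case True
    then show ?thesis using near_pos[OF root(1) True lim that] by blast
  next
    case False
    then have "poly (pderiv (- P)) r > 0" using root(2) by (simp add: pderiv_minus)
    moreover have "(\<lambda>n. poly (- Ps n) s) \<longlonglongrightarrow> poly (- P) s" for s
      using tendsto_minus[OF lim] by simp
    ultimately have "\<forall>\<^sub>F n in sequentially. \<exists>s. \<bar>s - r\<bar> < \<epsilon> \<and> poly (- Ps n) s = 0"
      using near_pos[of "- P" "\<lambda>n. - Ps n"] root(1) that by simp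
    then show ?thesis by simp
  qed
  define Z where "Z n = {s. poly (Ps n) s = 0}" for n
  define rs where "rs n = arg_min_on (\<lambda>s. \<bar>s - r\<bar>) (Z n)" for n
  have fin: "finite (Z n)" if "Ps n \<noteq> 0" for n unfolding Z_def using poly_roots_finite that by blast
  have "\<forall>\<^sub>F n in sequentially. poly (Ps n) (rs n) = 0"
    using near[of 1, OF zero_less_one] nz
  proof eventually_elim
    case (elim n)
    then have "rs n \<in> Z n" unfolding rs_def by (intro arg_min_if_finite(1) fin) (auto simp: Z_def)
    then show ?case by (simp add: Z_def)
  qed
  moreover have "rs \<longlonglongrightarrow> r"
  proof (rule tendstoI)
    fix \<epsilon> :: real assume "\<epsilon> > 0"
    from near[OF this] nz show "\<forall>\<^sub>F n in sequentially. dist (rs n) r < \<epsilon>"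
    proof eventually_elim
      case (elim n)
      then obtain s where s: "\<bar>s - r\<bar> < \<epsilon>" "s \<in> Z n" by (auto simp: Z_def)
      have "\<bar>rs n - r\<bar> \<le> \<bar>s - r\<bar>"
        unfolding rs_def by (rule arg_min_least[OF fin _ s(2)]) (use elim s in auto)
      then show ?case using s(1) by (simp add: dist_real_def)
    qed
  qed
  ultimately show ?thesis using that by blast
qed

text \<open>The value of \<open>x\<close> is free here. It is moved by less than
  \<open>1 / (n + 1)\<close> to avoid the finitely many roots of the mapped polynomial representing
  \<open>e\<close>, which is nonzero because its leading coefficient survives.\<close>

lemma central_adjoin_transcendental:
  assumes A: "subalg A" and trans: "\<And>p. coeffs_in A p \<Longrightarrow> poly p x = 0 \<Longrightarrow> p = 0"
    and \<phi>: "alg_hom (adjoin A x) \<phi>" "central A \<phi>"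
  shows "central (adjoin A x) \<phi>"
  unfolding central_def
proof (intro ballI impI)
  fix e assume e: "e \<in> adjoin A x" "e \<noteq> 0"
  obtain g where g: "coeffs_in A g" "e = poly g x" using e(1) unfolding adjoin_def by blast
  then have "g \<noteq> 0" using e(2) by auto
  then have c: "lead_coeff g \<in> A" "lead_coeff g \<noteq> 0" using g(1) coeffs_in_lead_coeff by auto
  then obtain \<phi>s where \<phi>s: "\<forall>\<^sub>F n in sequentially. alg_hom A (\<phi>s n) \<and> \<phi>s n (lead_coeff g) \<noteq> 0"
    "\<And>a. a \<in> A \<Longrightarrow> (\<lambda>n. \<phi>s n a) \<longlonglongrightarrow> \<phi> a"
    using \<phi>(2) unfolding central_def by meson
  have "\<exists>s. \<bar>s - \<phi> x\<bar> < inverse (real (Suc n)) \<and> (map_poly (\<phi>s n) g \<noteq> 0 \<longrightarrow> poly (map_poly (\<phi>s n) g) s \<noteq> 0)" for n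
  proof (rule ccontr)
    define \<epsilon> where "\<epsilon> = inverse (real (Suc n))"
    assume none: "\<not> ?thesis"
    moreover have "\<bar>\<phi> x - \<phi> x\<bar> < inverse (real (Suc n))" by simp
    ultimately have nz: "map_poly (\<phi>s n) g \<noteq> 0" by blast
    have "{\<phi> x - \<epsilon> <..< \<phi> x + \<epsilon>} \<subseteq> {s. poly (map_poly (\<phi>s n) g) s = 0}"
      using none by (auto simp: \<epsilon>_def abs_less_iff)
    moreover have "infinite {\<phi> x - \<epsilon> <..< \<phi> x + \<epsilon>}" by (rule infinite_Ioo) (simp add: \<epsilon>_def)
    ultimately show False using poly_roots_finite[OF nz] finite_subset by blast
  qed
  then obtain r where r: "\<And>n. \<bar>r n - \<phi> x\<bar> < inverse (real (Suc n))"
    "\<And>n. map_poly (\<phi>s n) g \<noteq> 0 \<Longrightarrow> poly (map_poly (\<phi>s n) g) (r n) \<noteq> 0" by metis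
  have "(\<lambda>n. r n - \<phi> x) \<longlonglongrightarrow> 0"
    by (rule Lim_null_comparison[OF _ LIMSEQ_inverse_real_of_nat]) (use r(1) in \<open>auto intro!: always_eventually less_imp_le\<close>)
  then have lim: "r \<longlonglongrightarrow> \<phi> x" by (rule LIM_zero_cancel)
  have hom: "\<forall>\<^sub>F n in sequentially. alg_hom A (\<phi>s n)" using \<phi>s(1) by eventually_elim blast
  have rel: "\<forall>\<^sub>F n in sequentially. \<forall>p. coeffs_in A p \<and> poly p x = 0 \<longrightarrow> poly (map_poly (\<phi>s n) p) (r n) = 0"
    using trans by (intro always_eventually) fastforce
  obtain \<psi>s where \<psi>s: "\<forall>\<^sub>F n in sequentially. alg_hom (adjoin A x) (\<psi>s n) \<and>
      (\<forall>p. coeffs_in A p \<longrightarrow> \<psi>s n (poly p x) = poly (map_poly (\<phi>s n) p) (r n))"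
    "\<And>b. b \<in> adjoin A x \<Longrightarrow> (\<lambda>n. \<psi>s n b) \<longlonglongrightarrow> \<phi> b"
    using approximations_adjoin[OF A \<phi>(1) hom \<phi>s(2) lim rel] by blast
  have "\<forall>\<^sub>F n in sequentially. alg_hom (adjoin A x) (\<psi>s n) \<and> \<psi>s n e \<noteq> 0"
    using \<psi>s(1) \<phi>s(1)
  proof eventually_elim
    case (elim n)
    then have "coeff (map_poly (\<phi>s n) g) (degree g) \<noteq> 0" using alg_hom_0[of A "\<phi>s n"] by (simp add: coeff_map_poly)
    then have "map_poly (\<phi>s n) g \<noteq> 0" by auto
    then show ?case using elim(1) r(2) g by simp
  qed
  then show "\<exists>\<phi>s. (\<forall>\<^sub>F n in sequentially. alg_hom (adjoin A x) (\<phi>s n) \<and> \<phi>s n e \<noteq> 0) \<and>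
     (\<forall>a\<in>adjoin A x. (\<lambda>n. \<phi>s n a) \<longlonglongrightarrow> \<phi> a)"
    using \<psi>s(2) by blast
qed

text \<open>Nonvanishing of \<open>e\<close> is pushed down to a multiple \<open>e * w\<close> in
  \<open>A\<close>, and approximations over \<open>A\<close> are lifted back by following the simple
  root \<open>\<phi> x\<close> of the mapped minimal polynomial. The leading coefficient
  \<open>c\<close> is kept nonzero as well, so that pseudo-division by \<open>m\<close> shows that
  the new value satisfies every relation of \<open>x\<close>.\<close>

lemma central_adjoin_algebraic:
  assumes A: "subalg A" and m: "coeffs_in A m" "m \<noteq> 0" "poly m x = 0"
    and min: "\<And>p. coeffs_in A p \<Longrightarrow> p \<noteq> 0 \<Longrightarrow> poly p x = 0 \<Longrightarrow> degree m \<le> degree p"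
    and \<phi>: "alg_hom (adjoin A x) \<phi>" "central A \<phi>" "\<phi> (poly (pderiv m) x) \<noteq> 0"
  shows "central (adjoin A x) \<phi>"
  unfolding central_def
proof (intro ballI impI)
  note B = adjoin_subalg[OF A, of x] and AB = adjoin_superset[OF A, of x]
  fix e assume e: "e \<in> adjoin A x" "e \<noteq> 0"
  obtain w where w: "w \<in> adjoin A x" "e * w \<in> A" "e * w \<noteq> 0"
    using algebraic_multiple_in_base[OF A m min e] by blast
  define c where "c = lead_coeff m"
  have c: "c \<in> A" "c \<noteq> 0" using m coeffs_in_lead_coeff by (auto simp: c_def)
  have "c * (e * w) \<in> A" "c * (e * w) \<noteq> 0" using c w subalg_mult[OF A] by auto
  then obtain \<phi>s where \<phi>s: "\<forall>\<^sub>F n in sequentially. alg_hom A (\<phi>s n) \<and> \<phi>s n (c * (e * w)) \<noteq> 0"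
    "\<And>a. a \<in> A \<Longrightarrow> (\<lambda>n. \<phi>s n a) \<longlonglongrightarrow> \<phi> a"
    using \<phi>(2) unfolding central_def by meson
  have hom: "\<forall>\<^sub>F n in sequentially. alg_hom A (\<phi>s n) \<and> \<phi>s n c \<noteq> 0 \<and> \<phi>s n (e * w) \<noteq> 0"
    using \<phi>s(1)
  proof eventually_elim
    case (elim n)
    then show ?case using alg_hom_mult[of A "\<phi>s n" c "e * w"] c w by auto
  qed
  have lim: "(\<lambda>n. poly (map_poly (\<phi>s n) m) s) \<longlonglongrightarrow> poly (map_poly \<phi> m) s" for s
  proof -
    have "(\<lambda>n. \<Sum>i\<le>degree m. \<phi>s n (coeff m i) * s ^ i) \<longlonglongrightarrow> (\<Sum>i\<le>degree m. \<phi> (coeff m i) * s ^ i)"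
      by (intro tendsto_intros \<phi>s(2)) (use m(1) in \<open>auto simp: coeffs_in_def\<close>)
    moreover have "\<forall>\<^sub>F n in sequentially. (\<Sum>i\<le>degree m. \<phi>s n (coeff m i) * s ^ i) = poly (map_poly (\<phi>s n) m) s"
      using hom
    proof eventually_elim
      case (elim n)
      then show ?case using alg_hom_0[of A "\<phi>s n"] by (simp add: poly_map_poly_eq_sum)
    qed
    ultimately show ?thesis
      using Lim_transform_eventually by (fastforce simp: poly_map_poly_eq_sum alg_hom_0[OF \<phi>(1)])
  qed
  note mB = coeffs_in_mono[OF AB m(1)]
  have root: "poly (map_poly \<phi> m) (\<phi> x) = 0"
    using alg_hom_poly[OF B \<phi>(1) mB adjoin_generator[OF A]] m(3) alg_hom_0[OF \<phi>(1)] by simp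
  have simple: "poly (pderiv (map_poly \<phi> m)) (\<phi> x) \<noteq> 0"
    using alg_hom_poly[OF B \<phi>(1) coeffs_in_pderiv[OF B mB] adjoin_generator[OF A]] \<phi>(3)
    by (simp add: alg_hom_map_poly_pderiv[OF B \<phi>(1) mB])
  have nz: "\<forall>\<^sub>F n in sequentially. map_poly (\<phi>s n) m \<noteq> 0"
    using hom
  proof eventually_elim
    case (elim n)
    then have "coeff (map_poly (\<phi>s n) m) (degree m) \<noteq> 0"
      using alg_hom_0[of A "\<phi>s n"] by (simp add: coeff_map_poly c_def)
    then show ?case by auto
  qed
  obtain r where r: "r \<longlonglongrightarrow> \<phi> x" "\<forall>\<^sub>F n in sequentially. poly (map_poly (\<phi>s n) m) (r n) = 0"
    using simple_root_persists[OF root simple lim nz] by blast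
  have hom': "\<forall>\<^sub>F n in sequentially. alg_hom A (\<phi>s n)" using hom by eventually_elim blast
  have rel: "\<forall>\<^sub>F n in sequentially. \<forall>p. coeffs_in A p \<and> poly p x = 0 \<longrightarrow> poly (map_poly (\<phi>s n) p) (r n) = 0"
    using hom r(2)
  proof eventually_elim
    case (elim n)
    then have h: "alg_hom A (\<phi>s n)" by blast
    show ?case
    proof (intro allI impI, elim conjE)
      fix p assume p: "coeffs_in A p" "poly p x = 0"
      obtain k q t where t: "coeffs_in A q" "coeffs_in A t" "smult (c ^ k) p = m * q + t" "t = 0 \<or> degree t < degree m"
        using pseudo_division[OF A m(1,2) p(1)] unfolding c_def by blast
      have "poly (smult (c ^ k) p) x = poly (m * q + t) x" using t(3) by simp
      then have "poly t x = 0" using m(3) p(2) by simp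
      then have "t = 0" using min[OF t(2)] t(4) by force
      then have "map_poly (\<phi>s n) (smult (c ^ k) p) = map_poly (\<phi>s n) (m * q)" using t(3) by simp
      then have "smult (\<phi>s n c ^ k) (map_poly (\<phi>s n) p) = map_poly (\<phi>s n) m * map_poly (\<phi>s n) q"
        using alg_hom_map_poly_smult[OF A h p(1) subalg_power[OF A c(1)], of k]
          alg_hom_map_poly_mult[OF A h m(1) t(1)] alg_hom_power[OF A h c(1), of k] by simp
      then have "\<phi>s n c ^ k * poly (map_poly (\<phi>s n) p) (r n) = 0"
        using elim(2) by (metis mult_zero_left poly_mult poly_smult)
      then show "poly (map_poly (\<phi>s n) p) (r n) = 0" using elim(1) by simp
    qed
  qed
  obtain \<psi>s where \<psi>s: "\<forall>\<^sub>F n in sequentially. alg_hom (adjoin A x) (\<psi>s n) \<and>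
      (\<forall>p. coeffs_in A p \<longrightarrow> \<psi>s n (poly p x) = poly (map_poly (\<phi>s n) p) (r n))"
    "\<And>b. b \<in> adjoin A x \<Longrightarrow> (\<lambda>n. \<psi>s n b) \<longlonglongrightarrow> \<phi> b"
    using approximations_adjoin[OF A \<phi>(1) hom' \<phi>s(2) r(1) rel] by blast
  have "\<forall>\<^sub>F n in sequentially. alg_hom (adjoin A x) (\<psi>s n) \<and> \<psi>s n e \<noteq> 0"
    using \<psi>s(1) hom
  proof eventually_elim
    case (elim n)
    have "\<psi>s n (e * w) = \<phi>s n (e * w)"
      using elim w(2) coeffs_in_simps[OF A] map_poly_pCons_hom[of A "\<phi>s n"]
      by (metis (no_types, lifting) map_poly_0 mult_zero_right add.right_neutral poly_0 poly_pCons)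
    then have "\<psi>s n (e * w) \<noteq> 0" using elim by simp
    then show ?case using elim(1) alg_hom_mult[OF _ e(1) w(1), of "\<psi>s n"] by auto
  qed
  then show "\<exists>\<phi>s. (\<forall>\<^sub>F n in sequentially. alg_hom (adjoin A x) (\<phi>s n) \<and> \<phi>s n e \<noteq> 0) \<and>
     (\<forall>a\<in>adjoin A x. (\<lambda>n. \<phi>s n a) \<longlonglongrightarrow> \<phi> a)"
    using \<psi>s(2) by blast
qed

text \<open>An algebraic generator contributes the factor \<open>poly (pderiv m) x\<close>, whose
  nonvanishing says that its value is a simple root; a transcendental one contributes none. The
  product \<open>e\<close> thus acts like a discriminant.\<close>

lemma generic_homs_central:
  "finite G \<Longrightarrow> \<exists>e\<in>alg G. e \<noteq> 0 \<and> (\<forall>\<phi>. alg_hom (alg G) \<phi> \<and> \<phi> e \<noteq> 0 \<longrightarrow> central (alg G) \<phi>)"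
proof (induction G rule: finite_induct)
  case empty
  have "central (alg {}) \<phi>" if \<phi>: "alg_hom (alg {}) \<phi>" for \<phi> :: "'a \<Rightarrow> real"
    unfolding central_def
  proof (intro ballI impI)
    fix e :: 'a assume "e \<in> alg {}" "e \<noteq> 0"
    then have "\<phi> e \<noteq> 0" using alg_hom_of_real[OF \<phi>] by (auto simp: alg_empty)
    then show "\<exists>\<phi>s. (\<forall>\<^sub>F n in sequentially. alg_hom (alg {}) (\<phi>s n) \<and> \<phi>s n e \<noteq> 0) \<and> (\<forall>a\<in>alg {}. (\<lambda>n. \<phi>s n a) \<longlonglongrightarrow> \<phi> a)"
      using \<phi> by (intro exI[of _ "\<lambda>_. \<phi>"]) auto
  qed
  then show ?case using subalg_1[OF subalg_alg, of "{}"] by (intro bexI[of _ 1]) auto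
next
  case (insert x G)
  define A where "A = alg G"
  have A: "subalg A" unfolding A_def by (rule subalg_alg)
  have AB: "alg_hom (adjoin A x) \<phi> \<Longrightarrow> alg_hom A \<phi>" for \<phi> :: "'a \<Rightarrow> real"
    using alg_hom_mono adjoin_superset[OF A] by blast
  obtain e where e: "e \<in> A" "e \<noteq> 0" "\<And>\<phi>. alg_hom A \<phi> \<Longrightarrow> \<phi> e \<noteq> 0 \<Longrightarrow> central A \<phi>"
    using insert.IH unfolding A_def by blast
  have eB: "e \<in> adjoin A x" using e(1) adjoin_superset[OF A] by blast
  have "\<exists>e'\<in>adjoin A x. e' \<noteq> 0 \<and> (\<forall>\<phi>. alg_hom (adjoin A x) \<phi> \<and> \<phi> e' \<noteq> 0 \<longrightarrow> central (adjoin A x) \<phi>)"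
  proof (cases "\<exists>p. coeffs_in A p \<and> p \<noteq> 0 \<and> poly p x = 0")
    case False
    then show ?thesis using central_adjoin_transcendental[OF A] AB e eB by metis
  next
    case True
    then obtain m where m: "coeffs_in A m" "m \<noteq> 0" "poly m x = 0"
      and min: "\<And>q. coeffs_in A q \<Longrightarrow> q \<noteq> 0 \<Longrightarrow> poly q x = 0 \<Longrightarrow> degree m \<le> degree q"
      using min_poly_exists by metis
    have "degree m \<noteq> 0"
    proof
      assume "degree m = 0"
      then obtain a where "m = [:a:]" by (rule degree_eq_zeroE)
      then show False using m by auto
    qed
    then have "pderiv m \<noteq> 0" "degree (pderiv m) < degree m" by (auto simp: pderiv_eq_0_iff degree_pderiv)
    then have d0: "poly (pderiv m) x \<noteq> 0" using min[OF coeffs_in_pderiv[OF A m(1)]] by force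
    have dB: "poly (pderiv m) x \<in> adjoin A x" unfolding adjoin_def using coeffs_in_pderiv[OF A m(1)] by blast
    show ?thesis
    proof (intro bexI[of _ "e * poly (pderiv m) x"] conjI allI impI)
      show "e * poly (pderiv m) x \<in> adjoin A x" by (rule subalg_mult[OF adjoin_subalg[OF A] eB dB])
      show "e * poly (pderiv m) x \<noteq> 0" using e(2) d0 by simp
      fix \<phi> assume \<phi>: "alg_hom (adjoin A x) \<phi> \<and> \<phi> (e * poly (pderiv m) x) \<noteq> 0"
      then have "\<phi> e \<noteq> 0" "\<phi> (poly (pderiv m) x) \<noteq> 0" using alg_hom_mult[OF conjunct1[OF \<phi>] eB dB] by auto
      then show "central (adjoin A x) \<phi>"
        using central_adjoin_algebraic[OF A m min] e(3) AB \<phi> by blast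
    qed
  qed
  then show ?case by (simp add: A_def alg_insert)
qed

section \<open>Orderings and real places\<close>

text \<open>Finite systems of conditions are directed, so closure under sums and products follows by
  uniting two systems; satisfiability keeps -1 out, and any ordering above the precone will do. The
  sets \<open>S\<close> appear because a point has values on a subalgebra only, so even
  \<open>x * x\<close> is known to be nonnegative only where \<open>x\<close> is defined.\<close>

lemma ordering_compactness:
  fixes F N :: "'a::real_field set"
  assumes F: "is_R_subfield F" and N: "N \<subseteq> F"
    and sat: "\<And>N' S. finite N' \<Longrightarrow> N' \<subseteq> N \<Longrightarrow> finite S \<Longrightarrow> S \<subseteq> F \<Longrightarrow>
      \<exists>A \<phi>. subalg A \<and> S \<subseteq> A \<and> alg_hom A \<phi> \<and> (\<forall>n\<in>N'. \<phi> n > 0)"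
  obtains T where "field_ordering F T" "\<And>n. n \<in> N \<Longrightarrow> lt T 0 n"
proof -
  note K = subalg_R_subfield[OF F]
  define adm where "adm A \<phi> N' S \<longleftrightarrow> subalg A \<and> S \<subseteq> A \<and> alg_hom A \<phi> \<and> (\<forall>n\<in>N'. \<phi> n > 0)"
    for A :: "'a set" and \<phi> N' S
  have adm_mono: "adm A \<phi> N' S" if "adm A \<phi> N'' S''" "N' \<subseteq> N''" "S \<subseteq> S''" for A \<phi> N' S N'' S''
    using that unfolding adm_def by auto
  define ok where "ok z N' S \<longleftrightarrow> finite N' \<and> N' \<subseteq> N \<and> finite S \<and> S \<subseteq> F \<and>
    (\<forall>A \<phi>. adm A \<phi> N' S \<longrightarrow> z \<in> A \<and> \<phi> z \<ge> 0)" for z N' S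
  \<comment> \<open>\<open>T\<close> consists of the elements that are eventually nonnegative at the given points.\<close>
  define T where "T = {z \<in> F. \<exists>N' S. ok z N' S}"
  have "precone F T"
    unfolding precone_def
  proof (intro conjI ballI F)
    show "T \<subseteq> F" by (auto simp: T_def)
    show "x * x \<in> T" if x: "x \<in> F" for x
    proof -
      have "ok (x * x) {} {x}"
        unfolding ok_def using x by (auto simp: adm_def subalg_mult alg_hom_mult)
      then show ?thesis using x subalg_mult[OF K] by (auto simp: T_def)
    qed
    show "- 1 \<notin> T"
    proof
      assume "- 1 \<in> T"
      then obtain N' S where ok: "ok (- 1) N' S" by (auto simp: T_def)
      then obtain A \<phi> where A: "adm A \<phi> N' S" using sat[of N' S] unfolding ok_def adm_def by meson
      have "\<phi> (of_real (- 1)) = - 1" using A alg_hom_of_real[of A \<phi> "- 1"] by (simp only: adm_def)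
      then show False using ok A unfolding ok_def by fastforce
    qed
    fix x y assume "x \<in> T" "y \<in> T"
    then obtain N1 S1 N2 S2 where ok: "ok x N1 S1" "ok y N2 S2" and F': "x \<in> F" "y \<in> F"
      by (auto simp: T_def)
    have "(x + y \<in> A \<and> \<phi> (x + y) \<ge> 0) \<and> (x * y \<in> A \<and> \<phi> (x * y) \<ge> 0)"
      if A: "adm A \<phi> (N1 \<union> N2) (S1 \<union> S2)" for A \<phi>
    proof -
      have "adm A \<phi> N1 S1" "adm A \<phi> N2 S2" by (rule adm_mono[OF A]; blast)+
      then have xy: "x \<in> A" "\<phi> x \<ge> 0" "y \<in> A" "\<phi> y \<ge> 0" using ok unfolding ok_def by blast+
      have "subalg A" "alg_hom A \<phi>" using A by (simp_all add: adm_def)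
      then show ?thesis
        using xy alg_hom_add[of A \<phi> x y] alg_hom_mult[of A \<phi> x y] by (simp add: subalg_add subalg_mult)
    qed
    then have "ok (x + y) (N1 \<union> N2) (S1 \<union> S2)" "ok (x * y) (N1 \<union> N2) (S1 \<union> S2)"
      using ok unfolding ok_def by simp_all
    then show "x + y \<in> T" "x * y \<in> T"
      using F' subalg_add[OF K] subalg_mult[OF K] by (auto simp: T_def)
  qed
  then obtain P where P: "field_ordering F P" "T \<subseteq> P" by (rule precone_ordering)
  have "lt P 0 n" if n: "n \<in> N" for n
  proof -
    have "ok n {n} {n}" unfolding ok_def using n N by (auto simp: adm_def less_imp_le)
    then have "n \<in> P" using n N P(2) by (auto simp: T_def)
    \<comment> \<open>The precone yields only nonnegativity; strictness comes from 0 being positive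
      at no point.\<close>
    moreover have "n \<noteq> 0"
    proof
      assume "n = 0"
      then show False using sat[of "{n}" "{}"] n alg_hom_0 by force
    qed
    ultimately show ?thesis by (simp add: lt_def)
  qed
  then show ?thesis using that P(1) by blast
qed

section \<open>The real place of an ordering\<close>

definition infinitely_near :: "'a::real_field set \<Rightarrow> 'a \<Rightarrow> real \<Rightarrow> bool" where
  "infinitely_near T x r \<longleftrightarrow>
     (\<forall>\<epsilon>>0. lt T 0 (of_real \<epsilon> - (x - of_real r)) \<and> lt T 0 (of_real \<epsilon> + (x - of_real r)))"

text \<open>The canonical place of an ordering: the standard part of a finite element, infinity for
  an infinitely large one.\<close>

definition place_of :: "'a::real_field set \<Rightarrow> 'a set \<Rightarrow> 'a place" where
  "place_of K T x = (if x \<in> K \<and> (\<exists>r. infinitely_near T x r) then Some (SOME r. infinitely_near T x r) else None)"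

context ordered_R_field
begin

lemma infinitely_near_unique:
  assumes "infinitely_near T x r" "infinitely_near T x s" shows "r = s"
proof -
  have le: "r' \<le> s'" if "infinitely_near T x r'" "infinitely_near T x s'" for r' s'
  proof (rule ccontr)
    assume "\<not> ?thesis"
    then have \<epsilon>: "(r' - s') / 2 > 0" by simp
    then have "0 \<lless> of_real ((r' - s') / 2) + (x - of_real r')" "0 \<lless> of_real ((r' - s') / 2) - (x - of_real s')"
      using that unfolding infinitely_near_def by blast+
    from pos_add[OF this] have "0 \<lless> of_real ((r' - s') / 2 + (r' - s') / 2 - r' + s')"
      by (simp add: algebra_simps)
    then show False by (simp only: pos_of_real) simp
  qed
  show ?thesis using le[OF assms] le[OF assms(2,1)] by simp
qed

lemma place_of_eq_Some: "place_of K T x = Some r \<longleftrightarrow> x \<in> K \<and> infinitely_near T x r"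
  unfolding place_of_def using infinitely_near_unique
  by (auto intro: someI2 simp: some_equality)

lemma place_of_eq_None: "place_of K T x = None \<longleftrightarrow> x \<notin> K \<or> (\<forall>r. \<not> infinitely_near T x r)"
  unfolding place_of_def by auto

lemma infinitely_near_of_real: "infinitely_near T (of_real r) r"
  unfolding infinitely_near_def by (simp add: pos_of_real)

lemma infinitely_near_add:
  assumes "infinitely_near T x r" "infinitely_near T y s" shows "infinitely_near T (x + y) (r + s)"
  unfolding infinitely_near_def
proof (intro allI impI)
  fix \<epsilon> :: real assume "\<epsilon> > 0"
  then have "\<epsilon> / 2 > 0" by simp
  then have *: "0 \<lless> of_real (\<epsilon> / 2) - (x - of_real r)" "0 \<lless> of_real (\<epsilon> / 2) + (x - of_real r)"
    "0 \<lless> of_real (\<epsilon> / 2) - (y - of_real s)" "0 \<lless> of_real (\<epsilon> / 2) + (y - of_real s)"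
    using assms unfolding infinitely_near_def by blast+
  have h: "of_real (\<epsilon> / 2) + of_real (\<epsilon> / 2) = (of_real \<epsilon> :: 'a)" unfolding of_real_add[symmetric] by simp
  have eq: "of_real \<epsilon> - (x + y - of_real (r + s)) =
      (of_real (\<epsilon> / 2) - (x - of_real r)) + (of_real (\<epsilon> / 2) - (y - of_real s))"
    "of_real \<epsilon> + (x + y - of_real (r + s)) =
      (of_real (\<epsilon> / 2) + (x - of_real r)) + (of_real (\<epsilon> / 2) + (y - of_real s))"
    unfolding h[symmetric] of_real_add by (simp_all only: algebra_simps)
  show "0 \<lless> of_real \<epsilon> - (x + y - of_real (r + s)) \<and> 0 \<lless> of_real \<epsilon> + (x + y - of_real (r + s))"
    unfolding eq by (intro conjI pos_add *)
qed

lemma infinitely_near_zero_iff: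
  "infinitely_near T x r \<longleftrightarrow> infinitely_near T (x - of_real r) 0"
  unfolding infinitely_near_def by simp

lemma infinitesimal_mult_bounded:
  assumes x: "infinitely_near T x 0" and C: "C > 0" "0 \<lless> of_real C - b" "0 \<lless> of_real C + b"
  shows "infinitely_near T (x * b) 0"
  unfolding infinitely_near_def
proof (intro allI impI)
  fix \<epsilon> :: real assume \<epsilon>: "\<epsilon> > 0"
  define \<eta> where "\<eta> = \<epsilon> / C"
  have "\<eta> > 0" using \<epsilon> C by (simp add: \<eta>_def)
  then have *: "0 \<lless> of_real \<eta> - x" "0 \<lless> of_real \<eta> + x"
    using x unfolding infinitely_near_def by auto
  have half: "0 \<lless> of_real (1 / 2)" unfolding pos_of_real by simp
  have \<epsilon>': "of_real \<epsilon> = of_real \<eta> * (of_real C :: 'a)"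
    unfolding of_real_mult[symmetric] using C(1) by (simp add: \<eta>_def)
  \<comment> \<open>Each side is the mean of two products of positive factors, paired so that the
    terms linear in \<open>x\<close> or \<open>b\<close> alone cancel.\<close>
  have eq: "of_real \<epsilon> - (x * b - of_real 0) = of_real (1 / 2) * ((of_real \<eta> - x) * (of_real C + b) + (of_real \<eta> + x) * (of_real C - b))"
    "of_real \<epsilon> + (x * b - of_real 0) = of_real (1 / 2) * ((of_real \<eta> - x) * (of_real C - b) + (of_real \<eta> + x) * (of_real C + b))"
    unfolding \<epsilon>' by (simp_all add: algebra_simps)
  show "0 \<lless> of_real \<epsilon> - (x * b - of_real 0) \<and> 0 \<lless> of_real \<epsilon> + (x * b - of_real 0)"
    unfolding eq by (intro conjI pos_mult pos_add half * C)
qed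

lemma infinitely_near_bounded:
  assumes "infinitely_near T x r"
  shows "\<bar>r\<bar> + 1 > 0" "0 \<lless> of_real (\<bar>r\<bar> + 1) - x" "0 \<lless> of_real (\<bar>r\<bar> + 1) + x"
proof -
  have *: "0 \<lless> of_real (1 / 2) - (x - of_real r)" "0 \<lless> of_real (1 / 2) + (x - of_real r)"
    using assms unfolding infinitely_near_def by (metis half_gt_zero_iff zero_less_one)+
  have c: "0 \<lless> of_real (\<bar>r\<bar> - r + 1 / 2)" "0 \<lless> of_real (\<bar>r\<bar> + r + 1 / 2)" unfolding pos_of_real by simp_all
  have h: "of_real (1 / 2) + of_real (1 / 2) = (1 :: 'a)" unfolding of_real_add[symmetric] by simp
  have eq: "of_real (\<bar>r\<bar> + 1) - x = of_real (\<bar>r\<bar> - r + 1 / 2) + (of_real (1 / 2) - (x - of_real r))"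
    "of_real (\<bar>r\<bar> + 1) + x = of_real (\<bar>r\<bar> + r + 1 / 2) + (of_real (1 / 2) + (x - of_real r))"
    unfolding of_real_add of_real_diff of_real_1 h[symmetric] by (simp_all only: algebra_simps)
  show "0 \<lless> of_real (\<bar>r\<bar> + 1) - x" "0 \<lless> of_real (\<bar>r\<bar> + 1) + x"
    unfolding eq by (intro pos_add c *)+
qed simp

lemma infinitely_near_mult:
  assumes "infinitely_near T x r" "infinitely_near T y s" shows "infinitely_near T (x * y) (r * s)"
proof -
  have "infinitely_near T ((x - of_real r) * y) 0"
    by (rule infinitesimal_mult_bounded[OF _ infinitely_near_bounded[OF assms(2)]])
      (use assms(1) infinitely_near_zero_iff in blast)
  moreover have "infinitely_near T ((y - of_real s) * of_real r) 0"
    by (rule infinitesimal_mult_bounded[OF _ infinitely_near_bounded[OF infinitely_near_of_real]])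
      (use assms(2) infinitely_near_zero_iff in blast)
  ultimately have "infinitely_near T ((x - of_real r) * y + (y - of_real s) * of_real r) (0 + 0)"
    by (rule infinitely_near_add)
  moreover have "(x - of_real r) * y + (y - of_real s) * of_real r = x * y - of_real (r * s)"
    by (simp add: algebra_simps)
  ultimately show ?thesis using infinitely_near_zero_iff[of "x * y"] by simp
qed

text \<open>Completeness of the reals: the standard part is the supremum of the reals below
  \<open>x\<close>.\<close>

lemma bounded_infinitely_near:
  assumes x: "x \<in> K" and C: "0 \<lless> of_real C - x" "0 \<lless> of_real C + x"
  shows "\<exists>r. infinitely_near T x r"
proof -
  define Q where "Q = {q. 0 \<lless> x - of_real q}"
  have "- C \<in> Q" using C(2) by (simp add: Q_def add.commute)
  have bd: "q \<le> C" if "q \<in> Q" for q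
  proof -
    have "0 \<lless> of_real (C - q)" using pos_add[OF C(1), of "x - of_real q"] that by (simp add: Q_def)
    then show ?thesis by (simp only: pos_of_real)
  qed
  then have bdd: "bdd_above Q" by (auto simp: bdd_above_def)
  have "infinitely_near T x (Sup Q)"
    unfolding infinitely_near_def
  proof (intro allI impI conjI)
    fix \<epsilon> :: real assume \<epsilon>: "\<epsilon> > 0"
    have "Sup Q - \<epsilon> < Sup Q" using \<epsilon> by simp
    then obtain q where q: "q \<in> Q" "Sup Q - \<epsilon> < q"
      using less_cSup_iff[of Q "Sup Q - \<epsilon>"] bdd \<open>- C \<in> Q\<close> by blast
    have "0 \<lless> of_real (q - Sup Q + \<epsilon>)" unfolding pos_of_real using q(2) by simp
    from pos_add[OF this, of "x - of_real q"] q(1) show "0 \<lless> of_real \<epsilon> + (x - of_real (Sup Q))"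
      by (simp add: Q_def algebra_simps)
    \<comment> \<open>Lying outside \<open>Q\<close> gives only a weak inequality, so half of
      \<open>\<epsilon>\<close> is held back to make it strict.\<close>
    have "Sup Q + \<epsilon> / 2 \<notin> Q"
    proof
      assume "Sup Q + \<epsilon> / 2 \<in> Q"
      then have "Sup Q + \<epsilon> / 2 \<le> Sup Q" using cSup_upper bdd by blast
      then show False using \<epsilon> by simp
    qed
    define y where "y = of_real (Sup Q + \<epsilon> / 2) - x"
    have "y \<in> K" unfolding y_def using x by (intro subalg_diff[OF sub] subalg_of_real[OF sub])
    have "\<not> 0 \<lless> - y" using \<open>Sup Q + \<epsilon> / 2 \<notin> Q\<close> by (simp add: Q_def y_def)
    then have "y = 0 \<or> 0 \<lless> y"
      using less_total[OF subalg_0[OF sub] \<open>y \<in> K\<close>] neg_iff by blast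
    moreover have e: "0 \<lless> of_real (\<epsilon> / 2)" unfolding pos_of_real using \<epsilon> by simp
    ultimately have "0 \<lless> of_real (\<epsilon> / 2) + y" using pos_add by fastforce
    moreover have "of_real \<epsilon> = of_real (\<epsilon> / 2) + (of_real (\<epsilon> / 2) :: 'a)" unfolding of_real_add[symmetric] by simp
    ultimately show "0 \<lless> of_real \<epsilon> - (x - of_real (Sup Q))"
      unfolding y_def of_real_add by (simp only: algebra_simps)
  qed
  then show ?thesis by blast
qed

lemma unbounded_inverse:
  assumes x: "x \<in> K" and none: "\<And>r. \<not> infinitely_near T x r"
  shows "infinitely_near T (inverse x) 0"
proof -
  have x0: "x \<noteq> 0"
  proof
    assume "x = 0"
    then show False using none[of 0] infinitely_near_of_real[of 0] by simp
  qed
  have main: "infinitely_near T (inverse y) 0" if y: "y \<in> K" "0 \<lless> y" "\<And>r. \<not> infinitely_near T y r" for y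
    unfolding infinitely_near_def
  proof (intro allI impI)
    fix \<epsilon> :: real assume \<epsilon>: "\<epsilon> > 0"
    have y0: "y \<noteq> 0" using y(2) less_irrefl by auto
    have iy: "0 \<lless> inverse y" using y(2) T_inverse[of y] y0 by (simp add: lt_def)
    have c: "0 \<lless> of_real (inverse \<epsilon>)" unfolding pos_of_real using \<epsilon> by simp
    have "\<not> 0 \<lless> of_real (inverse \<epsilon>) - y"
      using bounded_infinitely_near[OF y(1)] y(3) pos_add[OF c y(2)] by blast
    moreover have "y \<noteq> of_real (inverse \<epsilon>)" using y(3) infinitely_near_of_real by metis
    ultimately have "0 \<lless> y - of_real (inverse \<epsilon>)"
      using less_total[OF y(1) subalg_of_real[OF sub, of "inverse \<epsilon>"]] less_iff_pos by blast
    moreover have e: "0 \<lless> of_real \<epsilon>" unfolding pos_of_real using \<epsilon> by simp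
    ultimately have "0 \<lless> of_real \<epsilon> * inverse y * (y - of_real (inverse \<epsilon>))"
      using pos_mult iy by blast
    moreover have "of_real \<epsilon> * inverse y * (y - of_real (inverse \<epsilon>)) = of_real \<epsilon> - inverse y"
      using y0 \<epsilon> by (simp add: field_simps)
    ultimately show "0 \<lless> of_real \<epsilon> - (inverse y - of_real 0) \<and> 0 \<lless> of_real \<epsilon> + (inverse y - of_real 0)"
      using pos_add[OF e iy] by simp
  qed
  have neg: "infinitely_near T (- y) (- r)" if "infinitely_near T y r" for y r
    using infinitely_near_mult[OF infinitely_near_of_real[of "- 1"] that] by simp
  show ?thesis
  proof (cases "0 \<lless> x")
    case True
    then show ?thesis using main x none by blast
  next
    case False
    then have "0 \<lless> - x" using less_total[OF subalg_0[OF sub] x] x0 neg_iff by blast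
    then have "infinitely_near T (inverse (- x)) 0"
      using main[of "- x"] neg[of "- x"] none subalg_uminus[OF sub x] by auto
    then show ?thesis using neg[of "inverse (- x)" 0] by simp
  qed
qed

lemma place_of_in_M: "place_of K T \<in> M K"
  unfolding M_def mem_Collect_eq is_place_def
proof (intro conjI allI ballI impI)
  show "place_of K T x = None" if "x \<notin> K" for x using that by (simp add: place_of_eq_None)
  show "place_of K T 1 = Some 1"
    unfolding place_of_eq_Some using subalg_1[OF sub] infinitely_near_of_real[of 1] by simp
  show "place_of K T (inverse x) = Some 0" if "x \<in> K" "place_of K T x = None" for x
    using that unfolding place_of_eq_Some place_of_eq_None
    using R_subfield_inverse[OF K] unbounded_inverse by blast
  fix x y assume "x \<in> K" "y \<in> K" "place_of K T x \<noteq> None \<and> place_of K T y \<noteq> None"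
  then obtain r s where rs: "place_of K T x = Some r" "place_of K T y = Some s" by auto
  then have near: "x \<in> K" "infinitely_near T x r" "y \<in> K" "infinitely_near T y s"
    by (simp_all add: place_of_eq_Some)
  show "place_of K T (x + y) = Some (the (place_of K T x) + the (place_of K T y))"
    unfolding rs place_of_eq_Some option.sel
    using infinitely_near_add[OF near(2,4)] subalg_add[OF sub near(1,3)] by blast
  show "place_of K T (x * y) = Some (the (place_of K T x) * the (place_of K T y))"
    unfolding rs place_of_eq_Some option.sel
    using infinitely_near_mult[OF near(2,4)] subalg_mult[OF sub near(1,3)] by blast
qed

end

lemma infinitely_near_mono:
  "T \<subseteq> T' \<Longrightarrow> infinitely_near T x r \<Longrightarrow> infinitely_near T' x r"
  unfolding infinitely_near_def lt_def by blast

text \<open>Standard parts persist in the larger ordering. An element infinitely large for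
  \<open>T1\<close> stays so for \<open>T\<close>: its inverse remains infinitesimal, and a finite
  times an infinitesimal element cannot be 1.\<close>

lemma restr_place_of:
  assumes ord: "field_ordering F T" "field_ordering F1 T1" and sub: "F1 \<subseteq> F" "T1 \<subseteq> T"
  shows "restr F1 (place_of F T) = place_of F1 T1"
proof
  fix x
  interpret F: ordered_R_field F T by unfold_locales (rule ord)
  interpret F1: ordered_R_field F1 T1 by unfold_locales (rule ord)
  show "restr F1 (place_of F T) x = place_of F1 T1 x"
  proof (cases "x \<in> F1")
    case False
    then show ?thesis using F1.place_of_eq_None[of x] by (simp add: restr_def)
  next
    case x: True
    show ?thesis
    proof (cases "\<exists>r. infinitely_near T1 x r")
      case True
      then obtain r where "infinitely_near T1 x r" by blast
      then have "place_of F1 T1 x = Some r" "place_of F T x = Some r"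
        using x sub infinitely_near_mono F.place_of_eq_Some F1.place_of_eq_Some by blast+
      then show ?thesis using x by (simp add: restr_def)
    next
      case False
      then have near: "infinitely_near T1 (inverse x) 0" using F1.unbounded_inverse[OF x] by blast
      have "place_of F T x = None"
      proof (rule ccontr)
        assume "place_of F T x \<noteq> None"
        then obtain r where r: "infinitely_near T x r"
          using F.place_of_eq_None[of x] x sub(1) by auto
        have "x \<noteq> 0"
        proof
          assume "x = 0"
          then show False using False F1.infinitely_near_of_real[of 0] by auto
        qed
        then have "infinitely_near T (of_real 1) (r * 0)"
          using F.infinitely_near_mult[OF r infinitely_near_mono[OF sub(2) near]] by simp
        then have "1 = r * 0" using F.infinitely_near_unique[OF F.infinitely_near_of_real] by blast
        then show False by simp
      qed
      moreover have "place_of F1 T1 x = None" using False by (simp add: F1.place_of_eq_None)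
      ultimately show ?thesis using x by (simp add: restr_def)
    qed
  qed
qed

section \<open>From a place to a preordering\<close>

lemma place_zero: "is_place F \<zeta> \<Longrightarrow> 0 \<in> F \<Longrightarrow> \<zeta> 0 = Some 0"
proof -
  assume \<zeta>: "is_place F \<zeta>" "0 \<in> F"
  \<comment> \<open>As \<open>inverse 0 = 0\<close>, the value infinity at 0 would force the value 0
    there.\<close>
  have "\<zeta> 0 \<noteq> None"
  proof
    assume "\<zeta> 0 = None"
    then show False using \<zeta> unfolding is_place_def by (metis inverse_zero option.distinct(1))
  qed
  moreover from this have "\<zeta> (0 + 0) = Some (the (\<zeta> 0) + the (\<zeta> 0))"
    using \<zeta> unfolding is_place_def by blast
  ultimately show ?thesis by auto
qed

text \<open>The set is closed under addition because of any two elements \<open>x\<close>, \<open>y\<close> one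
  divides the other in the valuation ring.\<close>

lemma place_precone:
  assumes \<zeta>: "is_place F \<zeta>" and F: "is_R_subfield F"
  shows "precone F {a * (x * x) |a x. a \<in> F \<and> x \<in> F \<and> (\<exists>r>0. \<zeta> a = Some r)}" (is "precone F ?T")
proof -
  note A = subalg_R_subfield[OF F]
  have \<zeta>1: "\<zeta> 1 = Some 1" using \<zeta> by (simp add: is_place_def)
  have op: "\<zeta> (x + y) = Some (r + s) \<and> \<zeta> (x * y) = Some (r * s)"
    if "x \<in> F" "y \<in> F" "\<zeta> x = Some r" "\<zeta> y = Some s" for x y r s
    using \<zeta> that unfolding is_place_def by force
  have inv: "\<zeta> (inverse x) = Some 0" if "x \<in> F" "\<zeta> x = None" for x
    using \<zeta> that unfolding is_place_def by blast
  have closed: "x \<in> F \<Longrightarrow> y \<in> F \<Longrightarrow> x + y \<in> F" "x \<in> F \<Longrightarrow> y \<in> F \<Longrightarrow> x * y \<in> F" for x y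
    using subalg_add[OF A] subalg_mult[OF A] by auto
  have memI: "a * (x * x) \<in> ?T" if "a \<in> F" "x \<in> F" "\<zeta> a = Some r" "r > 0" for a x r
    unfolding mem_Collect_eq using that by (intro exI[of _ a] exI[of _ x] conjI exI[of _ r]) simp_all
  \<comment> \<open>For finite \<open>z = y / x\<close> the sum is
    \<open>(a + b * z^2) * x^2\<close>, and the first factor has the positive value
    \<open>r + s * c^2\<close>.\<close>
  have add: "a * (x * x) + b * (y * y) \<in> ?T"
    if ab: "a \<in> F" "b \<in> F" "\<zeta> a = Some r" "r > 0" "\<zeta> b = Some s" "s > 0"
      and xy: "x \<in> F" "y \<in> F" "x \<noteq> 0" "\<zeta> (y / x) = Some c" for a b x y r s c
  proof -
    define z where "z = y / x"
    have z: "z \<in> F" unfolding z_def using R_subfield_divide[OF F xy(2,1)] .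
    note zz = closed(2)[OF z z]
    have "\<zeta> (z * z) = Some (c * c)" using op[OF z z] xy(4) by (simp add: z_def)
    then have "\<zeta> (b * (z * z)) = Some (s * (c * c))" using op[OF ab(2) zz ab(5)] by blast
    then have "\<zeta> (a + b * (z * z)) = Some (r + s * (c * c))"
      using op[OF ab(1) closed(2)[OF ab(2) zz] ab(3)] by blast
    moreover have "r + s * (c * c) > 0" using ab by (simp add: add_pos_nonneg)
    moreover have "a + b * (z * z) \<in> F" by (intro closed ab zz)
    ultimately have "(a + b * (z * z)) * (x * x) \<in> ?T" using memI xy(1) by simp
    moreover have "a * (x * x) + b * (y * y) = (a + b * (z * z)) * (x * x)"
      using xy(3) by (simp add: z_def field_simps)
    ultimately show ?thesis by simp
  qed
  show ?thesis
    unfolding precone_def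
  proof (intro conjI ballI F)
    show "?T \<subseteq> F" by (auto intro!: closed)
    show "x * x \<in> ?T" if "x \<in> F" for x
      using memI[OF subalg_1[OF A] that \<zeta>1] by simp
    show "- 1 \<notin> ?T"
    proof
      assume "- 1 \<in> ?T"
      then obtain a x r where a: "a \<in> F" "x \<in> F" "\<zeta> a = Some r" "r > 0" "- 1 = a * (x * x)" by blast
      have x0: "x \<noteq> 0" using a(5) by auto
      define z where "z = inverse x"
      have z: "z \<in> F" unfolding z_def using R_subfield_inverse[OF F a(2)] .
      \<comment> \<open>If \<open>1 / x\<close> is infinite, then \<open>x\<close> has value 0 and
        so would -1. Otherwise \<open>a + z * z\<close>, which is 0, would have the positive value
        \<open>r + s * s\<close>.\<close>
      show False
      proof (cases "\<zeta> z")
        case None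
        then have "\<zeta> x = Some 0" using inv[OF z] by (simp add: z_def)
        then have "\<zeta> (x * x) = Some 0" using op[OF a(2) a(2)] by simp
        then have "\<zeta> (- 1) = Some 0" using op[OF a(1) _ a(3), of "x * x"] closed a by simp
        then have "\<zeta> (- 1 + 1) = Some (0 + 1)"
          using op[OF subalg_uminus[OF A subalg_1[OF A]] subalg_1[OF A] _ \<zeta>1] by blast
        then show False using place_zero[OF \<zeta> subalg_0[OF A]] by simp
      next
        case (Some s)
        have "\<zeta> (z * z) = Some (s * s)" using op[OF z z Some Some] by blast
        then have "\<zeta> (a + z * z) = Some (r + s * s)" using op[OF a(1) closed(2)[OF z z] a(3)] by blast
        moreover have "a + z * z = 0"
        proof -
          have "- 1 * (z * z) = a * ((x * z) * (x * z))" unfolding a(5) by (simp only: mult_ac)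
          then have "a = - (z * z)" using x0 by (simp add: z_def)
          then show ?thesis by simp
        qed
        moreover have "r + s * s > 0" using a(4) by (simp add: add_pos_nonneg)
        ultimately show False using place_zero[OF \<zeta> subalg_0[OF A]] by simp
      qed
    qed
    fix u v assume "u \<in> ?T" "v \<in> ?T"
    then obtain a x r b y s where u: "u = a * (x * x)" "a \<in> F" "x \<in> F" "\<zeta> a = Some r" "r > 0"
      and v: "v = b * (y * y)" "b \<in> F" "y \<in> F" "\<zeta> b = Some s" "s > 0" by blast
    have uv: "u * v = (a * b) * ((x * y) * (x * y))" by (simp add: u v)
    show "u * v \<in> ?T"
      unfolding uv
      by (rule memI[OF closed(2)[OF u(2) v(2)] closed(2)[OF u(3) v(3)] conjunct2[OF op[OF u(2) v(2) u(4) v(4)]]])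
        (use u v in simp)
    show "u + v \<in> ?T"
    proof (cases "x = 0 \<or> y = 0")
      case True
      then have "u + v = u \<or> u + v = v" by (auto simp: u(1) v(1))
      then show ?thesis using \<open>u \<in> ?T\<close> \<open>v \<in> ?T\<close> by (elim disjE) (simp_all only:)
    next
      case False
      show ?thesis
      proof (cases "\<zeta> (y / x)")
        case None
        have "\<zeta> (x / y) = Some 0" using inv[OF R_subfield_divide[OF F v(3) u(3)] None] by simp
        from add[OF v(2) u(2) v(4,5) u(4,5) v(3) u(3) _ this] False
        have "b * (y * y) + a * (x * x) \<in> ?T" by simp
        then show ?thesis unfolding u(1) v(1) by (simp only: add.commute)
      next
        case (Some c)
        from add[OF u(2) v(2) u(4,5) v(4,5) u(3) v(3) _ this] False
        show ?thesis unfolding u(1) v(1) by simp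
      qed
    qed
  qed
qed

section \<open>Tensor products of points\<close>

lemma alg_finitary:
  assumes "x \<in> alg G"
  obtains Y where "finite Y" "Y \<subseteq> G" "x \<in> alg Y"
proof -
  let ?U = "{x. \<exists>Y. finite Y \<and> Y \<subseteq> G \<and> x \<in> alg Y}"
  have "subalg ?U"
    unfolding subalg_def
  proof (intro conjI ballI subsetI)
    fix x :: 'a assume "x \<in> range of_real"
    then show "x \<in> ?U" using subalg_of_real[OF subalg_alg[of "{}"]] by (auto intro!: exI[of _ "{}"])
  next
    fix x y assume "x \<in> ?U" "y \<in> ?U"
    then obtain Y Z where Y: "finite Y" "Y \<subseteq> G" "x \<in> alg Y" and Z: "finite Z" "Z \<subseteq> G" "y \<in> alg Z" by blast
    have "x \<in> alg (Y \<union> Z)" "y \<in> alg (Y \<union> Z)" using Y(3) Z(3) alg_mono[of Y "Y \<union> Z"] alg_mono[of Z "Y \<union> Z"] by auto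
    then have "x + y \<in> alg (Y \<union> Z)" "x * y \<in> alg (Y \<union> Z)"
      using subalg_add[OF subalg_alg] subalg_mult[OF subalg_alg] by blast+
    moreover have "finite (Y \<union> Z) \<and> Y \<union> Z \<subseteq> G" using Y Z by simp
    ultimately show "x + y \<in> ?U" "x * y \<in> ?U" by blast+
  qed
  moreover have "G \<subseteq> ?U"
  proof
    fix g assume "g \<in> G"
    then show "g \<in> ?U" using alg_superset[of "{g}"] by (auto intro!: exI[of _ "{g}"])
  qed
  ultimately have "alg G \<subseteq> ?U" by (rule alg_least)
  then show ?thesis using assms that by blast
qed

lemma finite_subset_alg_finitary:
  assumes "finite W" "W \<subseteq> alg G"
  obtains Y where "finite Y" "Y \<subseteq> G" "W \<subseteq> alg Y"
proof -
  have "\<exists>Y. finite Y \<and> Y \<subseteq> G \<and> w \<in> alg Y" if "w \<in> W" for w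
    using alg_finitary[OF subsetD[OF assms(2) that]] by metis
  then obtain f where f: "\<And>w. w \<in> W \<Longrightarrow> finite (f w) \<and> f w \<subseteq> G \<and> w \<in> alg (f w)" by metis
  have "W \<subseteq> alg (\<Union> (f ` W))"
  proof
    fix w assume w: "w \<in> W"
    then have "f w \<subseteq> \<Union> (f ` W)" by blast
    then show "w \<in> alg (\<Union> (f ` W))" using f[OF w] alg_mono by blast
  qed
  moreover have "finite (\<Union> (f ` W))" "\<Union> (f ` W) \<subseteq> G" using assms(1) f by auto
  ultimately show ?thesis using that by blast
qed

lemma field_gen_least: "is_R_subfield K \<Longrightarrow> S \<subseteq> K \<Longrightarrow> field_gen S \<subseteq> K"
  unfolding field_gen_def by auto

lemma field_gen_superset: "S \<subseteq> field_gen S"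
  unfolding field_gen_def by auto

lemma field_gen_R_subfield: "is_R_subfield (field_gen S)"
  unfolding is_R_subfield_def field_gen_def by auto

lemma field_gen_fraction:
  assumes "x \<in> field_gen S"
  shows "\<exists>n\<in>alg S. \<exists>m\<in>alg S. m \<noteq> 0 \<and> x = n / m"
proof -
  define Q where "Q = {n / m |n m. n \<in> alg S \<and> m \<in> alg S \<and> m \<noteq> 0}"
  note A = subalg_alg[of S]
  have QI: "n / m \<in> Q" if "n \<in> alg S" "m \<in> alg S" "m \<noteq> 0" for n m
    unfolding Q_def using that by blast
  have AQ: "alg S \<subseteq> Q" using QI[OF _ subalg_1[OF A]] by auto
  have "is_R_subfield Q"
    unfolding is_R_subfield_def
  proof (intro conjI ballI)
    show "range of_real \<subseteq> Q" using AQ subalg_of_real[OF A] by auto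
  next
    fix x y assume "x \<in> Q" "y \<in> Q"
    then obtain n m n' m' where x: "n \<in> alg S" "m \<in> alg S" "m \<noteq> 0" "x = n / m"
      and y: "n' \<in> alg S" "m' \<in> alg S" "m' \<noteq> 0" "y = n' / m'" unfolding Q_def by blast
    have "x + y = (n * m' + n' * m) / (m * m')" "x * y = (n * n') / (m * m')"
      unfolding x(4) y(4) by (rule add_frac_eq[OF x(3) y(3)], rule times_divide_times_eq)
    moreover have "n * m' + n' * m \<in> alg S" "n * n' \<in> alg S" "m * m' \<in> alg S"
      by (intro subalg_add[OF A] subalg_mult[OF A] x y)+
    ultimately show "x + y \<in> Q" "x * y \<in> Q" using QI x y by simp_all
  next
    fix x assume "x \<in> Q"
    then obtain n m where x: "n \<in> alg S" "m \<in> alg S" "m \<noteq> 0" "x = n / m" unfolding Q_def by blast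
    show "- x \<in> Q" using QI[OF subalg_uminus[OF A x(1)] x(2,3)] x(4) by simp
    show "inverse x \<in> Q"
    proof (cases "n = 0")
      case True
      then show ?thesis using x AQ subalg_0[OF A] by auto
    next
      case False
      then have "inverse x = m / n" using x by simp
      then show ?thesis using QI x False by simp
    qed
  qed
  then have "field_gen S \<subseteq> Q" by (rule field_gen_least[OF _ subset_trans[OF alg_superset AQ]])
  then have "x \<in> Q" using assms by (rule subsetD)
  then obtain n m where "x = n / m" "n \<in> alg S" "m \<in> alg S" "m \<noteq> 0"
    unfolding Q_def mem_Collect_eq by (elim exE conjE)
  then show ?thesis by (intro bexI[of _ n] bexI[of _ m] conjI)
qed

text \<open>Localisation at the elements on which \<open>\<phi>\<close> does not vanish;
  cross-multiplication shows that the value of a fraction is well defined.\<close>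

lemma alg_hom_fractions:
  assumes A: "subalg A" and \<phi>: "alg_hom A \<phi>"
  obtains B \<psi> where "subalg B" "A \<subseteq> B" "alg_hom B \<psi>" "\<And>a. a \<in> A \<Longrightarrow> \<psi> a = \<phi> a"
    "\<And>n m. n \<in> A \<Longrightarrow> m \<in> A \<Longrightarrow> \<phi> m \<noteq> 0 \<Longrightarrow> n / m \<in> B"
proof -
  define P where "P z r \<longleftrightarrow> (\<exists>n\<in>A. \<exists>m\<in>A. \<phi> m \<noteq> 0 \<and> z = n / m \<and> r = \<phi> n / \<phi> m)" for z r
  define B where "B = {z. \<exists>r. P z r}"
  define \<psi> where "\<psi> z = (SOME r. P z r)" for z
  have PI: "P (n / m) (\<phi> n / \<phi> m)" if "n \<in> A" "m \<in> A" "\<phi> m \<noteq> 0" for n m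
    unfolding P_def using that by blast
  have nz: "m \<noteq> 0" if "\<phi> m \<noteq> 0" for m using that alg_hom_0[OF \<phi>] by auto
  have uniq: "r = s" if "P z r" "P z s" for z r s
  proof -
    from that obtain n m n' m' where *: "n \<in> A" "m \<in> A" "\<phi> m \<noteq> 0" "z = n / m" "r = \<phi> n / \<phi> m"
      "n' \<in> A" "m' \<in> A" "\<phi> m' \<noteq> 0" "z = n' / m'" "s = \<phi> n' / \<phi> m'" unfolding P_def by blast
    have "n * m' = n' * m" using *(4,9) nz[OF *(3)] nz[OF *(8)] by (simp add: frac_eq_eq)
    then have "\<phi> n * \<phi> m' = \<phi> n' * \<phi> m" using alg_hom_mult[OF \<phi>] * by metis
    then show ?thesis using * by (simp add: frac_eq_eq)
  qed
  have \<psi>: "\<psi> z = r" if "P z r" for z r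
    unfolding \<psi>_def using someI[of "P z", OF that] uniq that by blast
  have base: "P a (\<phi> a)" if "a \<in> A" for a
    using PI[OF that subalg_1[OF A]] alg_hom_1[OF \<phi>] by simp
  have add: "P (y + z) (r + s)" and mult: "P (y * z) (r * s)" if yz: "P y r" "P z s" for y z r s
  proof -
    from yz obtain n m n' m' where *: "n \<in> A" "m \<in> A" "\<phi> m \<noteq> 0" "y = n / m" "r = \<phi> n / \<phi> m"
      "n' \<in> A" "m' \<in> A" "\<phi> m' \<noteq> 0" "z = n' / m'" "s = \<phi> n' / \<phi> m'" unfolding P_def by blast
    have mem: "n * m' \<in> A" "n' * m \<in> A" "n * n' \<in> A" "m * m' \<in> A" "n * m' + n' * m \<in> A"
      by (intro subalg_add[OF A] subalg_mult[OF A] *)+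
    have \<phi>m: "\<phi> (m * m') = \<phi> m * \<phi> m'" "\<phi> (n * n') = \<phi> n * \<phi> n'"
      "\<phi> (n * m' + n' * m) = \<phi> n * \<phi> m' + \<phi> n' * \<phi> m"
      using alg_hom_add[OF \<phi> mem(1,2)] alg_hom_mult[OF \<phi>] * by simp_all
    have "y + z = (n * m' + n' * m) / (m * m')"
      unfolding *(4,9) by (rule add_frac_eq[OF nz[OF *(3)] nz[OF *(8)]])
    moreover have "y * z = (n * n') / (m * m')" unfolding *(4,9) by (rule times_divide_times_eq)
    moreover have "r + s = \<phi> (n * m' + n' * m) / \<phi> (m * m')"
      unfolding \<phi>m *(5,10) by (rule add_frac_eq[OF *(3,8)])
    moreover have "r * s = \<phi> (n * n') / \<phi> (m * m')"
      unfolding \<phi>m *(5,10) by (rule times_divide_times_eq)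
    ultimately show "P (y + z) (r + s)" "P (y * z) (r * s)"
      using PI[OF mem(5,4)] PI[OF mem(3,4)] * by (simp_all add: \<phi>m)
  qed
  show ?thesis
  proof (rule that[of B \<psi>])
    show "A \<subseteq> B" using base by (auto simp: B_def)
    show "n / m \<in> B" if "n \<in> A" "m \<in> A" "\<phi> m \<noteq> 0" for n m using PI[OF that] by (auto simp: B_def)
    show "\<psi> a = \<phi> a" if "a \<in> A" for a using \<psi> base that by blast
    have real: "P (of_real s) s" for s
      using base[OF subalg_of_real[OF A, of s]] alg_hom_of_real[OF \<phi>, of s] by simp
    show "subalg B" 
      unfolding subalg_def
    proof (intro conjI ballI subsetI)
      show "x \<in> B" if "x \<in> range of_real" for x using that real by (auto simp: B_def)
      fix y z assume "y \<in> B" "z \<in> B"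
      then obtain r s where rs: "P y r" "P z s" by (auto simp: B_def)
      show "y + z \<in> B" "y * z \<in> B" using add[OF rs] mult[OF rs] by (auto simp: B_def)
    qed
    show "alg_hom B \<psi>"
      unfolding alg_hom_def
    proof (intro conjI allI ballI)
      show "\<psi> (of_real s) = s" for s using \<psi> real by blast
      fix y z assume "y \<in> B" "z \<in> B"
      then obtain r s where rs: "P y r" "P z s" by (auto simp: B_def)
      then show "\<psi> (y + z) = \<psi> y + \<psi> z" "\<psi> (y * z) = \<psi> y * \<psi> z"
        using \<psi>[OF rs(1)] \<psi>[OF rs(2)] \<psi>[OF add[OF rs]] \<psi>[OF mult[OF rs]] by simp_all
    qed
  qed
qed

lemma alg_hom_prod_nonzero:
  assumes A: "subalg A" "alg_hom A \<phi>" and S: "finite S" "\<And>s. s \<in> S \<Longrightarrow> m s \<in> A"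
    and "\<phi> (prod m S) \<noteq> 0" "s \<in> S"
  shows "\<phi> (m s) \<noteq> 0"
  using assms(5,6) S(1) alg_hom_prod[OF A, of S m] S(2) by auto

text \<open>By compactness it suffices to meet finitely many conditions
  \<open>|a - \<phi> a| < \<epsilon>\<close> at a point where finitely many fractions are defined.
  Centrality supplies a point close to \<open>\<phi>\<close> at which the product of their
  denominators does not vanish.\<close>

lemma ordering_at_central_point:
  fixes G :: "'a::real_field set"
  assumes \<phi>: "alg_hom (alg G) \<phi>" "central (alg G) \<phi>"
  obtains P where "field_ordering (field_gen G) P" "\<And>a. a \<in> alg G \<Longrightarrow> infinitely_near P a (\<phi> a)"
proof -
  define A where "A = alg G"
  have A: "subalg A" unfolding A_def by (rule subalg_alg)
  note \<phi> = \<phi>[folded A_def]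
  have AF: "A \<subseteq> field_gen G"
    unfolding A_def by (rule alg_least[OF subalg_R_subfield[OF field_gen_R_subfield] field_gen_superset])
  define N where "N = {of_real \<epsilon> - (a - of_real (\<phi> a)) |a \<epsilon>. a \<in> A \<and> \<epsilon> > 0} \<union>
    {of_real \<epsilon> + (a - of_real (\<phi> a)) |a \<epsilon>. a \<in> A \<and> \<epsilon> > 0}"
  have N: "n \<in> A \<and> \<phi> n > 0" if n: "n \<in> N" for n
  proof -
    from n obtain a \<epsilon> where a: "a \<in> A" "\<epsilon> > 0"
      "n = of_real \<epsilon> - (a - of_real (\<phi> a)) \<or> n = of_real \<epsilon> + (a - of_real (\<phi> a))" unfolding N_def by blast
    have mem: "of_real \<epsilon> \<in> A" "a - of_real (\<phi> a) \<in> A"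
      using subalg_of_real[OF A] subalg_diff[OF A a(1)] by auto
    have "\<phi> (a - of_real (\<phi> a)) = 0"
      using alg_hom_diff[OF A \<phi>(1) a(1) subalg_of_real[OF A]] alg_hom_of_real[OF \<phi>(1)] by simp
    then have "\<phi> n = \<epsilon>"
      using a(3) alg_hom_diff[OF A \<phi>(1) mem] alg_hom_add[OF \<phi>(1) mem] alg_hom_of_real[OF \<phi>(1)] by auto
    moreover have "n \<in> A"
      using a(3) subalg_diff[OF A mem] subalg_add[OF A mem] by (elim disjE) (simp_all only:)
    ultimately show ?thesis using a(2) by simp
  qed
  have sat: "\<exists>B \<psi>. subalg B \<and> S \<subseteq> B \<and> alg_hom B \<psi> \<and> (\<forall>n\<in>N'. \<psi> n > 0)"
    if N': "finite N'" "N' \<subseteq> N" and S: "finite S" "S \<subseteq> field_gen G" for N' S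
  proof -
    have "\<exists>n\<in>A. \<exists>m\<in>A. m \<noteq> 0 \<and> s = n / m" if "s \<in> S" for s
      unfolding A_def by (rule field_gen_fraction[OF subsetD[OF S(2) that]])
    then obtain n m where nm: "\<And>s. s \<in> S \<Longrightarrow> n s \<in> A \<and> m s \<in> A \<and> m s \<noteq> 0 \<and> s = n s / m s" by metis
    have mA: "\<And>s. s \<in> S \<Longrightarrow> m s \<in> A" using nm by blast
    have "prod m S \<in> A" "prod m S \<noteq> 0" using nm S(1) by (auto intro!: subalg_prod[OF A])
    then obtain \<phi>s where \<phi>s: "\<forall>\<^sub>F k in sequentially. alg_hom A (\<phi>s k) \<and> \<phi>s k (prod m S) \<noteq> 0"
      "\<And>a. a \<in> A \<Longrightarrow> (\<lambda>k. \<phi>s k a) \<longlonglongrightarrow> \<phi> a"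
      using \<phi>(2) unfolding central_def by meson
    have "\<forall>\<^sub>F k in sequentially. \<forall>n\<in>N'. \<phi>s k n > 0"
    proof (rule eventually_ball_finite[OF N'(1)], intro ballI)
      fix n assume "n \<in> N'"
      then have "n \<in> A" "\<phi> n > 0" using N N'(2) by auto
      then show "\<forall>\<^sub>F k in sequentially. \<phi>s k n > 0" using order_tendstoD(1)[OF \<phi>s(2)] by blast
    qed
    with \<phi>s(1) have "\<forall>\<^sub>F k in sequentially. (alg_hom A (\<phi>s k) \<and> \<phi>s k (prod m S) \<noteq> 0) \<and> (\<forall>n\<in>N'. \<phi>s k n > 0)"
      by (rule eventually_conj)
    then obtain k where k: "alg_hom A (\<phi>s k)" "\<phi>s k (prod m S) \<noteq> 0" "\<forall>n\<in>N'. \<phi>s k n > 0"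
      using eventually_happens'[OF sequentially_bot] by blast
    obtain B \<psi> where B: "subalg B" "A \<subseteq> B" "alg_hom B \<psi>" "\<And>a. a \<in> A \<Longrightarrow> \<psi> a = \<phi>s k a"
      "\<And>n m. n \<in> A \<Longrightarrow> m \<in> A \<Longrightarrow> \<phi>s k m \<noteq> 0 \<Longrightarrow> n / m \<in> B"
      using alg_hom_fractions[OF A k(1)] by blast
    have "S \<subseteq> B"
    proof
      fix s assume s: "s \<in> S"
      have "\<phi>s k (m s) \<noteq> 0" by (rule alg_hom_prod_nonzero[OF A k(1) S(1) mA k(2) s])
      then show "s \<in> B" using B(5)[of "n s" "m s"] nm[OF s] by metis
    qed
    moreover have "\<forall>n\<in>N'. \<psi> n > 0" using B(4) k(3) N N'(2) by auto
    ultimately show ?thesis using B(1,3) by blast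
  qed
  have NF: "N \<subseteq> field_gen G" using N AF by auto
  obtain P where P: "field_ordering (field_gen G) P" "\<And>n. n \<in> N \<Longrightarrow> lt P 0 n"
    by (rule ordering_compactness[OF field_gen_R_subfield NF sat]) (assumption+, blast)
  have "infinitely_near P a (\<phi> a)" if "a \<in> A" for a
    unfolding infinitely_near_def using P(2) that unfolding N_def by blast
  then show ?thesis using that P(1) unfolding A_def by blast
qed

text \<open>Either \<open>x\<close> minus its standard part or the inverse of \<open>x\<close> is a
  nonzero infinitesimal, and one of its two signs is positive.\<close>

lemma exists_pos_infinitesimal:
  assumes ord: "field_ordering K T" and x: "x \<in> K" "x \<notin> range of_real"
  obtains t where "pos_infinitesimal K T t"
proof -
  interpret ordered_R_field K T by unfold_locales (rule ord)
  have *: "\<exists>t. pos_infinitesimal K T t" if y: "y \<in> K" "y \<noteq> 0" "infinitely_near T y 0" for y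
  proof -
    have near: "lt T 0 (of_real \<epsilon> - y)" "lt T 0 (of_real \<epsilon> + y)" if "\<epsilon> > 0" for \<epsilon>
      using y(3) that unfolding infinitely_near_def by auto
    then have lt: "lt T y (of_real \<epsilon>)" "lt T (- y) (of_real \<epsilon>)" if "\<epsilon> > 0" for \<epsilon>
      using that less_iff_pos[of y "of_real \<epsilon>"] less_iff_pos[of "- y" "of_real \<epsilon>"] by auto
    have "lt T 0 y \<or> lt T 0 (- y)" using less_total[OF subalg_0[OF sub] y(1)] y(2) neg_iff by blast
    then show ?thesis
      using lt y(1) subalg_uminus[OF sub y(1)] unfolding pos_infinitesimal_def by blast
  qed
  have "\<exists>y. y \<in> K \<and> y \<noteq> 0 \<and> infinitely_near T y 0"
  proof (cases "\<exists>r. infinitely_near T x r")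
    case True
    then obtain r where r: "infinitely_near T x r" by blast
    then have "infinitely_near T (x - of_real r) 0" using infinitely_near_zero_iff by blast
    moreover have "x - of_real r \<noteq> 0" using x(2) by auto
    ultimately show ?thesis using subalg_diff[OF sub x(1) subalg_of_real[OF sub]] by blast
  next
    case False
    then have "infinitely_near T (inverse x) 0" using unbounded_inverse x(1) by blast
    moreover have "inverse x \<noteq> 0"
    proof
      assume "inverse x = 0"
      then have "x = of_real 0" by simp
      then show False using x(2) by blast
    qed
    ultimately show ?thesis using R_subfield_inverse[OF K x(1)] by blast
  qed
  then show ?thesis using * that by blast
qed

text \<open>Pairs an expression of \<open>z\<close> as a sum of products with the corresponding sum
  of values. That \<open>r\<close> depends on \<open>z\<close> alone is not built in; it is derived
  from linear disjointness later.\<close>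

inductive tensor :: "'a::real_field set \<Rightarrow> 'a set \<Rightarrow> ('a \<Rightarrow> real) \<Rightarrow> ('a \<Rightarrow> real) \<Rightarrow> 'a \<Rightarrow> real \<Rightarrow> bool"
  for A1 A2 \<phi>1 \<phi>2 where
  tensor_prod: "a \<in> A1 \<Longrightarrow> b \<in> A2 \<Longrightarrow> tensor A1 A2 \<phi>1 \<phi>2 (a * b) (\<phi>1 a * \<phi>2 b)"
| tensor_add: "tensor A1 A2 \<phi>1 \<phi>2 z r \<Longrightarrow> tensor A1 A2 \<phi>1 \<phi>2 z' r' \<Longrightarrow> tensor A1 A2 \<phi>1 \<phi>2 (z + z') (r + r')"

lemma tensor_mult:
  assumes A: "subalg A1" "subalg A2"
    and mult1: "\<And>a a'. a \<in> A1 \<Longrightarrow> a' \<in> A1 \<Longrightarrow> \<phi>1 (a * a') = \<phi>1 a * \<phi>1 a'"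
    and mult2: "\<And>b b'. b \<in> A2 \<Longrightarrow> b' \<in> A2 \<Longrightarrow> \<phi>2 (b * b') = \<phi>2 b * \<phi>2 b'"
  shows "tensor A1 A2 \<phi>1 \<phi>2 z r \<Longrightarrow> tensor A1 A2 \<phi>1 \<phi>2 z' r' \<Longrightarrow> tensor A1 A2 \<phi>1 \<phi>2 (z * z') (r * r')"
proof (induction rule: tensor.induct)
  case (tensor_prod a b)
  from tensor_prod(3) show ?case
  proof (induction rule: tensor.induct)
    case (tensor_prod a' b')
    have "tensor A1 A2 \<phi>1 \<phi>2 ((a * a') * (b * b')) (\<phi>1 (a * a') * \<phi>2 (b * b'))"
      by (intro tensor.tensor_prod subalg_mult A tensor_prod \<open>a \<in> A1\<close> \<open>b \<in> A2\<close>)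
    then show ?case
      using mult1[OF \<open>a \<in> A1\<close> tensor_prod(1)] mult2[OF \<open>b \<in> A2\<close> tensor_prod(2)] by (simp add: mult_ac)
  next
    case (tensor_add z r z' r')
    then show ?case using tensor.tensor_add by (fastforce simp: distrib_left)
  qed
next
  case (tensor_add z r y s)
  then show ?case using tensor.tensor_add by (fastforce simp: distrib_right)
qed

lemma tensor_subalg:
  assumes A: "subalg A1" "subalg A2"
    and mult1: "\<And>a a'. a \<in> A1 \<Longrightarrow> a' \<in> A1 \<Longrightarrow> \<phi>1 (a * a') = \<phi>1 a * \<phi>1 a'"
    and mult2: "\<And>b b'. b \<in> A2 \<Longrightarrow> b' \<in> A2 \<Longrightarrow> \<phi>2 (b * b') = \<phi>2 b * \<phi>2 b'"
  shows "subalg {z. \<exists>r. tensor A1 A2 \<phi>1 \<phi>2 z r}" "A1 \<union> A2 \<subseteq> {z. \<exists>r. tensor A1 A2 \<phi>1 \<phi>2 z r}"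
proof -
  have left: "tensor A1 A2 \<phi>1 \<phi>2 a (\<phi>1 a * \<phi>2 1)" if "a \<in> A1" for a
    using tensor_prod[OF that subalg_1[OF A(2)], of \<phi>1 \<phi>2] by simp
  have right: "tensor A1 A2 \<phi>1 \<phi>2 b (\<phi>1 1 * \<phi>2 b)" if "b \<in> A2" for b
    using tensor_prod[OF subalg_1[OF A(1)] that, of \<phi>1 \<phi>2] by simp
  show "A1 \<union> A2 \<subseteq> {z. \<exists>r. tensor A1 A2 \<phi>1 \<phi>2 z r}" using left right by blast
  show "subalg {z. \<exists>r. tensor A1 A2 \<phi>1 \<phi>2 z r}"
    unfolding subalg_def
  proof (intro conjI ballI)
    show "range of_real \<subseteq> {z. \<exists>r. tensor A1 A2 \<phi>1 \<phi>2 z r}" using left subalg_of_real[OF A(1)] by blast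
    fix x y assume "x \<in> {z. \<exists>r. tensor A1 A2 \<phi>1 \<phi>2 z r}" "y \<in> {z. \<exists>r. tensor A1 A2 \<phi>1 \<phi>2 z r}"
    then obtain r s where rs: "tensor A1 A2 \<phi>1 \<phi>2 x r" "tensor A1 A2 \<phi>1 \<phi>2 y s" by blast
    show "x + y \<in> {z. \<exists>r. tensor A1 A2 \<phi>1 \<phi>2 z r}" using tensor_add[OF rs] by blast
    show "x * y \<in> {z. \<exists>r. tensor A1 A2 \<phi>1 \<phi>2 z r}" using tensor_mult[OF A mult1 mult2 rs] by blast
  qed
qed

lemma tensor_list:
  "tensor A1 A2 \<phi>1 \<phi>2 z r \<Longrightarrow> \<exists>ps. set ps \<subseteq> A1 \<times> A2 \<and> z = sum_list (map (\<lambda>p. fst p * snd p) ps) \<and>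
    r = sum_list (map (\<lambda>p. \<phi>1 (fst p) * \<phi>2 (snd p)) ps)"
proof (induction rule: tensor.induct)
  case (tensor_prod a b)
  then show ?case by (intro exI[of _ "[(a, b)]"]) auto
next
  case (tensor_add z r z' r')
  then obtain ps qs where "set ps \<subseteq> A1 \<times> A2" "z = sum_list (map (\<lambda>p. fst p * snd p) ps)"
    "r = sum_list (map (\<lambda>p. \<phi>1 (fst p) * \<phi>2 (snd p)) ps)" "set qs \<subseteq> A1 \<times> A2"
    "z' = sum_list (map (\<lambda>p. fst p * snd p) qs)" "r' = sum_list (map (\<lambda>p. \<phi>1 (fst p) * \<phi>2 (snd p)) qs)"
    by blast
  then show ?case by (intro exI[of _ "ps @ qs"]) auto
qed

lemma basis_expansion:
  fixes V :: "'a::real_vector set"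
  assumes "finite V"
  obtains E l where "finite E" "E \<subseteq> V" "independent E" "\<And>v. v \<in> V \<Longrightarrow> v = (\<Sum>e\<in>E. l v e *\<^sub>R e)"
proof -
  obtain E where E: "E \<subseteq> V" "independent E" "V \<subseteq> span E"
    using maximal_independent_subset by blast
  then have fin: "finite E" using assms finite_subset by blast
  have "\<exists>l. v = (\<Sum>e\<in>E. l e *\<^sub>R e)" if "v \<in> V" for v
    using E(3) that span_finite[OF fin] by auto
  then obtain l where "\<And>v. v \<in> V \<Longrightarrow> v = (\<Sum>e\<in>E. l v e *\<^sub>R e)" by metis
  then show ?thesis using that E fin by blast
qed

text \<open>The first factors are expressed through a subset of them that is linearly independent
  over the reals, the shape to which linear disjointness applies. For homomorphisms the value
  \<open>r\<close> can be rearranged in parallel.\<close>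

lemma tensor_expansion:
  assumes "tensor A1 A2 \<phi>1 \<phi>2 z r" and A: "subalg A1" "subalg A2"
  obtains E c where "finite E" "E \<subseteq> A1" "independent E" "\<And>e. e \<in> E \<Longrightarrow> c e \<in> A2" "z = (\<Sum>e\<in>E. c e * e)"
    "alg_hom A1 \<phi>1 \<Longrightarrow> alg_hom A2 \<phi>2 \<Longrightarrow> r = (\<Sum>e\<in>E. \<phi>2 (c e) * \<phi>1 e)"
proof -
  obtain ps where ps: "set ps \<subseteq> A1 \<times> A2" "z = sum_list (map (\<lambda>p. fst p * snd p) ps)"
    "r = sum_list (map (\<lambda>p. \<phi>1 (fst p) * \<phi>2 (snd p)) ps)" using tensor_list[OF assms(1)] by blast
  define I where "I = {..<length ps}"
  define a b where "a i = fst (ps ! i)" and "b i = snd (ps ! i)" for i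
  have ab: "a i \<in> A1" "b i \<in> A2" if "i \<in> I" for i
  proof -
    have "ps ! i \<in> A1 \<times> A2" using ps(1) nth_mem[of i ps] that by (auto simp: I_def simp del: nth_mem)
    then show "a i \<in> A1" "b i \<in> A2" by (simp_all add: a_def b_def mem_Times_iff)
  qed
  have z: "z = (\<Sum>i\<in>I. a i * b i)" and r: "r = (\<Sum>i\<in>I. \<phi>1 (a i) * \<phi>2 (b i))"
    unfolding ps(2,3) sum_list_sum_nth I_def a_def b_def by (simp_all add: atLeast0LessThan)
  obtain E l where E: "finite E" "E \<subseteq> a ` I" "independent E" "\<And>v. v \<in> a ` I \<Longrightarrow> v = (\<Sum>e\<in>E. l v e *\<^sub>R e)"
    using basis_expansion[of "a ` I"] by (auto simp: I_def)
  have a: "a i = (\<Sum>e\<in>E. of_real (l (a i) e) * e)" if "i \<in> I" for i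
    using E(4)[of "a i"] that by (simp add: scaleR_conv_of_real)
  have EA: "E \<subseteq> A1" using E(2) ab(1) by blast
  define c where "c e = (\<Sum>i\<in>I. of_real (l (a i) e) * b i)" for e
  show ?thesis
  proof (rule that[OF E(1) EA E(3)])
    show "c e \<in> A2" for e
      unfolding c_def by (intro subalg_sum[OF A(2)] subalg_mult[OF A(2)] subalg_of_real[OF A(2)] ab)
    have "z = (\<Sum>i\<in>I. (\<Sum>e\<in>E. of_real (l (a i) e) * e) * b i)"
      unfolding z by (intro sum.cong refl) (subst a, auto)
    also have "\<dots> = (\<Sum>i\<in>I. \<Sum>e\<in>E. of_real (l (a i) e) * b i * e)"
      by (simp add: sum_distrib_right sum_distrib_left mult_ac)
    also have "\<dots> = (\<Sum>e\<in>E. c e * e)"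
      unfolding c_def by (subst sum.swap) (simp add: sum_distrib_right)
    finally show "z = (\<Sum>e\<in>E. c e * e)" .
    assume hom: "alg_hom A1 \<phi>1" "alg_hom A2 \<phi>2"
    have \<phi>a: "\<phi>1 (a i) = (\<Sum>e\<in>E. l (a i) e * \<phi>1 e)" if "i \<in> I" for i
    proof -
      have "\<phi>1 (\<Sum>e\<in>E. of_real (l (a i) e) * e) = (\<Sum>e\<in>E. \<phi>1 (of_real (l (a i) e) * e))"
        by (rule alg_hom_sum[OF A(1) hom(1)]) (use EA subalg_mult[OF A(1) subalg_of_real[OF A(1)]] in blast)
      also have "\<dots> = (\<Sum>e\<in>E. l (a i) e * \<phi>1 e)"
        using EA alg_hom_mult[OF hom(1) subalg_of_real[OF A(1)]] alg_hom_of_real[OF hom(1)]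
        by (intro sum.cong refl) auto
      finally show ?thesis using a[OF that] by simp
    qed
    have \<phi>c: "\<phi>2 (c e) = (\<Sum>i\<in>I. l (a i) e * \<phi>2 (b i))" for e
    proof -
      have "\<phi>2 (c e) = (\<Sum>i\<in>I. \<phi>2 (of_real (l (a i) e) * b i))"
        unfolding c_def
        by (rule alg_hom_sum[OF A(2) hom(2)]) (use ab subalg_mult[OF A(2) subalg_of_real[OF A(2)]] in blast)
      also have "\<dots> = (\<Sum>i\<in>I. l (a i) e * \<phi>2 (b i))"
        using ab alg_hom_mult[OF hom(2) subalg_of_real[OF A(2)]] alg_hom_of_real[OF hom(2)]
        by (intro sum.cong refl) auto
      finally show ?thesis .
    qed
    have "r = (\<Sum>i\<in>I. \<Sum>e\<in>E. l (a i) e * \<phi>2 (b i) * \<phi>1 e)"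
      unfolding r by (intro sum.cong refl) (simp add: \<phi>a sum_distrib_right sum_distrib_left mult_ac)
    also have "\<dots> = (\<Sum>e\<in>E. \<phi>2 (c e) * \<phi>1 e)"
      unfolding \<phi>c by (subst sum.swap) (simp add: sum_distrib_right)
    finally show "r = (\<Sum>e\<in>E. \<phi>2 (c e) * \<phi>1 e)" .
  qed
qed

text \<open>A representation of 0 over an independent set has zero coefficients by linear
  disjointness, hence value 0; so \<open>tensor\<close> is a function. This is why points for the
  two fields may be chosen independently.\<close>

lemma alg_hom_compositum:
  assumes ld: "linearly_disjoint F1 F2" and A: "subalg A1" "A1 \<subseteq> F1" "subalg A2" "A2 \<subseteq> F2"
    and \<phi>: "alg_hom A1 \<phi>1" "alg_hom A2 \<phi>2"
  obtains B \<psi> where "subalg B" "A1 \<union> A2 \<subseteq> B" "alg_hom B \<psi>"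
    "\<And>a. a \<in> A1 \<Longrightarrow> \<psi> a = \<phi>1 a" "\<And>b. b \<in> A2 \<Longrightarrow> \<psi> b = \<phi>2 b"
proof -
  define P where "P = tensor A1 A2 \<phi>1 \<phi>2"
  have mult: "P (y * z) (r * s)" if "P y r" "P z s" for y z r s
    using tensor_mult[OF A(1,3), of \<phi>1 \<phi>2] alg_hom_mult[OF \<phi>(1)] alg_hom_mult[OF \<phi>(2)] that
    unfolding P_def by blast
  have add: "P (y + z) (r + s)" if "P y r" "P z s" for y z r s
    using that tensor_add unfolding P_def by metis
  have left: "P a (\<phi>1 a)" if "a \<in> A1" for a
    using tensor_prod[OF that subalg_1[OF A(3)], of \<phi>1 \<phi>2] alg_hom_1[OF \<phi>(2)] by (simp add: P_def)
  have right: "P b (\<phi>2 b)" if "b \<in> A2" for b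
    using tensor_prod[OF subalg_1[OF A(1)] that, of \<phi>1 \<phi>2] alg_hom_1[OF \<phi>(1)] by (simp add: P_def)
  have real: "P (of_real s) s" for s
    using left[OF subalg_of_real[OF A(1), of s]] alg_hom_of_real[OF \<phi>(1), of s] by simp
  have zero: "r = 0" if r: "P 0 r" for r
  proof -
    obtain E c where E: "finite E" "E \<subseteq> A1" "independent E" "\<And>e. e \<in> E \<Longrightarrow> c e \<in> A2"
      "0 = (\<Sum>e\<in>E. c e * e)" "r = (\<Sum>e\<in>E. \<phi>2 (c e) * \<phi>1 e)"
      by (rule tensor_expansion[OF r[unfolded P_def] A(1,3)]) (use \<phi> in blast)
    have "finite E \<and> E \<subseteq> F1 \<and> \<not> dependent E" using E A(2) by blast
    moreover have "(\<forall>e\<in>E. c e \<in> F2) \<and> (\<Sum>e\<in>E. c e * e) = 0" using E A(4) by auto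
    ultimately have "\<forall>e\<in>E. c e = 0" using ld unfolding linearly_disjoint_def by blast
    then show ?thesis using E(6) alg_hom_0[OF \<phi>(2)] by simp
  qed
  have uniq: "r = s" if "P z r" "P z s" for z r s
  proof -
    have "P (z + of_real (- 1) * z) (r + (- 1) * s)" by (intro add mult real that)
    then show ?thesis using zero[of "r + (- 1) * s"] by simp
  qed
  define \<psi> where "\<psi> z = (SOME r. P z r)" for z
  have \<psi>: "\<psi> z = r" if "P z r" for z r
    unfolding \<psi>_def using someI[of "P z", OF that] uniq that by blast
  define B where "B = {z. \<exists>r. P z r}"
  show ?thesis
  proof (rule that[of B \<psi>])
    show "A1 \<union> A2 \<subseteq> B" using left right by (auto simp: B_def)
    show "\<psi> a = \<phi>1 a" if "a \<in> A1" for a using \<psi> left that by blast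
    show "\<psi> b = \<phi>2 b" if "b \<in> A2" for b using \<psi> right that by blast
    show "subalg B" 
      unfolding subalg_def
    proof (intro conjI ballI subsetI)
      show "x \<in> B" if "x \<in> range of_real" for x using that real by (auto simp: B_def)
      fix y z assume "y \<in> B" "z \<in> B"
      then obtain r s where rs: "P y r" "P z s" by (auto simp: B_def)
      show "y + z \<in> B" "y * z \<in> B" using add[OF rs] mult[OF rs] by (auto simp: B_def)
    qed
    show "alg_hom B \<psi>"
      unfolding alg_hom_def
    proof (intro conjI allI ballI)
      show "\<psi> (of_real s) = s" for s using \<psi> real by blast
      fix y z assume "y \<in> B" "z \<in> B"
      then obtain r s where rs: "P y r" "P z s" by (auto simp: B_def)
      then show "\<psi> (y + z) = \<psi> y + \<psi> z" "\<psi> (y * z) = \<psi> y * \<psi> z"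
        using \<psi>[OF rs(1)] \<psi>[OF rs(2)] \<psi>[OF add[OF rs]] \<psi>[OF mult[OF rs]] by simp_all
    qed
  qed
qed

lemma alg_Un_expansion:
  assumes A: "subalg F1" "subalg F2" and z: "z \<in> alg (F1 \<union> F2)"
  obtains E c where "finite E" "E \<subseteq> F1" "independent E" "\<And>e. e \<in> E \<Longrightarrow> c e \<in> F2" "z = (\<Sum>e\<in>E. c e * e)"
proof -
  \<comment> \<open>Only the representation of \<open>z\<close> is wanted, so both value maps are
    set to 0.\<close>
  have "alg (F1 \<union> F2) \<subseteq> {z. \<exists>r. tensor F1 F2 (\<lambda>_. 0) (\<lambda>_. 0) z r}"
    by (rule alg_least) (use tensor_subalg[OF A, of "\<lambda>_. 0" "\<lambda>_. 0"] in simp_all)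
  then obtain r where "tensor F1 F2 (\<lambda>_. 0) (\<lambda>_. 0) z r" using z by blast
  from tensor_expansion[OF this A] show ?thesis using that by metis
qed

section \<open>Fibres of the restriction map\<close>

text \<open>Compactness with three kinds of conditions: positivity on \<open>P1\<close>, positivity
  on \<open>P2\<close>, and \<open>|t1 / t2 - c| < \<epsilon>\<close>. Artin--Lang gives points of
  the two factors at which \<open>t1\<close> and \<open>t2\<close> take the values
  \<open>c * \<sigma>\<close> and \<open>\<sigma>\<close>. The first point is then moved slightly to
  keep the common denominator \<open>D\<close> from vanishing, which does not disturb the finitely
  many strict conditions.\<close>

lemma joint_ordering:
  assumes F1: "field_ordering F1 P1" "pos_infinitesimal F1 P1 t1"
    and F2: "field_ordering F2 P2" "pos_infinitesimal F2 P2 t2"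
    and ld: "linearly_disjoint F1 F2" and c: "c > 0"
  obtains T where "field_ordering (field_gen (F1 \<union> F2)) T" "P1 \<subseteq> T" "P2 \<subseteq> T" "infinitely_near T (t1 / t2) c"
proof -
  interpret F1: ordered_R_field F1 P1 by unfold_locales (rule F1)
  interpret F2: ordered_R_field F2 P2 by unfold_locales (rule F2)
  define F where "F = field_gen (F1 \<union> F2)"
  have F: "is_R_subfield F" "F1 \<subseteq> F" "F2 \<subseteq> F"
    using field_gen_R_subfield field_gen_superset[of "F1 \<union> F2"] by (auto simp: F_def)
  note sF = subalg_R_subfield[OF F(1)]
  have t: "t1 \<in> F1" "t2 \<in> F2" using F1(2) F2(2) by (auto simp: pos_infinitesimal_def)
  have t12: "t1 / t2 \<in> F" using R_subfield_divide[OF F(1)] t F(2,3) by blast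
  define N3 where "N3 = {of_real \<epsilon> - (t1 / t2 - of_real c) |\<epsilon>. \<epsilon> > 0} \<union> {of_real \<epsilon> + (t1 / t2 - of_real c) |\<epsilon>. \<epsilon> > 0}"
  define N where "N = (P1 - {0}) \<union> (P2 - {0}) \<union> N3"
  have "N3 \<subseteq> F"
    using subalg_diff[OF sF] subalg_add[OF sF] subalg_of_real[OF sF] t12 by (auto simp: N3_def)
  moreover have "P1 \<subseteq> F" by (intro subsetI subsetD[OF F(2)] F1.T_sub)
  moreover have "P2 \<subseteq> F" by (intro subsetI subsetD[OF F(3)] F2.T_sub)
  ultimately have NF: "N \<subseteq> F" by (auto simp: N_def)
  have sat: "\<exists>B \<psi>. subalg B \<and> S \<subseteq> B \<and> alg_hom B \<psi> \<and> (\<forall>n\<in>N'. \<psi> n > 0)"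
    if N': "finite N'" "N' \<subseteq> N" and S: "finite S" "S \<subseteq> F" for N' S
  proof -
    have "\<exists>n\<in>alg (F1 \<union> F2). \<exists>m\<in>alg (F1 \<union> F2). m \<noteq> 0 \<and> s = n / m" if "s \<in> S" for s
      by (rule field_gen_fraction) (use S(2) that in \<open>auto simp: F_def\<close>)
    then obtain n m where nm: "\<And>s. s \<in> S \<Longrightarrow> n s \<in> alg (F1 \<union> F2) \<and> m s \<in> alg (F1 \<union> F2) \<and> m s \<noteq> 0 \<and> s = n s / m s"
      by metis
    have W: "finite (n ` S \<union> m ` S)" "n ` S \<union> m ` S \<subseteq> alg (F1 \<union> F2)" using S(1) nm by auto
    obtain Y where Y: "finite Y" "Y \<subseteq> F1 \<union> F2" "n ` S \<union> m ` S \<subseteq> alg Y"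
      by (rule finite_subset_alg_finitary[OF W])
    define D where "D = prod m S"
    have D: "D \<in> alg (F1 \<union> F2)" "D \<noteq> 0" "D \<in> alg Y"
      unfolding D_def using nm S(1) Y(3) by (auto intro!: subalg_prod[OF subalg_alg])
    obtain E f where E: "finite E" "E \<subseteq> F1" "independent E" "\<And>e. e \<in> E \<Longrightarrow> f e \<in> F2" "D = (\<Sum>e\<in>E. f e * e)"
      by (rule alg_Un_expansion[OF F1.sub F2.sub D(1)]) (rule that; simp)
    have "\<exists>e\<in>E. f e \<noteq> 0"
    proof (rule ccontr)
      assume "\<not> ?thesis"
      then have "(\<Sum>e\<in>E. f e * e) = 0" by (intro sum.neutral) auto
      then show False using E(5) D(2) by (simp only:)
    qed
    then obtain e0 where e0: "e0 \<in> E" "f e0 \<noteq> 0" by (rule bexE)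
    define Q1 Q2 where "Q1 = N' \<inter> P1 - {0}" and "Q2 = N' \<inter> P2 - {0}"
    define G1 where "G1 = insert t1 ((Y \<inter> F1) \<union> Q1 \<union> E)"
    define G2 where "G2 = insert t2 ((Y \<inter> F2) \<union> Q2 \<union> f ` E)"
    have fin: "finite G1" "finite G2" "finite Q1" "finite Q2"
      using Y(1) N'(1) E(1) by (auto simp: G1_def G2_def Q1_def Q2_def)
    have G: "G1 \<subseteq> F1" "G2 \<subseteq> F2"
      using t E F1.T_sub F2.T_sub by (auto simp: G1_def G2_def Q1_def Q2_def)
    define A1 A2 where "A1 = alg G1" and "A2 = alg G2"
    have A: "subalg A1" "subalg A2" "A1 \<subseteq> F1" "A2 \<subseteq> F2"
      unfolding A1_def A2_def using subalg_alg alg_least[OF F1.sub G(1)] alg_least[OF F2.sub G(2)] by auto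
    have "G1 \<subseteq> A1" "G2 \<subseteq> A2" unfolding A1_def A2_def by (rule alg_superset)+
    then have mem: "t1 \<in> A1" "Q1 \<subseteq> A1" "E \<subseteq> A1" "Y \<inter> F1 \<subseteq> A1" "t2 \<in> A2" "Q2 \<subseteq> A2" "f ` E \<subseteq> A2" "Y \<inter> F2 \<subseteq> A2"
      by (auto simp: G1_def G2_def)
    \<comment> \<open>A point at which \<open>d\<close> does not vanish is central, so it can be
      moved later.\<close>
    obtain d where d: "d \<in> A1" "d \<noteq> 0" "\<And>\<phi>. alg_hom A1 \<phi> \<Longrightarrow> \<phi> d \<noteq> 0 \<Longrightarrow> central A1 \<phi>"
      using generic_homs_central[OF fin(1)] unfolding A1_def by blast
    have "good P1 t1 A1" "good P2 t2 A2"
      unfolding A1_def A2_def G1_def G2_def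
      by (rule artin_lang[OF F1], use fin(1) G(1) in \<open>simp_all add: G1_def\<close>)
        (rule artin_lang[OF F2], use fin(2) G(2) in \<open>simp_all add: G2_def\<close>)
    then have ev: "\<forall>\<^sub>F \<tau> in at_right 0. \<exists>\<phi>. alg_hom A1 \<phi> \<and> \<phi> t1 = \<tau> \<and> (\<forall>s\<in>insert d Q1. sgn (\<phi> s) = sg P1 s)"
      "\<forall>\<^sub>F \<sigma> in at_right 0. \<exists>\<phi>. alg_hom A2 \<phi> \<and> \<phi> t2 = \<sigma> \<and> (\<forall>s\<in>insert (f e0) Q2. sgn (\<phi> s) = sg P2 s)"
      using goodD[of P1 t1 A1 "insert d Q1"] goodD[of P2 t2 A2 "insert (f e0) Q2"] fin d(1) mem e0(1) by auto
    obtain b1 where b1: "b1 > 0" "\<And>\<tau>. 0 < \<tau> \<Longrightarrow> \<tau> < b1 \<Longrightarrow>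
      \<exists>\<phi>. alg_hom A1 \<phi> \<and> \<phi> t1 = \<tau> \<and> (\<forall>s\<in>insert d Q1. sgn (\<phi> s) = sg P1 s)"
      using ev(1) eventually_at_right[of "0::real" 1] by auto
    obtain b2 where b2: "b2 > 0" "\<And>\<sigma>. 0 < \<sigma> \<Longrightarrow> \<sigma> < b2 \<Longrightarrow>
      \<exists>\<phi>. alg_hom A2 \<phi> \<and> \<phi> t2 = \<sigma> \<and> (\<forall>s\<in>insert (f e0) Q2. sgn (\<phi> s) = sg P2 s)"
      using ev(2) eventually_at_right[of "0::real" 1] by auto
    \<comment> \<open>The bound \<open>b1 / c\<close> is there to give
      \<open>c * \<sigma> < b1\<close>; halving makes the inequalities strict.\<close>
    define \<mu> \<sigma> where "\<mu> = min (b1 / c) b2" and "\<sigma> = \<mu> / 2"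
    have "\<mu> > 0" using b1(1) b2(1) c by (simp add: \<mu>_def)
    then have \<sigma>0: "\<sigma> > 0" "\<sigma> < \<mu>" by (simp_all add: \<sigma>_def)
    have "\<mu> \<le> b2" "\<mu> \<le> b1 / c" by (simp_all add: \<mu>_def)
    then have \<sigma>: "\<sigma> > 0" "\<sigma> < b2" "\<sigma> < b1 / c"
      using \<sigma>0 by (auto intro: less_le_trans)
    then have "0 < c * \<sigma>" "c * \<sigma> < b1" using c by (simp_all add: pos_less_divide_eq mult.commute)
    then obtain \<phi>1 where \<phi>1: "alg_hom A1 \<phi>1" "\<phi>1 t1 = c * \<sigma>" "\<And>s. s \<in> insert d Q1 \<Longrightarrow> sgn (\<phi>1 s) = sg P1 s"
      using b1(2) by blast
    obtain \<phi>2 where \<phi>2: "alg_hom A2 \<phi>2" "\<phi>2 t2 = \<sigma>" "\<And>s. s \<in> insert (f e0) Q2 \<Longrightarrow> sgn (\<phi>2 s) = sg P2 s"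
      using b2(2)[OF \<sigma>(1,2)] by blast
    have "sg P1 d \<noteq> 0" "sg P2 (f e0) \<noteq> 0" using d(2) e0(2) by simp_all
    then have \<phi>_nz: "\<phi>1 d \<noteq> 0" "\<phi>2 (f e0) \<noteq> 0" using \<phi>1(3)[of d] \<phi>2(3)[of "f e0"] by auto
    have pos1: "\<phi>1 q > 0" if "q \<in> Q1" for q
      using \<phi>1(3)[of q] that by (simp add: Q1_def sg_def sgn_1_pos)
    have pos2: "\<phi>2 q > 0" if "q \<in> Q2" for q
      using \<phi>2(3)[of q] that by (simp add: Q2_def sg_def sgn_1_pos)
    \<comment> \<open>This is \<open>D\<close> with the second factor already evaluated. It is
      nonzero because \<open>E\<close> is independent over the reals and its coefficient
      \<open>\<phi>2 (f e0)\<close> is nonzero; its value at the moved first point is the value of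
      \<open>D\<close> at the joint point.\<close>
    define D' where "D' = (\<Sum>e\<in>E. of_real (\<phi>2 (f e)) * e)"
    have D': "D' \<in> A1"
      unfolding D'_def using mem(3) by (intro subalg_sum[OF A(1)] subalg_mult[OF A(1)] subalg_of_real[OF A(1)]) auto
    have "D' \<noteq> 0"
    proof
      assume "D' = 0"
      then have "(\<Sum>e\<in>E. \<phi>2 (f e) *\<^sub>R e) = 0" by (simp add: D'_def scaleR_conv_of_real)
      then have "\<phi>2 (f e0) = 0" by (rule independentD[OF E(3,1) subset_refl _ e0(1), where u = "\<lambda>e. \<phi>2 (f e)"])
      then show False using \<phi>_nz(2) by simp
    qed
    then obtain \<phi>s where \<phi>s: "\<forall>\<^sub>F k in sequentially. alg_hom A1 (\<phi>s k) \<and> \<phi>s k D' \<noteq> 0"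
      "\<And>a. a \<in> A1 \<Longrightarrow> (\<lambda>k. \<phi>s k a) \<longlonglongrightarrow> \<phi>1 a"
      using d(3)[OF \<phi>1(1) \<phi>_nz(1)] D' unfolding central_def by meson
    \<comment> \<open>The joint point is built only after \<open>k\<close> is fixed, so the
      estimates that hold for large \<open>k\<close> are stated for every homomorphism that extends
      the \<open>k\<close>-th pair.\<close>
    define ext where "ext k B \<psi> \<longleftrightarrow> subalg B \<and> alg_hom B \<psi> \<and> A1 \<subseteq> B \<and> A2 \<subseteq> B \<and> t1 / t2 \<in> B \<and>
      (\<forall>a\<in>A1. \<psi> a = \<phi>s k a) \<and> (\<forall>a\<in>A2. \<psi> a = \<phi>2 a)" for k B \<psi>
    have near: "\<forall>\<^sub>F k in sequentially. \<bar>\<phi>s k t1 / \<sigma> - c\<bar> < \<epsilon>" if "\<epsilon> > 0" for \<epsilon>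
    proof -
      have "(\<lambda>k. \<phi>s k t1 / \<sigma>) \<longlonglongrightarrow> \<phi>1 t1 / \<sigma>" using \<sigma>(1) by (intro tendsto_divide \<phi>s(2) mem) auto
      then have "(\<lambda>k. \<phi>s k t1 / \<sigma>) \<longlonglongrightarrow> c" using \<phi>1(2) \<sigma>(1) by simp
      from tendstoD[OF this that] show ?thesis by (simp add: dist_real_def)
    qed
    have quot: "\<psi> (t1 / t2) = \<phi>s k t1 / \<sigma>" if "ext k B \<psi>" for k B \<psi>
    proof -
      have "t2 \<noteq> 0" using \<phi>2(2) \<sigma>(1) alg_hom_0[OF \<phi>2(1)] by auto
      then have "\<psi> (t1 / t2) * \<psi> t2 = \<psi> t1"
        using that mem(5) alg_hom_mult[of B \<psi> "t1 / t2" t2] unfolding ext_def by auto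
      then show ?thesis using that mem(1,5) \<phi>2(2) \<sigma>(1) unfolding ext_def by (simp add: eq_divide_eq)
    qed
    have "\<forall>\<^sub>F k in sequentially. \<forall>n\<in>N'. \<forall>B \<psi>. ext k B \<psi> \<longrightarrow> \<psi> n > 0"
    proof (rule eventually_ball_finite[OF N'(1)], intro ballI)
      fix n assume n: "n \<in> N'"
      then consider "n \<in> Q1" | "n \<in> Q2" | "n \<in> N3" using N'(2) unfolding N_def Q1_def Q2_def by blast
      then show "\<forall>\<^sub>F k in sequentially. \<forall>B \<psi>. ext k B \<psi> \<longrightarrow> \<psi> n > 0"
      proof cases
        case 1
        then have nA: "n \<in> A1" using mem(2) by blast
        show ?thesis
          using order_tendstoD(1)[OF \<phi>s(2)[OF nA] pos1[OF 1]]
          by eventually_elim (use nA in \<open>auto simp: ext_def\<close>)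
      next
        case 2
        then show ?thesis using pos2[OF 2] mem(6) by (intro always_eventually) (auto simp: ext_def)
      next
        case 3
        then obtain \<epsilon> where \<epsilon>: "\<epsilon> > 0"
          "n = of_real \<epsilon> - (t1 / t2 - of_real c) \<or> n = of_real \<epsilon> + (t1 / t2 - of_real c)"
          unfolding N3_def by blast
        show ?thesis
          using near[OF \<epsilon>(1)]
        proof eventually_elim
          case (elim k)
          show ?case
          proof (intro allI impI)
            fix B \<psi> assume ext: "ext k B \<psi>"
            then have B: "subalg B" "alg_hom B \<psi>" "t1 / t2 \<in> B" by (auto simp: ext_def)
            have r: "of_real r \<in> B" for r using subalg_of_real[OF B(1)] .
            have diff: "t1 / t2 - of_real c \<in> B" using subalg_diff[OF B(1,3) r] .
            have "\<psi> (t1 / t2 - of_real c) = \<phi>s k t1 / \<sigma> - c"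
              using alg_hom_diff[OF B r] alg_hom_of_real[OF B(2)] quot[OF ext] by simp
            then have "\<psi> n = \<epsilon> - (\<phi>s k t1 / \<sigma> - c) \<or> \<psi> n = \<epsilon> + (\<phi>s k t1 / \<sigma> - c)"
              using \<epsilon>(2) alg_hom_diff[OF B(1,2) r diff] alg_hom_add[OF B(2) r diff] alg_hom_of_real[OF B(2)]
              by auto
            then show "\<psi> n > 0" using elim by auto
          qed
        qed
      qed
    qed
    with \<phi>s(1) have "\<forall>\<^sub>F k in sequentially. (alg_hom A1 (\<phi>s k) \<and> \<phi>s k D' \<noteq> 0) \<and>
      (\<forall>n\<in>N'. \<forall>B \<psi>. ext k B \<psi> \<longrightarrow> \<psi> n > 0)"
      by (rule eventually_conj)
    then obtain k where k: "alg_hom A1 (\<phi>s k)" "\<phi>s k D' \<noteq> 0" "\<And>n B \<psi>. n \<in> N' \<Longrightarrow> ext k B \<psi> \<Longrightarrow> \<psi> n > 0"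
      using eventually_happens'[OF sequentially_bot] by blast
    obtain B0 \<psi>0 where B0: "subalg B0" "A1 \<union> A2 \<subseteq> B0" "alg_hom B0 \<psi>0"
      "\<And>a. a \<in> A1 \<Longrightarrow> \<psi>0 a = \<phi>s k a" "\<And>b. b \<in> A2 \<Longrightarrow> \<psi>0 b = \<phi>2 b"
      by (rule alg_hom_compositum[OF ld A(1,3,2,4) k(1) \<phi>2(1)]) blast
    have "Y \<subseteq> B0" using Y(2) mem(4,8) B0(2) by blast
    then have YB: "alg Y \<subseteq> B0" by (rule alg_least[OF B0(1)])
    have EB: "e \<in> B0 \<and> f e \<in> B0 \<and> \<psi>0 e = \<phi>s k e \<and> \<psi>0 (f e) = \<phi>2 (f e)" if "e \<in> E" for e
      using that mem(3,7) B0(2,4,5) by auto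
    have "\<psi>0 D = (\<Sum>e\<in>E. \<phi>2 (f e) * \<phi>s k e)"
    proof -
      have "\<psi>0 D = (\<Sum>e\<in>E. \<psi>0 (f e * e))"
        unfolding E(5) using EB by (intro alg_hom_sum[OF B0(1,3)] subalg_mult[OF B0(1)]) auto
      also have "\<dots> = (\<Sum>e\<in>E. \<phi>2 (f e) * \<phi>s k e)"
        using EB alg_hom_mult[OF B0(3)] by (intro sum.cong refl) auto
      finally show ?thesis .
    qed
    also have "\<dots> = \<phi>s k D'"
    proof -
      have "\<phi>s k D' = (\<Sum>e\<in>E. \<phi>s k (of_real (\<phi>2 (f e)) * e))"
        unfolding D'_def using mem(3)
        by (intro alg_hom_sum[OF A(1) k(1)] subalg_mult[OF A(1)] subalg_of_real[OF A(1)]) auto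
      also have "\<dots> = (\<Sum>e\<in>E. \<phi>2 (f e) * \<phi>s k e)"
        using mem(3) alg_hom_mult[OF k(1) subalg_of_real[OF A(1)]] alg_hom_of_real[OF k(1)]
        by (intro sum.cong refl) auto
      finally show ?thesis by simp
    qed
    finally have \<psi>D: "\<psi>0 (prod m S) \<noteq> 0" using k(2) by (simp add: D_def)
    obtain B \<psi> where B: "subalg B" "B0 \<subseteq> B" "alg_hom B \<psi>" "\<And>a. a \<in> B0 \<Longrightarrow> \<psi> a = \<psi>0 a"
      "\<And>n m. n \<in> B0 \<Longrightarrow> m \<in> B0 \<Longrightarrow> \<psi>0 m \<noteq> 0 \<Longrightarrow> n / m \<in> B"
      by (rule alg_hom_fractions[OF B0(1,3)]) blast
    have mB: "n s \<in> B0 \<and> m s \<in> B0" if "s \<in> S" for s using Y(3) YB that by blast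
    have "S \<subseteq> B"
    proof
      fix s assume s: "s \<in> S"
      have "\<psi>0 (m s) \<noteq> 0" by (rule alg_hom_prod_nonzero[OF B0(1,3) S(1) _ \<psi>D s]) (use mB in blast)
      then show "s \<in> B" using B(5)[of "n s" "m s"] mB[OF s] nm[OF s] by metis
    qed
    moreover have "ext k B \<psi>"
      unfolding ext_def
    proof (intro conjI ballI)
      have "\<psi>0 t2 \<noteq> 0" using B0(5)[OF mem(5)] \<phi>2(2) \<sigma>(1) by simp
      then show "t1 / t2 \<in> B" using B(5)[of t1 t2] mem(1,5) B0(2) by blast
    qed (use B B0 in auto)
    ultimately show ?thesis using B(1,3) k(3) by blast
  qed
  obtain T where T: "field_ordering F T" "\<And>n. n \<in> N \<Longrightarrow> lt T 0 n"
    by (rule ordering_compactness[OF F(1) NF sat]) (assumption+, blast)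
  interpret T: ordered_R_field F T by unfold_locales (rule T)
  show ?thesis
  proof (rule that[of T])
    show "field_ordering (field_gen (F1 \<union> F2)) T" using T(1) by (simp add: F_def)
    have "x \<in> T" if "x \<in> P1 \<or> x \<in> P2" for x
      using T(2)[of x] that T.T_0 by (cases "x = 0") (auto simp: N_def lt_def)
    then show "P1 \<subseteq> T" "P2 \<subseteq> T" by auto
    have N3: "lt T 0 n" if "n \<in> N3" for n using T(2) that by (simp add: N_def)
    show "infinitely_near T (t1 / t2) c"
      unfolding infinitely_near_def using N3 unfolding N3_def by blast
  qed
qed

text \<open>A place above \<open>(\<zeta>1, \<zeta>2)\<close> is known only on the algebra generated
  by elements of the two fields with finite value. Each \<open>b\<close> is therefore written as a
  fraction over such an algebra, and the point is chosen so that numerator and denominator have the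
  same nonzero sign.\<close>

lemma basic_open_contains_fibre:
  fixes F1 F2 :: "'a::real_field set"
  assumes ff: "function_field F1" "function_field F2" and td: "trdeg_ge_1 F1" "trdeg_ge_1 F2"
    and ld: "linearly_disjoint F1 F2" and F: "F = field_gen (F1 \<union> F2)"
    and \<xi>: "\<xi> \<in> M F" "finite B" "B \<subseteq> F" "\<forall>b\<in>B. \<xi> \<in> H' F b"
  shows "\<exists>\<zeta>1\<in>M F1. \<exists>\<zeta>2\<in>M F2.
    (\<forall>b\<in>B. \<forall>\<zeta>\<in>M F. rho F1 F2 \<zeta> = (\<zeta>1, \<zeta>2) \<longrightarrow> \<zeta> \<in> H' F b) \<and>
    infinite {\<zeta> \<in> M F. rho F1 F2 \<zeta> = (\<zeta>1, \<zeta>2)}"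
proof -
  obtain S1 S2 where S: "finite S1" "S1 \<subseteq> F1" "F1 = field_gen S1" "finite S2" "S2 \<subseteq> F2" "F2 = field_gen S2"
    and R: "is_R_subfield F1" "is_R_subfield F2"
    using ff unfolding function_field_def by blast
  have FR: "is_R_subfield F" "F1 \<subseteq> F" "F2 \<subseteq> F"
    using field_gen_R_subfield field_gen_superset[of "F1 \<union> F2"] by (auto simp: F)
  note sF = subalg_R_subfield[OF FR(1)]
  have trans: "\<exists>x\<in>K. x \<notin> range of_real" if K: "trdeg_ge_1 K" for K :: "'a set"
  proof -
    obtain x where x: "x \<in> K" "R_transcendental x" using K unfolding trdeg_ge_1_def by blast
    have "x \<notin> range of_real"
    proof
      assume "x \<in> range of_real"
      then obtain r where "x = of_real r" by blast
      then have "poly (map_poly of_real [:- r, 1:]) x = 0" by (simp add: map_poly_pCons)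
      then show False using x(2) unfolding R_transcendental_def by fastforce
    qed
    then show ?thesis using x(1) by blast
  qed
  obtain x1 where x1: "x1 \<in> F1" "x1 \<notin> range of_real" using trans[OF td(1)] by blast
  obtain x2 where x2: "x2 \<in> F2" "x2 \<notin> range of_real" using trans[OF td(2)] by blast
  have \<xi>p: "is_place F \<xi>" using \<xi>(1) by (simp add: M_def)
  obtain P where P: "field_ordering F P"
    "{a * (x * x) |a x. a \<in> F \<and> x \<in> F \<and> (\<exists>r>0. \<xi> a = Some r)} \<subseteq> P"
    by (rule precone_ordering[OF place_precone[OF \<xi>p FR(1)]])
  interpret P: ordered_R_field F P by unfold_locales (rule P)
  have Bpos: "sg P b = 1" if b: "b \<in> B" for b
  proof -
    obtain r where r: "\<xi> b = Some r" "r > 0" using bspec[OF \<xi>(4) b] by (auto simp: H'_def)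
    have "b * (1 * 1) \<in> P" using P(2) \<xi>(3) b r subalg_1[OF sF] by blast
    moreover have "b \<noteq> 0" using r place_zero[OF \<xi>p subalg_0[OF sF]] by auto
    ultimately show ?thesis by (simp add: sg_def)
  qed
  obtain t where t: "pos_infinitesimal F P t"
    by (rule exists_pos_infinitesimal[OF P(1) subsetD[OF FR(2) x1(1)] x1(2)])
  have "\<exists>n\<in>alg (F1 \<union> F2). \<exists>m\<in>alg (F1 \<union> F2). m \<noteq> 0 \<and> b = n / m" if "b \<in> B" for b
    by (rule field_gen_fraction) (use \<xi>(3) that in \<open>auto simp: F\<close>)
  then obtain n m where nm: "\<And>b. b \<in> B \<Longrightarrow> n b \<in> alg (F1 \<union> F2) \<and> m b \<in> alg (F1 \<union> F2) \<and> m b \<noteq> 0 \<and> b = n b / m b"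
    by metis
  have W: "finite (n ` B \<union> m ` B)" "n ` B \<union> m ` B \<subseteq> alg (F1 \<union> F2)" using \<xi>(2) nm by auto
  obtain Y where Y: "finite Y" "Y \<subseteq> F1 \<union> F2" "n ` B \<union> m ` B \<subseteq> alg Y"
    by (rule finite_subset_alg_finitary[OF W])
  \<comment> \<open>\<open>S1\<close> and \<open>S2\<close> ensure that \<open>G1\<close> and
    \<open>G2\<close> generate the whole fields, so that the central points give orderings of
    \<open>F1\<close> and \<open>F2\<close>. The parts of \<open>Y\<close> bring the numerators and
    denominators into the joint algebra.\<close>
  define G1 G2 where "G1 = (Y \<inter> F1) \<union> S1" and "G2 = (Y \<inter> F2) \<union> S2"
  have G: "finite G1" "finite G2" "G1 \<subseteq> F1" "G2 \<subseteq> F2" using Y S by (auto simp: G1_def G2_def)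
  have gen: "field_gen G1 = F1" "field_gen G2 = F2"
    using field_gen_least[OF R(1) G(3)] field_gen_least[OF R(2) G(4)]
      field_gen_least[OF field_gen_R_subfield, of S1 G1] field_gen_least[OF field_gen_R_subfield, of S2 G2]
      field_gen_superset[of G1] field_gen_superset[of G2] S(3,6) by (auto simp: G1_def G2_def)
  define A where "A = alg (insert t (G1 \<union> G2))"
  have A: "subalg A" unfolding A_def by (rule subalg_alg)
  have sub: "alg G1 \<subseteq> A" "alg G2 \<subseteq> A" "alg Y \<subseteq> A"
    unfolding A_def using Y(2) by (auto intro!: alg_mono simp: G1_def G2_def)
  obtain d1 where d1: "d1 \<in> alg G1" "d1 \<noteq> 0" "\<And>\<phi>. alg_hom (alg G1) \<phi> \<Longrightarrow> \<phi> d1 \<noteq> 0 \<Longrightarrow> central (alg G1) \<phi>"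
    using generic_homs_central[OF G(1)] by blast
  obtain d2 where d2: "d2 \<in> alg G2" "d2 \<noteq> 0" "\<And>\<phi>. alg_hom (alg G2) \<phi> \<Longrightarrow> \<phi> d2 \<noteq> 0 \<Longrightarrow> central (alg G2) \<phi>"
    using generic_homs_central[OF G(2)] by blast
  \<comment> \<open>\<open>d1\<close> and \<open>d2\<close> make both components central; the signs
    of numerators and denominators carry the positivity of the elements of \<open>B\<close>.\<close>
  define S where "S = {d1, d2} \<union> n ` B \<union> m ` B"
  have "good P t A" unfolding A_def by (rule artin_lang[OF P(1) t]) (use G FR in auto)
  moreover have "finite S \<and> S \<subseteq> A" using \<xi>(2) d1(1) d2(1) sub Y(3) by (auto simp: S_def)
  ultimately have "\<forall>\<^sub>F \<tau> in at_right 0. \<exists>\<phi>. alg_hom A \<phi> \<and> \<phi> t = \<tau> \<and> (\<forall>s\<in>S. sgn (\<phi> s) = sg P s)"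
    unfolding good_def by blast
  then obtain \<phi> where \<phi>: "alg_hom A \<phi>" "\<And>s. s \<in> S \<Longrightarrow> sgn (\<phi> s) = sg P s"
    using eventually_happens'[OF trivial_limit_at_right_real[of 0]] by blast
  have \<phi>d: "\<phi> d1 \<noteq> 0" "\<phi> d2 \<noteq> 0"
    using \<phi>(2)[of d1] \<phi>(2)[of d2] d1(2) d2(2) by (auto simp: S_def)
  have hom: "alg_hom (alg G1) \<phi>" "alg_hom (alg G2) \<phi>" using alg_hom_mono[OF \<phi>(1)] sub by auto
  obtain P1 where P1: "field_ordering F1 P1" "\<And>a. a \<in> alg G1 \<Longrightarrow> infinitely_near P1 a (\<phi> a)"
    by (rule ordering_at_central_point[OF hom(1) d1(3)[OF hom(1) \<phi>d(1)], unfolded gen]) blast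
  obtain P2 where P2: "field_ordering F2 P2" "\<And>a. a \<in> alg G2 \<Longrightarrow> infinitely_near P2 a (\<phi> a)"
    by (rule ordering_at_central_point[OF hom(2) d2(3)[OF hom(2) \<phi>d(2)], unfolded gen]) blast
  interpret P1: ordered_R_field F1 P1 by unfold_locales (rule P1)
  interpret P2: ordered_R_field F2 P2 by unfold_locales (rule P2)
  define \<zeta>1 \<zeta>2 where "\<zeta>1 = place_of F1 P1" and "\<zeta>2 = place_of F2 P2"
  have AG: "alg G1 \<subseteq> F1" "alg G2 \<subseteq> F2" using alg_least[OF P1.sub G(3)] alg_least[OF P2.sub G(4)] by auto
  have \<zeta>\<phi>: "\<zeta>1 a = Some (\<phi> a)" if "a \<in> alg G1" for a
    using P1(2)[OF that] AG that by (auto simp: \<zeta>1_def P1.place_of_eq_Some)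
  have \<zeta>\<phi>': "\<zeta>2 a = Some (\<phi> a)" if "a \<in> alg G2" for a
    using P2(2)[OF that] AG that by (auto simp: \<zeta>2_def P2.place_of_eq_Some)
  have over: "\<zeta> \<in> H' F b" if \<zeta>: "\<zeta> \<in> M F" "rho F1 F2 \<zeta> = (\<zeta>1, \<zeta>2)" and b: "b \<in> B" for \<zeta> b
  proof -
    have pl: "is_place F \<zeta>" using \<zeta>(1) by (simp add: M_def)
    have r: "restr F1 \<zeta> = \<zeta>1" "restr F2 \<zeta> = \<zeta>2" using \<zeta>(2) by (simp_all add: rho_def)
    have base: "\<zeta> a = Some (\<phi> a)" if "a \<in> alg G1 \<union> alg G2" for a
      using that r[THEN fun_cong, of a] \<zeta>\<phi>[of a] \<zeta>\<phi>'[of a] AG by (auto simp: restr_def split: if_splits)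
    \<comment> \<open>Agreement of the place with the point passes from the generators to sums and
      products, hence to all \<open>n b\<close> and \<open>m b\<close>.\<close>
    define Z where "Z = {z \<in> A \<inter> F. \<zeta> z = Some (\<phi> z)}"
    have op: "\<zeta> (x + y) = Some (p + q) \<and> \<zeta> (x * y) = Some (p * q)"
      if "x \<in> F" "y \<in> F" "\<zeta> x = Some p" "\<zeta> y = Some q" for x y p q
      using pl that unfolding is_place_def by force
    have "subalg Z"
      unfolding subalg_def
    proof (intro conjI ballI subsetI)
      fix z :: 'a assume "z \<in> range of_real"
      then obtain s where "z = of_real s" by blast
      then show "z \<in> Z"
        using base[of z] subalg_of_real[OF subalg_alg[of G1], of s] subalg_of_real[OF A] subalg_of_real[OF sF] by (simp add: Z_def)
    next
      fix x y assume "x \<in> Z" "y \<in> Z"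
      then have xy: "x \<in> A" "y \<in> A" "x \<in> F" "y \<in> F" "\<zeta> x = Some (\<phi> x)" "\<zeta> y = Some (\<phi> y)" by (auto simp: Z_def)
      then show "x + y \<in> Z" "x * y \<in> Z"
        using op[OF xy(3-6)] alg_hom_add[OF \<phi>(1) xy(1,2)] alg_hom_mult[OF \<phi>(1) xy(1,2)]
          subalg_add[OF A] subalg_mult[OF A] subalg_add[OF sF] subalg_mult[OF sF] by (simp_all add: Z_def)
    qed
    moreover have "G1 \<union> G2 \<subseteq> Z"
      using base alg_superset[of G1] alg_superset[of G2] sub G(3,4) FR(2,3) by (auto simp: Z_def)
    ultimately have "alg (G1 \<union> G2) \<subseteq> Z" by (rule alg_least)
    moreover have "alg Y \<subseteq> alg (G1 \<union> G2)" using Y(2) by (intro alg_mono) (auto simp: G1_def G2_def)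
    ultimately have YZ: "alg Y \<subseteq> Z" by blast
    have nmZ: "n b \<in> F" "m b \<in> F" "\<zeta> (n b) = Some (\<phi> (n b))" "\<zeta> (m b) = Some (\<phi> (m b))"
      using YZ Y(3) b by (auto simp: Z_def)
    have b_eq: "b * m b = n b" "m b \<noteq> 0" using nm[OF b] by (metis nonzero_eq_divide_eq, blast)
    have bF: "b \<in> F" using \<xi>(3) b by blast
    have "sg P (n b) = sg P (m b)"
      using P.sg_mult[OF bF nmZ(2)] Bpos[OF b] b_eq(1) by simp
    then have same: "sgn (\<phi> (n b)) = sgn (\<phi> (m b))" "sgn (\<phi> (m b)) \<noteq> 0"
      using \<phi>(2)[of "n b"] \<phi>(2)[of "m b"] b b_eq(2) by (auto simp: S_def)
    \<comment> \<open>An infinite \<open>b\<close> would give \<open>m b\<close>, which is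
      \<open>inverse b * n b\<close>, the value 0.\<close>
    have "\<zeta> b \<noteq> None"
    proof
      assume "\<zeta> b = None"
      then have "\<zeta> (inverse b) = Some 0" using pl bF unfolding is_place_def by blast
      then have "\<zeta> (inverse b * n b) = Some (0 * \<phi> (n b))"
        using op[OF R_subfield_inverse[OF FR(1) bF] nmZ(1) _ nmZ(3)] by blast
      moreover have "inverse b * n b = m b"
        unfolding b_eq(1)[symmetric] using Bpos[OF b] by (cases "b = 0") (simp_all add: sg_def)
      ultimately show False using nmZ(4) same(2) by simp
    qed
    then obtain q where q: "\<zeta> b = Some q" by blast
    then have "\<zeta> (b * m b) = Some (q * \<phi> (m b))" using op[OF bF nmZ(2) _ nmZ(4)] by blast
    then have "q * \<phi> (m b) = \<phi> (n b)" using b_eq(1) nmZ(3) by simp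
    then have "sgn q * sgn (\<phi> (m b)) = sgn (\<phi> (m b))" using same(1) by (metis sgn_mult)
    then have "sgn q = 1" using same(2) by simp
    then have "q > 0" by (simp add: sgn_1_pos)
    then show ?thesis using \<zeta>(1) q by (simp add: H'_def)
  qed
  obtain t1 where t1: "pos_infinitesimal F1 P1 t1" by (rule exists_pos_infinitesimal[OF P1(1) x1])
  obtain t2 where t2: "pos_infinitesimal F2 P2 t2" by (rule exists_pos_infinitesimal[OF P2(1) x2])
  have "\<exists>\<zeta>. \<zeta> \<in> M F \<and> rho F1 F2 \<zeta> = (\<zeta>1, \<zeta>2) \<and> \<zeta> (t1 / t2) = Some c" if c: "c > 0" for c
  proof -
    obtain T where T: "field_ordering F T" "P1 \<subseteq> T" "P2 \<subseteq> T" "infinitely_near T (t1 / t2) c"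
      by (rule joint_ordering[OF P1(1) t1 P2(1) t2 ld c, folded F])
    interpret T: ordered_R_field F T by unfold_locales (rule T)
    have "t1 \<in> F" "t2 \<in> F" using t1 t2 FR by (auto simp: pos_infinitesimal_def)
    then have "t1 / t2 \<in> F" by (rule R_subfield_divide[OF FR(1)])
    then have "place_of F T (t1 / t2) = Some c" using T(4) by (simp add: T.place_of_eq_Some)
    moreover have "rho F1 F2 (place_of F T) = (\<zeta>1, \<zeta>2)"
      unfolding rho_def \<zeta>1_def \<zeta>2_def
      using restr_place_of[OF T(1) P1(1) FR(2) T(2)] restr_place_of[OF T(1) P2(1) FR(3) T(3)] by simp
    ultimately show ?thesis using T.place_of_in_M by blast
  qed
  then obtain Z where Z: "\<And>c. c > 0 \<Longrightarrow> Z c \<in> M F \<and> rho F1 F2 (Z c) = (\<zeta>1, \<zeta>2) \<and> Z c (t1 / t2) = Some c"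
    by metis
  have inj: "inj_on Z {0<..}"
  proof (rule inj_onI)
    fix c c' :: real assume c: "c \<in> {0<..}" "c' \<in> {0<..}" and eq: "Z c = Z c'"
    have "Z c (t1 / t2) = Some c" "Z c' (t1 / t2) = Some c'"
      using conjunct2[OF conjunct2[OF Z]] c unfolding greaterThan_iff by blast+
    then have "Some c = Some c'" by (simp only: eq)
    then show "c = c'" by simp
  qed
  have "infinite (Z ` {0<..})"
  proof
    assume "finite (Z ` {0<..})"
    then have "finite {0::real<..}" using inj by (rule finite_imageD)
    then show False by (rule notE[OF infinite_Ioi])
  qed
  moreover have "Z ` {0<..} \<subseteq> {\<zeta> \<in> M F. rho F1 F2 \<zeta> = (\<zeta>1, \<zeta>2)}" using Z by auto
  ultimately have "infinite {\<zeta> \<in> M F. rho F1 F2 \<zeta> = (\<zeta>1, \<zeta>2)}" by (rule infinite_super[rotated])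
  moreover have "\<forall>b\<in>B. \<forall>\<zeta>\<in>M F. rho F1 F2 \<zeta> = (\<zeta>1, \<zeta>2) \<longrightarrow> \<zeta> \<in> H' F b" by (intro ballI impI over)
  moreover have "\<zeta>1 \<in> M F1" "\<zeta>2 \<in> M F2"
    unfolding \<zeta>1_def \<zeta>2_def by (rule P1.place_of_in_M P2.place_of_in_M)+
  ultimately show ?thesis by (intro bexI[of _ \<zeta>1] bexI[of _ \<zeta>2] conjI)
qed

section \<open>Basic neighbourhoods in the topology of places\<close>

lemma M_top_basis:
  assumes "openin (M_top F) W" "\<xi> \<in> W"
  shows "\<exists>B. finite B \<and> B \<subseteq> F \<and> (\<forall>b\<in>B. \<xi> \<in> H' F b) \<and> (\<forall>\<zeta>\<in>M F. (\<forall>b\<in>B. \<zeta> \<in> H' F b) \<longrightarrow> \<zeta> \<in> W)"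
proof -
  define nb where "nb \<xi> W B \<longleftrightarrow> finite B \<and> B \<subseteq> F \<and> (\<forall>b\<in>B. \<xi> \<in> H' F b) \<and>
    (\<forall>\<zeta>\<in>M F. (\<forall>b\<in>B. \<zeta> \<in> H' F b) \<longrightarrow> \<zeta> \<in> W)" for \<xi> W B
  have "generate_topology_on {H' F b |b. b \<in> F} W"
    using assms(1) unfolding M_top_def openin_topology_generated_by_iff .
  then have "\<forall>\<xi>\<in>W. \<exists>B. nb \<xi> W B"
  proof induction
    case (Int U V)
    show ?case
    proof
      fix \<xi> assume \<xi>: "\<xi> \<in> U \<inter> V"
      obtain B where "nb \<xi> U B" using Int.IH(1) \<xi> by blast
      moreover obtain C where "nb \<xi> V C" using Int.IH(2) \<xi> by blast
      ultimately have "nb \<xi> (U \<inter> V) (B \<union> C)" unfolding nb_def by (simp add: ball_Un)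
      then show "\<exists>B. nb \<xi> (U \<inter> V) B" by blast
    qed
  next
    case (UN \<U>)
    show ?case
    proof
      fix \<xi> assume "\<xi> \<in> \<Union>\<U>"
      then obtain U where U: "U \<in> \<U>" "\<xi> \<in> U" by blast
      then obtain B where "nb \<xi> U B" using UN.IH by blast
      then have "nb \<xi> (\<Union>\<U>) B" using U(1) unfolding nb_def by (metis UnionI)
      then show "\<exists>B. nb \<xi> (\<Union>\<U>) B" by blast
    qed
  next
    case (Basis s)
    then obtain b where "b \<in> F" "s = H' F b" by blast
    then show ?case by (intro ballI exI[of _ "{b}"]) (simp add: nb_def)
  qed simp
  then show ?thesis using assms(2) unfolding nb_def by simp
qed

theorem theorem8p2:
  fixes F1 F2 :: "'a::real_field set"
    and \<iota> :: "'a place \<times> 'a place \<Rightarrow> 'a place"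
  assumes "function_field F1" and "function_field F2"
    and "trdeg_ge_1 F1" and "trdeg_ge_1 F2"
    and "linearly_disjoint F1 F2"
    and "compatible_embedding F1 F2 (field_gen (F1 \<union> F2)) \<iota>"
  shows "(M_top (field_gen (F1 \<union> F2))) closure_of (\<iota> ` (M F1 \<times> M F2))
           = topspace (M_top (field_gen (F1 \<union> F2))) \<and>
         (\<forall>U. basic_open (field_gen (F1 \<union> F2)) U \<and> U \<noteq> {} \<longrightarrow>
           infinite (U - \<iota> ` (M F1 \<times> M F2)))"
proof (intro conjI allI impI)
  define F where "F = field_gen (F1 \<union> F2)"
  note fibre = basic_open_contains_fibre[OF assms(1-5) F_def]
  have \<iota>: "\<iota> p \<in> M F" "rho F1 F2 (\<iota> p) = p" if "p \<in> M F1 \<times> M F2" for p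
    using assms(6) that unfolding compatible_embedding_def F_def by blast+
  have top: "topspace (M_top F) \<subseteq> M F"
    unfolding M_top_def topology_generated_by_topspace H'_def by blast
  show "M_top (field_gen (F1 \<union> F2)) closure_of (\<iota> ` (M F1 \<times> M F2)) = topspace (M_top (field_gen (F1 \<union> F2)))"
    unfolding F_def[symmetric]
  proof (rule antisym[OF closure_of_subset_topspace], rule subsetI)
    fix \<xi> assume \<xi>: "\<xi> \<in> topspace (M_top F)"
    show "\<xi> \<in> M_top F closure_of (\<iota> ` (M F1 \<times> M F2))"
      unfolding in_closure_of
    proof (intro conjI allI impI \<xi>)
      fix W assume W: "\<xi> \<in> W \<and> openin (M_top F) W"
      obtain B where B: "finite B" "B \<subseteq> F" "\<forall>b\<in>B. \<xi> \<in> H' F b"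
        "\<forall>\<zeta>\<in>M F. (\<forall>b\<in>B. \<zeta> \<in> H' F b) \<longrightarrow> \<zeta> \<in> W"
        using M_top_basis[OF conjunct2[OF W] conjunct1[OF W]] by (elim exE conjE)
      have "\<xi> \<in> M F" using \<xi> top by blast
      from fibre[OF this B(1,2) B(3)] obtain \<zeta>1 \<zeta>2 where \<zeta>: "\<zeta>1 \<in> M F1" "\<zeta>2 \<in> M F2"
        "\<forall>b\<in>B. \<forall>\<zeta>\<in>M F. rho F1 F2 \<zeta> = (\<zeta>1, \<zeta>2) \<longrightarrow> \<zeta> \<in> H' F b"
        by (elim bexE conjE)
      have p: "(\<zeta>1, \<zeta>2) \<in> M F1 \<times> M F2" using \<zeta>(1,2) by simp
      have "\<forall>b\<in>B. \<iota> (\<zeta>1, \<zeta>2) \<in> H' F b" using \<zeta>(3) \<iota>[OF p] by simp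
      then have "\<iota> (\<zeta>1, \<zeta>2) \<in> W" using \<iota>(1)[OF p] B(4) by simp
      then show "\<exists>\<zeta>. \<zeta> \<in> \<iota> ` (M F1 \<times> M F2) \<and> \<zeta> \<in> W" using p by blast
    qed
  qed
  fix U assume "basic_open (field_gen (F1 \<union> F2)) U \<and> U \<noteq> {}"
  then obtain B \<xi> where B: "finite B" "B \<subseteq> F" "U = M F \<inter> \<Inter> (H' F ` B)" "\<xi> \<in> U"
    unfolding basic_open_def F_def by blast
  have "\<xi> \<in> M F" and "\<forall>b\<in>B. \<xi> \<in> H' F b" using B(3,4) by simp_all
  from fibre[OF this(1) B(1,2) this(2)] obtain \<zeta>1 \<zeta>2 where \<zeta>: "\<zeta>1 \<in> M F1" "\<zeta>2 \<in> M F2"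
    "\<forall>b\<in>B. \<forall>\<zeta>\<in>M F. rho F1 F2 \<zeta> = (\<zeta>1, \<zeta>2) \<longrightarrow> \<zeta> \<in> H' F b"
    "infinite {\<zeta> \<in> M F. rho F1 F2 \<zeta> = (\<zeta>1, \<zeta>2)}" by (elim bexE conjE)
  \<comment> \<open>As \<open>rho\<close> recovers the argument of \<open>\<iota>\<close>, a place
    of the fibre that lies in the image can only be the image of \<open>(\<zeta>1, \<zeta>2)\<close>
    itself.\<close>
  have "{\<zeta> \<in> M F. rho F1 F2 \<zeta> = (\<zeta>1, \<zeta>2)} - {\<iota> (\<zeta>1, \<zeta>2)} \<subseteq> U - \<iota> ` (M F1 \<times> M F2)"
  proof
    fix \<zeta> assume z: "\<zeta> \<in> {\<zeta> \<in> M F. rho F1 F2 \<zeta> = (\<zeta>1, \<zeta>2)} - {\<iota> (\<zeta>1, \<zeta>2)}"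
    then have "\<zeta> \<in> U" using \<zeta>(3) B(3) by simp
    moreover have "\<zeta> \<notin> \<iota> ` (M F1 \<times> M F2)"
    proof
      assume "\<zeta> \<in> \<iota> ` (M F1 \<times> M F2)"
      then obtain p where p: "p \<in> M F1 \<times> M F2" "\<zeta> = \<iota> p" by blast
      then have "p = (\<zeta>1, \<zeta>2)" using z \<iota>(2)[OF p(1)] by simp
      then show False using z p(2) by simp
    qed
    ultimately show "\<zeta> \<in> U - \<iota> ` (M F1 \<times> M F2)" by blast
  qed
  moreover have "infinite ({\<zeta> \<in> M F. rho F1 F2 \<zeta> = (\<zeta>1, \<zeta>2)} - {\<iota> (\<zeta>1, \<zeta>2)})"
    using \<zeta>(4) by simp
  ultimately show "infinite (U - \<iota> ` (M F1 \<times> M F2))" by (rule infinite_super)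
qed

end
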